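(* Let $n\ge 3$ be even, $N\in\mathbb{N}$, $p\in\{0,\dots,\tfrac n2\}$, $\beta=n-2p$, and let $(M,h)$ be an oriented $n$-dimensional Einstein manifold with $Ric(h)=\tfrac{2J}{n}(n-1)h$, $J\in\mathbb{R}$ constant. Let $L^{(p)}_{2N}:\Omega^p(M)\to\Omega^p(M)$ be the Branson–Gover operator of order $2N$. (1) Let $\beta=2l$ for some $l\in\{1,\dots,N-1\}$. Then $$L^{(p)}_{2N}=-\tfrac{2l}{2l-1}\,\widetilde P^{(p)}\times\prod_{k=1,\,k\neq l,l+1}^{N}\big[\tfrac{l+k}{l+k-1}\delta^hd+\tfrac{l-k}{l-k+1}d\delta^h+(l-k)(l+k)\tfrac{2J}{n}\big],$$ where $\widetilde P^{(p)}:=\big[\tfrac{2l+1}{2}\delta^hd+\tfrac{2l-1}{2}d\delta^h\big]\big[d\delta^h-\delta^hd+2l\tfrac{2J}{n}\big]$ is a fourth-order differential operator. (2) Let $\beta=0$. Then $$L^{(p)}_{2N}=N\big[\delta^hd-d\delta^h\big]\times\prod_{k=2}^N\big[\delta^hd+d\delta^h-k(k-1)\tfrac{2J}{n}\big].$$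
   Context: $\delta^h$ is the codifferential of $(M,h)$ (formal adjoint of $d$). $(a)_0=1$, $(a)_k=a(a+1)\cdots(a+k-1)$. For $k\ge0$: $R_k(y;\alpha)=\prod_{l=1}^k[y-(\alpha-l)(\alpha-l+1)]$, $R_0=1$; $R^{(1)}_k(y)=\sum_{j=1}^k(\tfrac\beta2-k+j+1)_{2(k-j)}[y-\tfrac\beta2(\tfrac\beta2+1)]R_{j-1}(y;k)$, $R^{(1)}_0=0$. Put $y^{(+)}=\tfrac{n}{2J}\delta^hd+\tfrac\beta2(\tfrac\beta2-1)$, $y^{(1)}=\tfrac{n}{2J}d\delta^h+\tfrac\beta2(\tfrac\beta2+1)$. The Branson–Gover operator of order $2N$ on $p$-forms of the Einstein manifold is $$L^{(p)}_{2N}=(\tfrac{2J}{n})^N\Big[(\tfrac\beta2+N)R_N(y^{(+)};0)+(\tfrac\beta2-N)R^{(1)}_N(y^{(1)})\Big].$$ For $J=0$ this is understood after multiplying out the powers of $\tfrac{2J}{n}$ (it is polynomial in $J$). *)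

theory Defs
  imports
    "HOL-Analysis.Analysis"
    "HOL-Computational_Algebra.Polynomial"
    "HOL-Library.Function_Algebras"
begin

section \<open>Smooth functions on open subsets of Euclidean space\<close>

definition pd :: "'n::finite \<Rightarrow> (real^'n \<Rightarrow> real) \<Rightarrow> real^'n \<Rightarrow> real" where
  "pd i f x = frechet_derivative f (at x) (axis i 1)"

fun Ck_on :: "nat \<Rightarrow> (real^'n::finite) set \<Rightarrow> (real^'n \<Rightarrow> real) \<Rightarrow> bool" where
  "Ck_on 0 S f \<longleftrightarrow> continuous_on S f"
| "Ck_on (Suc k) S f \<longleftrightarrow> f differentiable_on S \<and> (\<forall>i. Ck_on k S (pd i f))"

text \<open>Only used for open \<open>S\<close>.\<close>

definition smooth_on :: "(real^'n::finite) set \<Rightarrow> (real^'n \<Rightarrow> real) \<Rightarrow> bool" where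
  "smooth_on S f \<longleftrightarrow> (\<forall>k. Ck_on k S f)"


section \<open>Oriented smooth manifolds\<close>

text \<open>The manifold is the whole (Hausdorff, second countable) type \<open>'m\<close>; its dimension is
  \<open>CARD('n)\<close>. A chart is a domain together with a coordinate map, whose values outside the
  domain are irrelevant.\<close>

type_synonym ('m, 'n) chart = "'m set \<times> ('m \<Rightarrow> real^'n)"

definition cdom :: "('m, 'n::finite) chart \<Rightarrow> 'm set" where "cdom c = fst c"
definition cmap :: "('m, 'n::finite) chart \<Rightarrow> 'm \<Rightarrow> real^'n" where "cmap c = snd c"
definition cimg :: "('m, 'n::finite) chart \<Rightarrow> (real^'n) set" where "cimg c = cmap c ` cdom c"
definition cinv :: "('m, 'n::finite) chart \<Rightarrow> real^'n \<Rightarrow> 'm" where "cinv c = inv_into (cdom c) (cmap c)"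

definition overlap :: "('m, 'n::finite) chart \<Rightarrow> ('m, 'n::finite) chart \<Rightarrow> (real^'n) set" where
  "overlap c c' = cmap c ` (cdom c \<inter> cdom c')"

definition trans_map :: "('m, 'n::finite) chart \<Rightarrow> ('m, 'n::finite) chart \<Rightarrow> real^'n \<Rightarrow> real^'n" where
  "trans_map c c' = cmap c' \<circ> cinv c"

definition trans_deriv ::
  "('m, 'n::finite) chart \<Rightarrow> ('m, 'n::finite) chart \<Rightarrow> real^'n \<Rightarrow> real^'n \<Rightarrow> real^'n" where
  "trans_deriv c c' x = frechet_derivative (trans_map c c') (at x)"

text \<open>An orientation is given by an atlas whose transition maps preserve the orientation
  of \<open>real^'n\<close>.\<close>

definition oriented_smooth_atlas ::
  "('m::{t2_space, second_countable_topology}, 'n::finite) chart set \<Rightarrow> bool" where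
  "oriented_smooth_atlas \<A> \<longleftrightarrow>
     (\<Union>c\<in>\<A>. cdom c) = UNIV \<and>
     (\<forall>c\<in>\<A>. open (cdom c) \<and> open (cimg c) \<and> homeomorphism (cdom c) (cimg c) (cmap c) (cinv c)) \<and>
     (\<forall>c\<in>\<A>. \<forall>c'\<in>\<A>.
        (\<forall>i. smooth_on (overlap c c') (\<lambda>x. trans_map c c' x $ i)) \<and>
        (\<forall>x\<in>overlap c c'. det (matrix (trans_deriv c c' x)) > 0))"

definition smooth_funs :: "('m, 'n::finite) chart set \<Rightarrow> ('m \<Rightarrow> real) set" where
  "smooth_funs \<A> = {f. \<forall>c\<in>\<A>. smooth_on (cimg c) (f \<circ> cinv c)}"


section \<open>Differential forms\<close>

text \<open>A form is given by its local representatives: \<open>\<omega> c x [v\<^sub>1, \<dots>, v\<^sub>p]\<close> is the value of \<open>\<omega>\<close> in the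
  chart \<open>c\<close> at the coordinate point \<open>x\<close> on the tangent vectors with coordinates
  \<open>v\<^sub>1, \<dots>, v\<^sub>p\<close>. Representatives in different charts are related by pullback along the transition
  maps. They vanish off their proper domain, so that equality of forms is equality in HOL.\<close>

type_synonym ('m, 'n) form = "('m, 'n) chart \<Rightarrow> real^'n \<Rightarrow> (real^'n) list \<Rightarrow> real"

definition forms :: "('m, 'n::finite) chart set \<Rightarrow> nat \<Rightarrow> ('m, 'n::finite) form set" where
  "forms \<A> p = {\<omega>.
     (\<forall>c x vs. c \<notin> \<A> \<or> x \<notin> cimg c \<or> length vs \<noteq> p \<longrightarrow> \<omega> c x vs = 0) \<and>
     (\<forall>c\<in>\<A>. \<forall>vs. length vs = p \<longrightarrow> smooth_on (cimg c) (\<lambda>x. \<omega> c x vs)) \<and>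
     (\<forall>c\<in>\<A>. \<forall>x\<in>cimg c. \<forall>vs. length vs = p \<longrightarrow>
        (\<forall>i<p. linear (\<lambda>v. \<omega> c x (vs[i := v]))) \<and>
        (\<forall>i<p. \<forall>j<p. i \<noteq> j \<and> vs ! i = vs ! j \<longrightarrow> \<omega> c x vs = 0)) \<and>
     (\<forall>c\<in>\<A>. \<forall>c'\<in>\<A>. \<forall>x\<in>overlap c c'. \<forall>vs. length vs = p \<longrightarrow>
        \<omega> c x vs = \<omega> c' (trans_map c c' x) (map (trans_deriv c c' x) vs))}"

text \<open>\<open>(d\<omega>)(v\<^sub>0, \<dots>, v\<^sub>p) = \<Sum>j. (-1)^j D\<^bsub>v\<^sub>j\<^esub> (\<omega>(v\<^sub>0, \<dots>, v\<^sub>p without v\<^sub>j))\<close> for coordinate-constant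
  \<open>v\<^sub>0, \<dots>, v\<^sub>p\<close>; the degree is read off from the number of arguments.\<close>

definition ext_d :: "('m, 'n::finite) chart set \<Rightarrow> ('m, 'n::finite) form \<Rightarrow> ('m, 'n::finite) form" where
  "ext_d \<A> \<omega> = (\<lambda>c x vs. if c \<in> \<A> \<and> x \<in> cimg c then
     (\<Sum>j<length vs. (-1)^j *
        frechet_derivative (\<lambda>y. \<omega> c y (take j vs @ drop (Suc j) vs)) (at x) (vs ! j))
     else 0)"

definition form_supp :: "('m::topological_space, 'n::finite) chart set \<Rightarrow> ('m, 'n::finite) form \<Rightarrow> 'm set" where
  "form_supp \<A> \<omega> = closure {m. \<exists>c\<in>\<A>. m \<in> cdom c \<and> (\<exists>vs. \<omega> c (cmap c m) vs \<noteq> 0)}"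

definition fmult :: "('m \<Rightarrow> real) \<Rightarrow> ('m, 'n::finite) form \<Rightarrow> ('m, 'n::finite) form" where
  "fmult f \<omega> = (\<lambda>c x vs. f (cinv c x) * \<omega> c x vs)"

definition fscale :: "real \<Rightarrow> ('m, 'n::finite) form \<Rightarrow> ('m, 'n::finite) form" where
  "fscale a \<omega> = (\<lambda>c x vs. a * \<omega> c x vs)"


section \<open>Riemannian metrics, Ricci curvature\<close>

type_synonym ('m, 'n) metric = "('m, 'n) chart \<Rightarrow> real^'n \<Rightarrow> real^'n^'n"

definition riemannian_metric :: "('m, 'n::finite) chart set \<Rightarrow> ('m, 'n::finite) metric \<Rightarrow> bool" where
  "riemannian_metric \<A> h \<longleftrightarrow>
     (\<forall>c\<in>\<A>. (\<forall>i j. smooth_on (cimg c) (\<lambda>x. h c x $ i $ j)) \<and>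
        (\<forall>x\<in>cimg c. transpose (h c x) = h c x \<and> (\<forall>v. v \<noteq> 0 \<longrightarrow> v \<bullet> (h c x *v v) > 0))) \<and>
     (\<forall>c\<in>\<A>. \<forall>c'\<in>\<A>. \<forall>x\<in>overlap c c'.
        h c x = transpose (matrix (trans_deriv c c' x)) ** h c' (trans_map c c' x)
                  ** matrix (trans_deriv c c' x))"

definition christoffel ::
  "('m, 'n::finite) metric \<Rightarrow> ('m, 'n::finite) chart \<Rightarrow> 'n \<Rightarrow> 'n \<Rightarrow> 'n \<Rightarrow> real^'n \<Rightarrow> real" where
  "christoffel h c k i j x = (1/2) * (\<Sum>l\<in>UNIV. matrix_inv (h c x) $ k $ l *
     (pd i (\<lambda>y. h c y $ j $ l) x + pd j (\<lambda>y. h c y $ i $ l) x - pd l (\<lambda>y. h c y $ i $ j) x))"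

text \<open>The sign is such that round spheres have positive Ricci curvature.\<close>

definition ricci ::
  "('m, 'n::finite) metric \<Rightarrow> ('m, 'n::finite) chart \<Rightarrow> 'n \<Rightarrow> 'n \<Rightarrow> real^'n \<Rightarrow> real" where
  "ricci h c i j x = (\<Sum>k\<in>UNIV.
      pd k (christoffel h c k i j) x - pd j (christoffel h c k i k) x
      + (\<Sum>l\<in>UNIV. christoffel h c k k l x * christoffel h c l i j x
                  - christoffel h c k j l x * christoffel h c l i k x))"

definition einstein :: "('m, 'n::finite) chart set \<Rightarrow> ('m, 'n::finite) metric \<Rightarrow> real \<Rightarrow> bool" where
  "einstein \<A> h K \<longleftrightarrow>
     (\<forall>c\<in>\<A>. \<forall>x\<in>cimg c. \<forall>i j. ricci h c i j x = K * h c x $ i $ j)"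


section \<open>The codifferential\<close>

text \<open>The Borel measure given by \<open>sqrt (det h) dx\<close> in every chart; as \<open>\<A>\<close> has a countable subcover,
  this determines it.\<close>

definition riemannian_volume ::
  "('m::topological_space, 'n::finite) chart set \<Rightarrow> ('m, 'n::finite) metric \<Rightarrow> 'm measure \<Rightarrow> bool" where
  "riemannian_volume \<A> h vol \<longleftrightarrow> sets vol = sets borel \<and>
     (\<forall>c\<in>\<A>. \<forall>A\<in>sets borel. A \<subseteq> cdom c \<longrightarrow>
        emeasure vol A = (\<integral>\<^sup>+x. ennreal (sqrt (det (h c x))) * indicator (cmap c ` A) x \<partial>lborel))"

text \<open>\<open>(1/p!) h\<^bsup>i\<^sub>1j\<^sub>1\<^esup> \<dots> h\<^bsup>i\<^sub>pj\<^sub>p\<^esup> \<omega>\<^bsub>i\<^sub>1\<dots>i\<^sub>p\<^esub> \<eta>\<^bsub>j\<^sub>1\<dots>j\<^sub>p\<^esub>\<close>, the inner product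
  for which \<open>e\<^bsub>i\<^sub>1\<^esub> \<and> \<dots> \<and> e\<^bsub>i\<^sub>p\<^esub>\<close> (\<open>i\<^sub>1 < \<dots> < i\<^sub>p\<close>) is orthonormal whenever
  \<open>(e\<^sub>i)\<close> is an orthonormal coframe.\<close>

definition form_inner_at ::
  "('m, 'n::finite) metric \<Rightarrow> nat \<Rightarrow> ('m, 'n::finite) form \<Rightarrow> ('m, 'n::finite) form
    \<Rightarrow> ('m, 'n::finite) chart \<Rightarrow> real^'n \<Rightarrow> real" where
  "form_inner_at h p \<omega> \<eta> c x = (1 / fact p) *
     (\<Sum>I\<in>{I. length I = p}. \<Sum>I'\<in>{I. length I = p}.
        (\<Prod>k<p. matrix_inv (h c x) $ (I ! k) $ (I' ! k)) *
        \<omega> c x (map (\<lambda>i. axis i 1) I) * \<eta> c x (map (\<lambda>i. axis i 1) I'))"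

text \<open>The pointwise inner product of forms does not depend on the chart, so any chart around the
  point may be chosen.\<close>

definition form_inner ::
  "('m, 'n::finite) chart set \<Rightarrow> ('m, 'n::finite) metric \<Rightarrow> nat \<Rightarrow> ('m, 'n::finite) form \<Rightarrow> ('m, 'n::finite) form
    \<Rightarrow> 'm \<Rightarrow> real" where
  "form_inner \<A> h p \<omega> \<eta> m =
     (let c = (SOME c. c \<in> \<A> \<and> m \<in> cdom c) in form_inner_at h p \<omega> \<eta> c (cmap c m))"

text \<open>Like \<open>ext_d\<close>, the codifferential is a single operator for all degrees; it is determined on
  each \<open>forms \<A> p\<close> by being formally adjoint to \<open>ext_d\<close>.\<close>

definition codifferential ::
  "('m::topological_space, 'n::finite) chart set \<Rightarrow> ('m, 'n::finite) metric \<Rightarrow> 'm measure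
    \<Rightarrow> (('m, 'n::finite) form \<Rightarrow> ('m, 'n::finite) form) \<Rightarrow> bool" where
  "codifferential \<A> h vol \<delta> \<longleftrightarrow>
     (\<forall>\<eta>\<in>forms \<A> 0. \<delta> \<eta> = 0) \<and>
     (\<forall>p. \<forall>\<eta>\<in>forms \<A> (Suc p). \<delta> \<eta> \<in> forms \<A> p \<and>
        (\<forall>\<omega>\<in>forms \<A> p. compact (form_supp \<A> \<omega>) \<or> compact (form_supp \<A> \<eta>) \<longrightarrow>
           (LINT m|vol. form_inner \<A> h (Suc p) (ext_d \<A> \<omega>) \<eta> m) =
           (LINT m|vol. form_inner \<A> h p \<omega> (\<delta> \<eta>) m)))"


section \<open>Operators on forms\<close>

text \<open>Sums of operators are pointwise sums.\<close>

type_synonym ('m, 'n) operator = "('m, 'n) form \<Rightarrow> ('m, 'n) form"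

definition oscale :: "real \<Rightarrow> ('m, 'n::finite) operator \<Rightarrow> ('m, 'n::finite) operator"  (infixr "*\<^sub>o" 75) where
  "a *\<^sub>o A = (\<lambda>\<omega>. fscale a (A \<omega>))"

text \<open>\<open>F k\<^sub>1 \<circ> \<dots> \<circ> F k\<^sub>r\<close> for \<open>ks = [k\<^sub>1, \<dots>, k\<^sub>r]\<close>\<close>

definition oprod :: "('k \<Rightarrow> ('m, 'n::finite) operator) \<Rightarrow> 'k list \<Rightarrow> ('m, 'n::finite) operator" where
  "oprod F ks = foldr (\<circ>) (map F ks) id"

definition opoly :: "real poly \<Rightarrow> ('m, 'n::finite) operator \<Rightarrow> ('m, 'n::finite) operator" where
  "opoly P A = (\<Sum>i\<le>degree P. coeff P i *\<^sub>o (A ^^ i))"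

definition linear_op ::
  "('m, 'n::finite) chart set \<Rightarrow> nat \<Rightarrow> nat \<Rightarrow> ('m, 'n::finite) operator \<Rightarrow> bool" where
  "linear_op \<A> p q D \<longleftrightarrow>
     (\<forall>\<omega>\<in>forms \<A> p. D \<omega> \<in> forms \<A> q) \<and>
     (\<forall>\<omega>\<in>forms \<A> p. \<forall>\<eta>\<in>forms \<A> p. D (\<omega> + \<eta>) = D \<omega> + D \<eta>) \<and>
     (\<forall>a. \<forall>\<omega>\<in>forms \<A> p. D (fscale a \<omega>) = fscale a (D \<omega>))"

text \<open>\<open>diff_op \<A> p q k D\<close>: \<open>D\<close> is a linear differential operator from \<open>p\<close>-forms to \<open>q\<close>-forms of
  order at most \<open>k\<close>, in the usual recursive sense: it has order \<open>0\<close> if it is linear over the smooth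
  functions, and order at most \<open>k + 1\<close> if its commutators with multiplications by smooth functions
  have order at most \<open>k\<close>.\<close>

fun diff_op ::
  "('m, 'n::finite) chart set \<Rightarrow> nat \<Rightarrow> nat \<Rightarrow> nat \<Rightarrow> ('m, 'n::finite) operator \<Rightarrow> bool" where
  "diff_op \<A> p q 0 D \<longleftrightarrow> linear_op \<A> p q D \<and>
     (\<forall>f\<in>smooth_funs \<A>. \<forall>\<omega>\<in>forms \<A> p. D (fmult f \<omega>) = fmult f (D \<omega>))"
| "diff_op \<A> p q (Suc k) D \<longleftrightarrow> linear_op \<A> p q D \<and>
     (\<forall>f\<in>smooth_funs \<A>. diff_op \<A> p q k (\<lambda>\<omega>. D (fmult f \<omega>) - fmult f (D \<omega>)))"

definition diff_op_of_order ::
  "('m, 'n::finite) chart set \<Rightarrow> nat \<Rightarrow> nat \<Rightarrow> nat \<Rightarrow> ('m, 'n::finite) operator \<Rightarrow> bool" where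
  "diff_op_of_order \<A> p q k D \<longleftrightarrow> diff_op \<A> p q k D \<and> (\<forall>j<k. \<not> diff_op \<A> p q j D)"


section \<open>Branson--Gover operators\<close>

text \<open>\<open>R_poly k \<alpha>\<close> is \<open>R\<^sub>k(y; \<alpha>)\<close> and \<open>R1_poly \<beta> k\<close> is \<open>R\<^sup>(\<^sup>1\<^sup>)\<^sub>k(y)\<close>, as polynomials in \<open>y\<close>.\<close>

definition R_poly :: "nat \<Rightarrow> real \<Rightarrow> real poly" where
  "R_poly k \<alpha> = (\<Prod>l=1..k. [: - ((\<alpha> - real l) * (\<alpha> - real l + 1)), 1 :])"

definition R1_poly :: "real \<Rightarrow> nat \<Rightarrow> real poly" where
  "R1_poly \<beta> k = (\<Sum>j=1..k. smult (pochhammer (\<beta>/2 - real k + real j + 1) (2 * (k - j)))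
     ([: - (\<beta>/2 * (\<beta>/2 + 1)), 1 :] * R_poly (j - 1) (real k)))"

text \<open>\<open>t^N P(z/t + s)\<close>, multiplied out as a polynomial in \<open>z\<close> and \<open>t\<close> (for \<open>degree P \<le> N\<close>); this
  makes sense for \<open>t = 0\<close> too.\<close>

definition hom_poly :: "nat \<Rightarrow> real \<Rightarrow> real \<Rightarrow> real poly \<Rightarrow> real poly" where
  "hom_poly N t s P = (\<Sum>i\<le>N. monom (t ^ (N - i) * coeff (pcompose P [: s, 1 :]) i) i)"

lemma poly_hom_poly:
  assumes "degree P \<le> N" "t \<noteq> 0"
  shows "poly (hom_poly N t s P) z = t ^ N * poly P (z / t + s)"
proof -
  let ?Q = "pcompose P [: s, 1 :]"
  have deg: "degree ?Q \<le> N" using assms(1) by (simp add: degree_pcompose)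
  have "poly P (z / t + s) = poly ?Q (z / t)"
    by (simp add: poly_pcompose add.commute)
  also have "\<dots> = (\<Sum>i\<le>N. coeff ?Q i * (z / t) ^ i)"
    unfolding poly_altdef using deg
    by (intro sum.mono_neutral_left) (auto simp: coeff_eq_0)
  finally have "t ^ N * poly P (z / t + s) = (\<Sum>i\<le>N. t ^ N * (coeff ?Q i * (z / t) ^ i))"
    by (simp add: sum_distrib_left)
  also have "\<dots> = (\<Sum>i\<le>N. t ^ (N - i) * coeff ?Q i * z ^ i)"
    using assms(2) by (intro sum.cong) (auto simp: power_diff power_divide field_simps)
  finally show ?thesis
    by (simp add: hom_poly_def poly_sum poly_monom)
qed

lemma degree_R_poly: "degree (R_poly k \<alpha>) \<le> k"
proof -
  have "degree (R_poly k \<alpha>) \<le> (\<Sum>l=1..k. degree [: - ((\<alpha> - real l) * (\<alpha> - real l + 1)), 1 :])"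
    unfolding R_poly_def by (rule degree_prod_sum_le[unfolded o_def]) simp
  then show ?thesis by simp
qed

lemma degree_R1_poly: "degree (R1_poly \<beta> k) \<le> k"
  unfolding R1_poly_def
proof (rule degree_sum_le)
  fix j assume j: "j \<in> {1..k}"
  have "degree ([: - (\<beta>/2 * (\<beta>/2 + 1)), 1 :] * R_poly (j - 1) (real k))
      \<le> degree [: - (\<beta>/2 * (\<beta>/2 + 1)), 1 :] + degree (R_poly (j - 1) (real k))"
    by (rule degree_mult_le)
  also have "\<dots> \<le> 1 + (j - 1)"
    using degree_R_poly[of "j - 1" "real k"] by simp
  also have "\<dots> \<le> k" using j by simp
  finally show "degree (smult (pochhammer (\<beta>/2 - real k + real j + 1) (2 * (k - j)))
      ([: - (\<beta>/2 * (\<beta>/2 + 1)), 1 :] * R_poly (j - 1) (real k))) \<le> k"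
    using degree_smult_le order_trans by blast
qed simp

text \<open>The operator \<open>L\<close> of order \<open>2N\<close> on \<open>p\<close>-forms, \<open>\<beta> = CARD('n) - 2p\<close>. For \<open>J = 0\<close> the coefficients
  of the multiplied-out polynomials are evaluated at \<open>2J/n = 0\<close>
  (cf. \<open>poly_hom_poly\<close>, \<open>degree_R_poly\<close>, \<open>degree_R1_poly\<close>).\<close>

definition branson_gover ::
  "('m, 'n::finite) operator \<Rightarrow> ('m, 'n::finite) operator \<Rightarrow> real \<Rightarrow> nat \<Rightarrow> nat \<Rightarrow> ('m, 'n::finite) operator" where
  "branson_gover d \<delta> J p N =
    (let n = real CARD('n); \<beta> = n - 2 * real p;
         s_plus = \<beta>/2 * (\<beta>/2 - 1); s_one = \<beta>/2 * (\<beta>/2 + 1)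
     in if J \<noteq> 0 then
          (let y_plus = (n / (2*J)) *\<^sub>o (\<delta> \<circ> d) + s_plus *\<^sub>o id;
               y_one = (n / (2*J)) *\<^sub>o (d \<circ> \<delta>) + s_one *\<^sub>o id
           in ((2*J/n) ^ N) *\<^sub>o
                ((\<beta>/2 + real N) *\<^sub>o opoly (R_poly N 0) y_plus
                 + (\<beta>/2 - real N) *\<^sub>o opoly (R1_poly \<beta> N) y_one))
        else
          (\<beta>/2 + real N) *\<^sub>o opoly (hom_poly N 0 s_plus (R_poly N 0)) (\<delta> \<circ> d)
          + (\<beta>/2 - real N) *\<^sub>o opoly (hom_poly N 0 s_one (R1_poly \<beta> N)) (d \<circ> \<delta>))"

definition P_tilde ::
  "('m, 'n::finite) operator \<Rightarrow> ('m, 'n::finite) operator \<Rightarrow> real \<Rightarrow> nat \<Rightarrow> ('m, 'n::finite) operator" where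
  "P_tilde d \<delta> J l =
     (((2 * real l + 1) / 2) *\<^sub>o (\<delta> \<circ> d) + ((2 * real l - 1) / 2) *\<^sub>o (d \<circ> \<delta>))
     \<circ> ((d \<circ> \<delta>) - (\<delta> \<circ> d) + (2 * real l * (2*J / real CARD('n))) *\<^sub>o id)"

end

theory Submission
  imports Defs
begin

text \<open>
  Put \<open>A = \<delta> d\<close> and \<open>B = d \<delta>\<close> on forms of degree \<open>p\<close>. As \<open>d\<^sup>2 = 0\<close> and \<open>\<delta>\<^sup>2 = 0\<close>, the products \<open>A B\<close> and \<open>B A\<close> vanish, so
  polynomials in \<open>A\<close> and \<open>B\<close> are images of elements of \<open>\<real>[x, y]/(xy)\<close>. Such an element is determined by its
  restrictions to the axes \<open>y = 0\<close> and \<open>x = 0\<close>, and all operators in the two factorizations are of this kind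
  (\<open>represents_unique\<close>, \<open>represents_comp\<close>). What remains are identities between polynomials in one variable.

  The decisive one concerns the second family of polynomials: its defining sum telescopes to
  \<open>\<Prod>i<N. (y - i (i + 1))\<close> minus the value of the same product at \<open>y = \<beta>/2 (\<beta>/2 + 1)\<close> (\<open>poly_R1_poly\<close>). For \<open>\<beta> = 2 l\<close>
  with \<open>l < N\<close> this value is zero, and \<open>R\<^sub>N(\<sqdot>; 0)\<close> is the same product. On each axis the Branson--Gover operator is
  therefore a product of linear factors, and these are matched with the factors of the claimed
  products (\<open>first_axis_identity\<close>, \<open>second_axis_identity\<close>); the factors for \<open>k = l\<close> and \<open>k = l + 1\<close> form the
  fourth-order operator.

  That this operator has order at most four is clear from its shape. For the converse let \<open>\<epsilon>\<close> and \<open>\<kappa>\<close> be the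
  commutators of \<open>d\<close> and \<open>\<delta>\<close> with a function \<open>f\<close>. They are the principal symbols at \<open>df\<close>, so \<open>\<epsilon>\<^sup>2 = \<kappa>\<^sup>2 = 0\<close>, and
  \<open>- \<kappa>\<close> is the adjoint of \<open>\<epsilon>\<close>. If the symbol of order four vanished, then \<open>(\<kappa> \<epsilon>)\<^sup>3 = 0\<close>; as \<open>- \<kappa> \<epsilon>\<close> is positive
  semidefinite, this would force \<open>\<epsilon> = 0\<close>, whereas \<open>\<epsilon>\<close> is the wedge product with \<open>df\<close>, which is not always zero in
  degrees below the dimension (\<open>cube_eq_0_of_low_order\<close>, \<open>d_comm_eq_0_of_cube\<close>, \<open>exists_d_comm_nonzero\<close>).

  Both arguments use that \<open>d\<close> maps forms to forms with \<open>d\<^sup>2 = 0\<close>, which follows from the symmetry of second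
  derivatives (\<open>ext_d_coord_pullback\<close>, \<open>ext_d_coord_ext_d_coord\<close>), and the corresponding facts about \<open>\<delta>\<close>. As \<open>\<delta>\<close> is
  given only as a formal adjoint, these are derived from the nondegeneracy of the \<open>L\<^sup>2\<close> pairing
  (\<open>pairing_nondegenerate\<close>). There it suffices to test with forms that are supported in a compact subset of
  one chart domain.\<close>

section \<open>Calculus of smooth functions\<close>

lemma frechet_derivative_cong_open:
  assumes "open S" "x \<in> S" "\<And>y. y \<in> S \<Longrightarrow> f y = g y"
  shows "frechet_derivative f (at x) = frechet_derivative g (at x)"
proof -
  have "(f has_derivative D) (at x) \<longleftrightarrow> (g has_derivative D) (at x)" for D
    using has_derivative_transform_within_open[of f D x UNIV S g]
      has_derivative_transform_within_open[of g D x UNIV S f] assms by auto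
  then show ?thesis by (simp add: frechet_derivative_def)
qed

lemma pd_cong_open:
  assumes "open S" "x \<in> S" "\<And>y. y \<in> S \<Longrightarrow> f y = g y"
  shows "pd i f x = pd i g x"
  using frechet_derivative_cong_open[OF assms] by (simp add: pd_def)

lemmas frechet_derivative_worksI = frechet_derivative_works[THEN iffD1]

lemma pdI: "(f has_derivative D) (at x) \<Longrightarrow> pd i f x = D (axis i 1)"
  by (metis pd_def frechet_derivative_at)

lemma frechet_derivative_eq_sum_pd:
  fixes f :: "real^'n::finite \<Rightarrow> real"
  assumes "f differentiable (at x)"
  shows "frechet_derivative f (at x) v = (\<Sum>i\<in>UNIV. v $ i * pd i f x)"
proof -
  interpret linear "frechet_derivative f (at x)"
    using assms by (rule linear_frechet_derivative)
  have "frechet_derivative f (at x) v = frechet_derivative f (at x) (\<Sum>i\<in>UNIV. v $ i *\<^sub>R axis i 1)"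
    using basis_expansion[of v] by (simp add: scalar_mult_eq_scaleR)
  then show ?thesis by (simp add: sum scale pd_def)
qed

lemma Ck_on_Suc_differentiable:
  "Ck_on (Suc k) S f \<Longrightarrow> open S \<Longrightarrow> x \<in> S \<Longrightarrow> f differentiable (at x)"
  by (simp add: differentiable_on_eq_differentiable_at)

lemma Ck_on_SucD: "Ck_on (Suc k) S f \<Longrightarrow> Ck_on k S f"
  by (induction k arbitrary: f) (auto intro: differentiable_imp_continuous_on)

lemma Ck_on_Suc_open:
  "open S \<Longrightarrow> Ck_on (Suc k) S f \<longleftrightarrow> (\<forall>x\<in>S. f differentiable (at x)) \<and> (\<forall>i. Ck_on k S (pd i f))"
  by (simp add: differentiable_on_eq_differentiable_at)

lemma Ck_on_cong:
  assumes "open S" "\<And>x. x \<in> S \<Longrightarrow> f x = g x" "Ck_on k S f"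
  shows "Ck_on k S g"
  using assms(2,3)
proof (induction k arbitrary: f g)
  case 0
  then show ?case using continuous_on_cong[of S S f g] by simp
next
  case (Suc k)
  have "g differentiable (at x)" if "x \<in> S" for x
    using Suc.prems that assms(1) Ck_on_Suc_differentiable[of k S f x]
      has_derivative_transform_within_open[of f _ x UNIV S g]
    unfolding differentiable_def by blast
  moreover have "Ck_on k S (pd i g)" for i
  proof (rule Suc.IH)
    show "pd i f x = pd i g x" if "x \<in> S" for x
      using pd_cong_open[OF assms(1) that] Suc.prems by blast
    show "Ck_on k S (pd i f)" using Suc.prems by simp
  qed
  ultimately show ?case using assms(1) by (simp add: Ck_on_Suc_open del: Ck_on.simps)
qed

text \<open>Smoothness on a manifold is checked chart by chart near each point, so it has to be a local property.\<close>

lemma Ck_on_local: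
  assumes "open S" "\<And>x. x \<in> S \<Longrightarrow> \<exists>U. open U \<and> x \<in> U \<and> U \<subseteq> S \<and> Ck_on k U f"
  shows "Ck_on k S f"
  using assms(2)
proof (induction k arbitrary: f)
  case 0
  have "continuous (at x) f" if "x \<in> S" for x
    using 0[OF that] by (auto simp: continuous_on_eq_continuous_at)
  then show ?case using assms(1) by (simp add: continuous_on_eq_continuous_at)
next
  case (Suc k)
  have "f differentiable (at x)" if "x \<in> S" for x
    using Suc.prems[OF that] Ck_on_Suc_differentiable by blast
  moreover have "Ck_on k S (pd i f)" for i
  proof (rule Suc.IH)
    fix x assume "x \<in> S"
    from Suc.prems[OF this] obtain U where "open U" "x \<in> U" "U \<subseteq> S" "Ck_on (Suc k) U f" by blast
    then show "\<exists>U. open U \<and> x \<in> U \<and> U \<subseteq> S \<and> Ck_on k U (pd i f)" by auto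
  qed
  ultimately show ?case using assms(1) by (simp add: Ck_on_Suc_open del: Ck_on.simps)
qed

lemma smooth_on_cong:
  "open S \<Longrightarrow> (\<And>x. x \<in> S \<Longrightarrow> f x = g x) \<Longrightarrow> smooth_on S f \<Longrightarrow> smooth_on S g"
  unfolding smooth_on_def using Ck_on_cong by blast

lemma smooth_on_local:
  assumes "open S" "\<And>x. x \<in> S \<Longrightarrow> \<exists>U. open U \<and> x \<in> U \<and> U \<subseteq> S \<and> smooth_on U f"
  shows "smooth_on S f"
  unfolding smooth_on_def
proof (intro allI Ck_on_local assms(1))
  fix k x assume "x \<in> S"
  then show "\<exists>U. open U \<and> x \<in> U \<and> U \<subseteq> S \<and> Ck_on k U f"
    using assms(2)[of x] unfolding smooth_on_def by blast
qed

lemma smooth_on_differentiable: "smooth_on S f \<Longrightarrow> open S \<Longrightarrow> x \<in> S \<Longrightarrow> f differentiable (at x)"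
  unfolding smooth_on_def using Ck_on_Suc_differentiable by blast

lemma smooth_on_continuous: "smooth_on S f \<Longrightarrow> continuous_on S f"
  unfolding smooth_on_def by (metis Ck_on.simps(1))

lemma smooth_on_pd: "smooth_on S f \<Longrightarrow> smooth_on S (pd i f)"
  unfolding smooth_on_def by (metis Ck_on.simps(2))

lemma Ck_on_const: "Ck_on k S (\<lambda>x. a)"
proof (induction k arbitrary: a)
  case (Suc k)
  have "pd i (\<lambda>x. a) = (\<lambda>x. 0)" for i :: 'a by (simp add: pd_def fun_eq_iff)
  then show ?case using Suc by simp
qed simp

lemma smooth_on_const [simp]: "smooth_on S (\<lambda>x. a)"
  by (simp add: smooth_on_def Ck_on_const)

lemma Ck_on_add:
  "open S \<Longrightarrow> Ck_on k S f \<Longrightarrow> Ck_on k S g \<Longrightarrow> Ck_on k S (\<lambda>x. f x + g x)"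
proof (induction k arbitrary: f g)
  case 0 then show ?case by (auto intro: continuous_on_add)
next
  case (Suc k)
  have df: "f differentiable (at x)" "g differentiable (at x)" if "x \<in> S" for x
    using Suc.prems that Ck_on_Suc_differentiable by blast+
  have "Ck_on k S (pd i (\<lambda>x. f x + g x))" for i
  proof (rule Ck_on_cong[OF Suc.prems(1)])
    show "Ck_on k S (\<lambda>x. pd i f x + pd i g x)" using Suc by simp
    show "pd i f x + pd i g x = pd i (\<lambda>x. f x + g x) x" if "x \<in> S" for x
      using has_derivative_add[OF frechet_derivative_worksI[OF df(1)] frechet_derivative_worksI[OF df(2)], OF that that]
      by (subst pdI) (auto simp: pd_def)
  qed
  then show ?case using Suc.prems(1) df by (simp add: Ck_on_Suc_open del: Ck_on.simps)
qed

lemma Ck_on_mult: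
  "open S \<Longrightarrow> Ck_on k S f \<Longrightarrow> Ck_on k S g \<Longrightarrow> Ck_on k S (\<lambda>x. f x * g x)"
proof (induction k arbitrary: f g)
  case 0 then show ?case by (auto intro: continuous_on_mult)
next
  case (Suc k)
  have df: "f differentiable (at x)" "g differentiable (at x)" if "x \<in> S" for x
    using Suc.prems that Ck_on_Suc_differentiable by blast+
  have "Ck_on k S (pd i (\<lambda>x. f x * g x))" for i
  proof (rule Ck_on_cong[OF Suc.prems(1)])
    show "Ck_on k S (\<lambda>x. f x * pd i g x + pd i f x * g x)"
      using Suc Ck_on_SucD[OF Suc.prems(2)] Ck_on_SucD[OF Suc.prems(3)]
      by (intro Ck_on_add) auto
    show "f x * pd i g x + pd i f x * g x = pd i (\<lambda>x. f x * g x) x" if "x \<in> S" for x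
      using has_derivative_mult[OF frechet_derivative_worksI[OF df(1)] frechet_derivative_worksI[OF df(2)], OF that that]
      by (subst pdI) (auto simp: pd_def)
  qed
  then show ?case using Suc.prems(1) df by (simp add: Ck_on_Suc_open del: Ck_on.simps)
qed

lemma smooth_on_add:
  "open S \<Longrightarrow> smooth_on S f \<Longrightarrow> smooth_on S g \<Longrightarrow> smooth_on S (\<lambda>x. f x + g x)"
  by (simp add: smooth_on_def Ck_on_add)

lemma smooth_on_mult:
  "open S \<Longrightarrow> smooth_on S f \<Longrightarrow> smooth_on S g \<Longrightarrow> smooth_on S (\<lambda>x. f x * g x)"
  by (simp add: smooth_on_def Ck_on_mult)

lemma smooth_on_diff:
  "open S \<Longrightarrow> smooth_on S f \<Longrightarrow> smooth_on S g \<Longrightarrow> smooth_on S (\<lambda>x. f x - g x)"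
  using smooth_on_add[of S f "\<lambda>x. -1 * g x"] smooth_on_mult[of S "\<lambda>x. -1" g] by simp

lemma smooth_on_sum:
  "open S \<Longrightarrow> (\<And>i. i \<in> I \<Longrightarrow> smooth_on S (f i)) \<Longrightarrow> smooth_on S (\<lambda>x. \<Sum>i\<in>I. f i x)"
  by (induction I rule: infinite_finite_induct) (auto intro: smooth_on_add)

lemma smooth_on_frechet_derivative:
  assumes "open S" "smooth_on S f"
  shows "smooth_on S (\<lambda>x. frechet_derivative f (at x) v)"
proof (rule smooth_on_cong[OF assms(1)])
  show "smooth_on S (\<lambda>x. \<Sum>i\<in>UNIV. v $ i * pd i f x)"
    using assms by (intro smooth_on_sum smooth_on_mult smooth_on_pd) auto
  show "(\<Sum>i\<in>UNIV. v $ i * pd i f x) = frechet_derivative f (at x) v" if "x \<in> S" for x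
    using frechet_derivative_eq_sum_pd[OF smooth_on_differentiable[OF assms(2,1) that]] by simp
qed

lemma smooth_on_nth: "smooth_on S (\<lambda>x. x $ i)"
proof -
  have "Ck_on k S (\<lambda>x. x $ i)" for k
  proof (cases k)
    case (Suc m)
    have der: "((\<lambda>x. x $ i) has_derivative (\<lambda>x. x $ i)) (at x)" for x :: "real^'a"
      by (rule bounded_linear_imp_has_derivative) (rule bounded_linear_vec_nth)
    have "pd j (\<lambda>x. x $ i) = (\<lambda>x. axis j 1 $ i)" for j
      using pdI[OF der] by blast
    moreover have "(\<lambda>x::real^'a. x $ i) differentiable_on S"
      using der unfolding differentiable_on_def differentiable_def
      using has_derivative_at_withinI by blast
    ultimately show ?thesis using Suc by (simp add: Ck_on_const)
  qed (auto intro: continuous_intros)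
  then show ?thesis by (simp add: smooth_on_def)
qed

lemma has_derivative_vecI:
  fixes T :: "real^'n::finite \<Rightarrow> real^'m::finite"
  assumes "\<And>j. ((\<lambda>x. T x $ j) has_derivative (\<lambda>v. D v $ j)) (at x)"
  shows "(T has_derivative D) (at x)"
  unfolding has_derivative_componentwise_within[of T] using assms
  by (auto simp: Basis_vec_def inner_axis)

lemma differentiable_vecI:
  fixes T :: "real^'n::finite \<Rightarrow> real^'m::finite"
  assumes "\<And>j. (\<lambda>x. T x $ j) differentiable (at x)"
  shows "T differentiable (at x)"
proof -
  have "(T has_derivative (\<lambda>v. \<chi> j. frechet_derivative (\<lambda>x. T x $ j) (at x) v)) (at x)"
    by (rule has_derivative_vecI) (use assms frechet_derivative_worksI in auto)
  then show ?thesis by (auto simp: differentiable_def)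
qed

lemma frechet_derivative_vec_nth:
  fixes T :: "real^'n::finite \<Rightarrow> real^'m::finite"
  assumes "T differentiable (at x)"
  shows "((\<lambda>x. T x $ j) has_derivative (\<lambda>v. frechet_derivative T (at x) v $ j)) (at x)"
    "frechet_derivative (\<lambda>x. T x $ j) (at x) v = frechet_derivative T (at x) v $ j"
proof -
  show *: "((\<lambda>x. T x $ j) has_derivative (\<lambda>v. frechet_derivative T (at x) v $ j)) (at x)"
    using bounded_linear.has_derivative[OF bounded_linear_vec_nth frechet_derivative_worksI[OF assms]] .
  show "frechet_derivative (\<lambda>x. T x $ j) (at x) v = frechet_derivative T (at x) v $ j"
    by (rule fun_cong[OF frechet_derivative_at[OF *], symmetric])
qed

lemma pd_compose:
  fixes T :: "real^'n::finite \<Rightarrow> real^'m::finite"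
  assumes T: "\<And>j. (\<lambda>x. T x $ j) differentiable (at x)" and f: "f differentiable (at (T x))"
  shows "(\<lambda>x. f (T x)) differentiable (at x)"
    and "pd i (\<lambda>x. f (T x)) x = (\<Sum>j\<in>UNIV. pd i (\<lambda>x. T x $ j) x * pd j f (T x))"
proof -
  have dT: "T differentiable (at x)" using T by (rule differentiable_vecI)
  have *: "((\<lambda>x. f (T x)) has_derivative
      (\<lambda>v. frechet_derivative f (at (T x)) (frechet_derivative T (at x) v))) (at x)"
    using has_derivative_compose[OF frechet_derivative_worksI[OF dT] frechet_derivative_worksI[OF f]] .
  then show "(\<lambda>x. f (T x)) differentiable (at x)" by (auto simp: differentiable_def)
  show "pd i (\<lambda>x. f (T x)) x = (\<Sum>j\<in>UNIV. pd i (\<lambda>x. T x $ j) x * pd j f (T x))"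
    using pdI[OF *, of i] frechet_derivative_vec_nth(2)[OF dT]
    by (simp add: frechet_derivative_eq_sum_pd[OF f] pd_def[of i])
qed

lemma Ck_on_sum:
  "open S \<Longrightarrow> (\<And>i. i \<in> I \<Longrightarrow> Ck_on k S (f i)) \<Longrightarrow> Ck_on k S (\<lambda>x. \<Sum>i\<in>I. f i x)"
  by (induction I rule: infinite_finite_induct) (auto intro: Ck_on_add Ck_on_const)

text \<open>By induction on the order: each partial derivative of a composite is a sum of products of a
  composite of lower order and a derivative of the inner map. This is what makes the notion of a smooth
  function independent of the chart.\<close>

lemma Ck_on_compose:
  fixes T :: "real^'n::finite \<Rightarrow> real^'m::finite"
  assumes "open S" "open S'" "T ` S \<subseteq> S'"
  shows "(\<And>j. Ck_on k S (\<lambda>x. T x $ j)) \<Longrightarrow> Ck_on k S' f \<Longrightarrow> Ck_on k S (\<lambda>x. f (T x))"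
proof (induction k arbitrary: f)
  case 0
  have "continuous_on S T"
    using 0(1) by (simp add: continuous_on_componentwise[of S T] Basis_vec_def inner_axis)
  then show ?case using 0 assms by (auto intro: continuous_on_compose2)
next
  case (Suc k)
  have dT: "(\<lambda>x. T x $ j) differentiable (at x)" if "x \<in> S" for x j
    using Suc.prems(1) that assms(1) Ck_on_Suc_differentiable by blast
  have df: "f differentiable (at (T x))" if "x \<in> S" for x
    using Suc.prems(2) that assms(2,3) Ck_on_Suc_differentiable by blast
  have "Ck_on k S (pd i (\<lambda>x. f (T x)))" for i
  proof (rule Ck_on_cong[OF assms(1)])
    show "Ck_on k S (\<lambda>x. \<Sum>j\<in>UNIV. pd i (\<lambda>x. T x $ j) x * pd j f (T x))"
      using Suc.prems Ck_on_SucD[OF Suc.prems(1)] Suc.IH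
      by (intro Ck_on_sum Ck_on_mult assms) (auto simp del: Ck_on.simps(1))
    show "(\<Sum>j\<in>UNIV. pd i (\<lambda>x. T x $ j) x * pd j f (T x)) = pd i (\<lambda>x. f (T x)) x" if "x \<in> S" for x
      using pd_compose(2)[OF dT[OF that] df[OF that]] by simp
  qed
  then show ?case using assms(1) pd_compose(1)[OF dT df]
    by (simp add: Ck_on_Suc_open del: Ck_on.simps)
qed

lemma smooth_on_compose:
  fixes T :: "real^'n::finite \<Rightarrow> real^'m::finite"
  assumes "open S" "open S'" "T ` S \<subseteq> S'" "\<And>j. smooth_on S (\<lambda>x. T x $ j)" "smooth_on S' f"
  shows "smooth_on S (\<lambda>x. f (T x))"
  using assms Ck_on_compose[OF assms(1-3)] by (simp add: smooth_on_def)

lemma DERIV_line: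
  fixes f :: "real^'n::finite \<Rightarrow> real"
  assumes "f differentiable (at (a + s *\<^sub>R axis i 1))"
  shows "((\<lambda>s. f (a + s *\<^sub>R axis i 1)) has_real_derivative pd i f (a + s *\<^sub>R axis i 1)) (at s)"
proof -
  have "((\<lambda>s. a + s *\<^sub>R axis i 1) has_derivative (\<lambda>h. h *\<^sub>R axis i 1)) (at s)"
    by (auto intro!: derivative_eq_intros)
  from has_derivative_compose[OF this frechet_derivative_worksI[OF assms]]
  have "((\<lambda>s. f (a + s *\<^sub>R axis i 1)) has_derivative (\<lambda>h. h * pd i f (a + s *\<^sub>R axis i 1))) (at s)"
    using linear_frechet_derivative[OF assms] by (simp add: linear_cmul pd_def)
  then show ?thesis
    by (simp add: has_field_derivative_def mult.commute[of _ "pd i f _"])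
qed

text \<open>Two applications of the mean value theorem. The left-hand side is symmetric in the two directions,
  whereas the right-hand side singles out an order of differentiation; hence the symmetry of second
  derivatives, by shrinking \<open>s\<close>.\<close>

lemma second_difference_eq_pd_pd:
  fixes f :: "real^'n::finite \<Rightarrow> real"
  assumes S: "ball x r \<subseteq> S" "open S" and f: "Ck_on (Suc (Suc 0)) S f" and s: "0 < s" "2 * s < r"
  shows "\<exists>y\<in>ball x r. f (x + s *\<^sub>R axis j 1 + s *\<^sub>R axis i 1) - f (x + s *\<^sub>R axis i 1) - f (x + s *\<^sub>R axis j 1) + f x
            = s * s * pd j (pd i f) y"
proof -
  have in_S: "x + b *\<^sub>R axis j 1 + a *\<^sub>R axis i 1 \<in> ball x r" if "0 \<le> a" "a \<le> s" "0 \<le> b" "b \<le> s" for a b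
  proof -
    have "norm (b *\<^sub>R axis j (1::real) + a *\<^sub>R axis i 1) \<le> norm (b *\<^sub>R axis j (1::real)) + norm (a *\<^sub>R axis i (1::real))"
      by (rule norm_triangle_ineq)
    also have "\<dots> < r" using that s by (simp add: norm_axis_1)
    finally show ?thesis by (simp add: dist_norm norm_minus_commute algebra_simps)
  qed
  have df: "f differentiable (at y)" "pd i f differentiable (at y)" if "y \<in> ball x r" for y
    using f that S by (auto simp del: Ck_on.simps simp: Ck_on_Suc_open)
  define g where "g = (\<lambda>a. f (x + s *\<^sub>R axis j 1 + a *\<^sub>R axis i 1) - f (x + a *\<^sub>R axis i 1))"
  have "\<exists>a>0. a < s \<and> g s - g 0 = (s - 0) * (pd i f (x + s *\<^sub>R axis j 1 + a *\<^sub>R axis i 1) - pd i f (x + a *\<^sub>R axis i 1))"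
    unfolding g_def
  proof (rule MVT2[OF s(1)])
    fix a assume a: "0 \<le> a" "a \<le> s"
    show "((\<lambda>a. f (x + s *\<^sub>R axis j 1 + a *\<^sub>R axis i 1) - f (x + a *\<^sub>R axis i 1)) has_real_derivative
      pd i f (x + s *\<^sub>R axis j 1 + a *\<^sub>R axis i 1) - pd i f (x + a *\<^sub>R axis i 1)) (at a)"
      using in_S[OF a, of s] in_S[OF a, of 0] s by (intro DERIV_diff DERIV_line df) auto
  qed
  then obtain a where a: "0 < a" "a < s"
    "g s - g 0 = s * (pd i f (x + s *\<^sub>R axis j 1 + a *\<^sub>R axis i 1) - pd i f (x + a *\<^sub>R axis i 1))" by auto
  have "\<exists>b>0. b < s \<and> pd i f ((x + a *\<^sub>R axis i 1) + s *\<^sub>R axis j 1) - pd i f ((x + a *\<^sub>R axis i 1) + 0 *\<^sub>R axis j 1)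
      = (s - 0) * pd j (pd i f) ((x + a *\<^sub>R axis i 1) + b *\<^sub>R axis j 1)"
  proof (rule MVT2[OF s(1)])
    fix b assume b: "0 \<le> b" "b \<le> s"
    show "((\<lambda>b. pd i f (x + a *\<^sub>R axis i 1 + b *\<^sub>R axis j 1)) has_real_derivative
       pd j (pd i f) (x + a *\<^sub>R axis i 1 + b *\<^sub>R axis j 1)) (at b)"
      using in_S[of a b] a b by (intro DERIV_line df) (auto simp: algebra_simps)
  qed
  then obtain b where b: "0 < b" "b < s" "pd i f ((x + a *\<^sub>R axis i 1) + s *\<^sub>R axis j 1) - pd i f (x + a *\<^sub>R axis i 1)
      = s * pd j (pd i f) ((x + a *\<^sub>R axis i 1) + b *\<^sub>R axis j 1)" by auto
  show ?thesis
  proof (rule bexI)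
    show "x + b *\<^sub>R axis j 1 + a *\<^sub>R axis i 1 \<in> ball x r" using in_S a b by simp
    show "f (x + s *\<^sub>R axis j 1 + s *\<^sub>R axis i 1) - f (x + s *\<^sub>R axis i 1) - f (x + s *\<^sub>R axis j 1) + f x
            = s * s * pd j (pd i f) (x + b *\<^sub>R axis j 1 + a *\<^sub>R axis i 1)"
      using a(3) b(3) by (simp add: g_def algebra_simps)
  qed
qed

lemma pd_pd_commute:
  fixes f :: "real^'n::finite \<Rightarrow> real"
  assumes S: "open S" "x \<in> S" and f: "Ck_on (Suc (Suc 0)) S f"
  shows "pd i (pd j f) x = pd j (pd i f) x"
proof (rule ccontr)
  let ?a = "pd i (pd j f)" and ?b = "pd j (pd i f)"
  assume ne: "?a x \<noteq> ?b x"
  define e where "e = \<bar>?a x - ?b x\<bar> / 2"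
  have e: "e > 0" using ne by (simp add: e_def)
  have "continuous_on S ?a" "continuous_on S ?b" using f by auto
  then have "isCont ?a x" "isCont ?b x" using S by (auto simp: continuous_on_eq_continuous_at)
  then have cont: "\<exists>r>0. \<forall>y. dist y x < r \<longrightarrow> dist (?a y) (?a x) < e"
      "\<exists>r>0. \<forall>y. dist y x < r \<longrightarrow> dist (?b y) (?b x) < e"
    using e unfolding continuous_at_eps_delta by simp_all
  obtain r1 where r1: "r1 > 0" "\<And>y. dist y x < r1 \<Longrightarrow> dist (?a y) (?a x) < e"
    using cont(1) by auto
  obtain r2 where r2: "r2 > 0" "\<And>y. dist y x < r2 \<Longrightarrow> dist (?b y) (?b x) < e"
    using cont(2) by auto
  obtain r3 where r3: "r3 > 0" "ball x r3 \<subseteq> S" using S openE by blast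
  define r where "r = min r1 (min r2 r3)"
  have rr: "r > 0" "ball x r \<subseteq> S" using r1(1) r2(1) r3 by (auto simp: r_def)
  have s: "0 < r / 3" "2 * (r / 3) < r" using rr by auto
  obtain y where y: "y \<in> ball x r" "f (x + (r/3) *\<^sub>R axis j 1 + (r/3) *\<^sub>R axis i 1) - f (x + (r/3) *\<^sub>R axis i 1) - f (x + (r/3) *\<^sub>R axis j 1) + f x
            = (r/3) * (r/3) * ?b y"
    using second_difference_eq_pd_pd[OF rr(2) S(1) f s, of j i] by blast
  obtain z where z: "z \<in> ball x r" "f (x + (r/3) *\<^sub>R axis i 1 + (r/3) *\<^sub>R axis j 1) - f (x + (r/3) *\<^sub>R axis j 1) - f (x + (r/3) *\<^sub>R axis i 1) + f x
            = (r/3) * (r/3) * ?a z"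
    using second_difference_eq_pd_pd[OF rr(2) S(1) f s, of i j] by blast
  have "(r/3) * (r/3) * ?b y = (r/3) * (r/3) * ?a z" using y(2) z(2) by (simp add: algebra_simps)
  then have "?b y = ?a z" using rr by simp
  moreover have "dist (?a z) (?a x) < e" "dist (?b y) (?b x) < e"
    using y(1) z(1) by (auto intro!: r1(2) r2(2) simp: r_def dist_commute[of _ x])
  ultimately have "\<bar>?a x - ?b x\<bar> < 2 * e" by (simp add: dist_real_def)
  then show False by (simp add: e_def)
qed

lemma frechet_derivative_commute:
  fixes f :: "real^'n::finite \<Rightarrow> real"
  assumes S: "open S" "x \<in> S" and f: "smooth_on S f"
  shows "frechet_derivative (\<lambda>y. frechet_derivative f (at y) v) (at x) u
       = frechet_derivative (\<lambda>y. frechet_derivative f (at y) u) (at x) v"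
proof -
  have *: "frechet_derivative (\<lambda>y. frechet_derivative f (at y) v) (at x) u
      = (\<Sum>i\<in>UNIV. \<Sum>j\<in>UNIV. u $ i * (v $ j * pd i (pd j f) x))" for u v
  proof -
    have "((\<lambda>y. \<Sum>j\<in>UNIV. v $ j * pd j f y) has_derivative
        (\<lambda>u. \<Sum>j\<in>UNIV. v $ j * frechet_derivative (pd j f) (at x) u)) (at x)"
      by (intro has_derivative_sum has_derivative_mult_right frechet_derivative_worksI
          smooth_on_differentiable[OF smooth_on_pd[OF f] S])
    then have "frechet_derivative (\<lambda>y. \<Sum>j\<in>UNIV. v $ j * pd j f y) (at x) u
        = (\<Sum>j\<in>UNIV. v $ j * frechet_derivative (pd j f) (at x) u)"
      using fun_cong[OF frechet_derivative_at] by fastforce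
    also have "\<dots> = (\<Sum>j\<in>UNIV. v $ j * (\<Sum>i\<in>UNIV. u $ i * pd i (pd j f) x))"
      by (simp add: frechet_derivative_eq_sum_pd[OF smooth_on_differentiable[OF smooth_on_pd[OF f] S]])
    also have "\<dots> = (\<Sum>i\<in>UNIV. \<Sum>j\<in>UNIV. u $ i * (v $ j * pd i (pd j f) x))"
      by (subst sum.swap) (simp add: sum_distrib_left mult_ac)
    also have "frechet_derivative (\<lambda>y. \<Sum>j\<in>UNIV. v $ j * pd j f y) (at x)
      = frechet_derivative (\<lambda>y. frechet_derivative f (at y) v) (at x)"
      using frechet_derivative_eq_sum_pd[OF smooth_on_differentiable[OF f S(1)]]
      by (intro frechet_derivative_cong_open[OF S]) simp
    finally show ?thesis .
  qed
  have comm: "pd i (pd j f) x = pd j (pd i f) x" for i j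
    using pd_pd_commute[OF S] f unfolding smooth_on_def by blast
  show ?thesis unfolding * by (subst sum.swap) (simp only: comm mult.left_commute)
qed

subsection \<open>Bump functions\<close>

text \<open>The polynomial \<open>q\<close> makes the class closed under differentiation.\<close>

definition expinv :: "real poly \<Rightarrow> real \<Rightarrow> real" where
  "expinv q t = (if 0 < t then poly q (1 / t) * exp (- (1 / t)) else 0)"

lemma poly_times_exp_minus_tendsto_0: "((\<lambda>s. poly q s * exp (- s)) \<longlongrightarrow> 0) at_top" for q :: "real poly"
proof -
  have "((\<lambda>s. \<Sum>i\<le>degree q. coeff q i * (s ^ i / exp s)) \<longlongrightarrow> (\<Sum>i\<le>degree q. coeff q i * 0)) at_top"
    by (intro tendsto_intros tendsto_power_div_exp_0)
  then show ?thesis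
    by (simp add: poly_altdef sum_distrib_right exp_minus divide_inverse mult.assoc)
qed

lemma expinv_tendsto_0: "(expinv q \<longlongrightarrow> 0) (at 0)"
proof -
  have "((\<lambda>t. poly q (inverse t) * exp (- inverse t)) \<longlongrightarrow> 0) (at_right 0)"
    using filterlim_compose[OF poly_times_exp_minus_tendsto_0[of q] filterlim_inverse_at_top_right] .
  then have "(expinv q \<longlongrightarrow> 0) (at_right 0)"
    by (rule Lim_transform_eventually)
       (auto simp: expinv_def eventually_at_filter inverse_eq_divide)
  moreover have "(expinv q \<longlongrightarrow> 0) (at_left 0)"
    by (rule Lim_transform_eventually[OF tendsto_const]) (auto simp: expinv_def eventually_at_filter)
  ultimately show ?thesis by (simp add: filterlim_split_at)
qed

text \<open>Each derivative is again of the form \<open>q(1/t) exp(-1/t)\<close>: substituting \<open>s = 1/t\<close> turns \<open>d/dt\<close> into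
  \<open>- s\<^sup>2 d/ds\<close>, and \<open>q e\<^sup>-\<^sup>s\<close> into \<open>s\<^sup>2 (q - q') e\<^sup>-\<^sup>s\<close>. At \<open>0\<close> the difference quotient is the same kind of
  function, with \<open>q\<close> multiplied by \<open>s\<close>, and tends to \<open>0\<close>.\<close>

lemma DERIV_expinv:
  "(expinv q has_real_derivative expinv ([:0, 0, 1:] * (q - pderiv q)) t) (at t)"
proof -
  consider "t > 0" | "t < 0" | "t = 0" by linarith
  then show ?thesis
  proof cases
    case 1
    have "((\<lambda>t. poly q (1 / t) * exp (- (1 / t))) has_real_derivative expinv ([:0, 0, 1:] * (q - pderiv q)) t) (at t)"
      using 1 by (auto intro!: derivative_eq_intros DERIV_chain'[OF _ poly_DERIV]
          simp: expinv_def field_simps power2_eq_square)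
    then show ?thesis
      by (rule has_field_derivative_transform_within_open[where S="{0<..}"]) (use 1 in \<open>auto simp: expinv_def\<close>)
  next
    case 2
    have "((\<lambda>t. 0) has_real_derivative expinv ([:0, 0, 1:] * (q - pderiv q)) t) (at t)"
      using 2 by (simp add: expinv_def)
    then show ?thesis
      by (rule has_field_derivative_transform_within_open[where S="{..<0}"]) (use 2 in \<open>auto simp: expinv_def\<close>)
  next
    case 3
    have "((\<lambda>h. (expinv q (0 + h) - expinv q 0) / h) \<longlongrightarrow> 0) (at 0)"
      by (rule Lim_transform_eventually[OF expinv_tendsto_0[of "[:0,1:] * q"]])
         (auto simp: expinv_def eventually_at_filter)
    then show ?thesis using 3 by (simp add: DERIV_def expinv_def)
  qed
qed

lemma Ck_on_expinv_compose: "open S \<Longrightarrow> Ck_on k S u \<Longrightarrow> Ck_on k S (\<lambda>x. expinv q (u x))"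
proof (induction k arbitrary: q)
  case 0
  have "continuous_on UNIV (expinv q)"
    using DERIV_expinv by (meson DERIV_continuous_on has_field_derivative_at_within)
  then show ?case using 0 by (auto intro: continuous_on_compose2)
next
  case (Suc k)
  let ?q = "[:0, 0, 1:] * (q - pderiv q)"
  have der: "((\<lambda>x. expinv q (u x)) has_derivative (\<lambda>v. frechet_derivative u (at x) v * expinv ?q (u x))) (at x)" if "x \<in> S" for x
    using has_derivative_compose[OF frechet_derivative_worksI[OF Ck_on_Suc_differentiable[OF Suc.prems(2,1) that]]
        DERIV_expinv[of q "u x", unfolded has_field_derivative_def]] by (simp add: mult.commute)
  have "Ck_on k S (pd i (\<lambda>x. expinv q (u x)))" for i
  proof (rule Ck_on_cong[OF Suc.prems(1)])
    show "Ck_on k S (\<lambda>x. pd i u x * expinv ?q (u x))"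
      using Suc Ck_on_SucD[OF Suc.prems(2)] by (intro Ck_on_mult) auto
    show "pd i u x * expinv ?q (u x) = pd i (\<lambda>x. expinv q (u x)) x" if "x \<in> S" for x
      using pdI[OF der[OF that]] by (simp add: pd_def)
  qed
  moreover have "(\<lambda>x. expinv q (u x)) differentiable (at x)" if "x \<in> S" for x
    using der[OF that] by (auto simp: differentiable_def)
  ultimately show ?case using Suc.prems(1) by (simp add: Ck_on_Suc_open del: Ck_on.simps)
qed

text \<open>The function \<open>exp(-1/u)\<close>, continued by zero, of \<open>u = r\<^sup>2 - |x - x\<^sub>0|\<^sup>2\<close>.\<close>

lemma smooth_bump_exists:
  fixes x0 :: "real^'n::finite"
  assumes "0 < r"
  obtains b :: "real^'n \<Rightarrow> real" where "smooth_on UNIV b" "b x0 > 0" "\<And>x. b x \<ge> 0" "\<And>x. x \<notin> cball x0 r \<Longrightarrow> b x = 0"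
proof
  define u where "u = (\<lambda>x::real^'n. r\<^sup>2 - (\<Sum>i\<in>UNIV. (x $ i - x0 $ i) * (x $ i - x0 $ i)))"
  have u: "u x = r\<^sup>2 - (norm (x - x0))\<^sup>2" for x
    by (simp add: u_def power2_norm_eq_inner inner_vec_def)
  have su: "smooth_on UNIV u" unfolding u_def
    by (intro smooth_on_diff smooth_on_sum smooth_on_mult smooth_on_const smooth_on_nth) auto
  show "smooth_on UNIV (\<lambda>x. expinv 1 (u x))"
    using su by (simp add: smooth_on_def Ck_on_expinv_compose)
  show "expinv 1 (u x0) > 0" using assms by (simp add: u expinv_def)
  show "expinv 1 (u x) \<ge> 0" for x by (simp add: expinv_def)
  show "expinv 1 (u x) = 0" if "x \<notin> cball x0 r" for x
  proof -
    have "r\<^sup>2 \<le> (norm (x - x0))\<^sup>2"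
      using that assms by (intro power_mono) (auto simp: dist_norm norm_minus_commute)
    then show ?thesis by (simp add: expinv_def u)
  qed
qed

section \<open>Alternating forms on a vector space\<close>

definition alt_form :: "nat \<Rightarrow> ((real^'n::finite) list \<Rightarrow> real) \<Rightarrow> bool" where
  "alt_form p W \<longleftrightarrow> (\<forall>vs. length vs = p \<longrightarrow>
     (\<forall>i<p. linear (\<lambda>v. W (vs[i := v]))) \<and>
     (\<forall>i<p. \<forall>j<p. i \<noteq> j \<and> vs ! i = vs ! j \<longrightarrow> W vs = 0))"

lemma alt_form_linear_nth: "alt_form p W \<Longrightarrow> length vs = p \<Longrightarrow> i < p \<Longrightarrow> linear (\<lambda>v. W (vs[i := v]))"
  by (simp add: alt_form_def)

lemma alt_form_repeated:
  "alt_form p W \<Longrightarrow> length vs = p \<Longrightarrow> i < p \<Longrightarrow> j < p \<Longrightarrow> i \<noteq> j \<Longrightarrow> vs ! i = vs ! j \<Longrightarrow> W vs = 0"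
  unfolding alt_form_def by blast

lemma alt_form_Cons: "alt_form (Suc p) W \<Longrightarrow> alt_form p (\<lambda>ws. W (v # ws))"
  unfolding alt_form_def
proof (intro allI impI conjI)
  fix vs :: "(real^'a) list" and i j
  assume A: "\<forall>vs. length vs = Suc p \<longrightarrow>
     (\<forall>i<Suc p. linear (\<lambda>v. W (vs[i := v]))) \<and>
     (\<forall>i<Suc p. \<forall>j<Suc p. i \<noteq> j \<and> vs ! i = vs ! j \<longrightarrow> W vs = 0)" and l: "length vs = p" and i: "i < p"
  show "linear (\<lambda>u. W (v # vs[i := u]))"
    using A[rule_format, of "v # vs", THEN conjunct1, rule_format, of "Suc i"] l i by simp
  show "W (v # vs) = 0" if "j < p" "i \<noteq> j \<and> vs ! i = vs ! j"
    using A[rule_format, of "v # vs", THEN conjunct2, rule_format, of "Suc i" "Suc j"] l i that by simp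
qed

lemma alt_form_linear_head: "alt_form (Suc p) W \<Longrightarrow> length ws = p \<Longrightarrow> linear (\<lambda>v. W (v # ws))"
  using alt_form_linear_nth[of "Suc p" W "undefined # ws" 0] by simp

lemma alt_form_mem: "alt_form (Suc p) W \<Longrightarrow> length ws = p \<Longrightarrow> v \<in> set ws \<Longrightarrow> W (v # ws) = 0"
  using alt_form_repeated[of "Suc p" W "v # ws" 0 "Suc i" for i] by (auto simp: in_set_conv_nth)

lemma alt_form_swap:
  assumes "alt_form (Suc (Suc p)) W" "length ws = p"
  shows "W (u # v # ws) = - W (v # u # ws)"
proof -
  have l1: "linear (\<lambda>u. W (u # v # ws))" for v
    using alt_form_linear_head[OF assms(1)] assms(2) by simp
  have l2: "linear (\<lambda>v. W (u # v # ws))" for u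
    using alt_form_linear_head[OF alt_form_Cons[OF assms(1)]] assms(2) by simp
  have z: "W (u # u # ws) = 0" for u
    using alt_form_mem[OF assms(1), of "u # ws" u] assms(2) by simp
  have "W ((u + v) # (u + v) # ws) = 0" by (rule z)
  moreover have "W ((u + v) # (u + v) # ws) = W (u # u # ws) + W (v # u # ws) + (W (u # v # ws) + W (v # v # ws))"
    using linear_add[OF l1] linear_add[OF l2] by presburger
  ultimately show ?thesis using z[of u] z[of v] by linarith
qed

text \<open>Moving a vector past \<open>length xs\<close> others costs as many sign changes. All sign bookkeeping for
  the exterior derivative goes through this rule.\<close>

lemma alt_form_move_to_front:
  "alt_form (Suc (length xs + length ys)) W \<Longrightarrow> W (xs @ v # ys) = (-1) ^ length xs * W (v # xs @ ys)"
proof (induction xs arbitrary: W)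
  case (Cons a xs)
  have "W (a # xs @ v # ys) = (-1) ^ length xs * W (a # v # xs @ ys)"
    using Cons.IH[of "\<lambda>ws. W (a # ws)"] alt_form_Cons[OF Cons.prems] by simp
  also have "W (a # v # xs @ ys) = - W (v # a # xs @ ys)"
    by (rule alt_form_swap[of "length xs + length ys"]) (use Cons.prems in auto)
  finally show ?case by simp
qed simp

abbreviation del_nth :: "nat \<Rightarrow> 'a list \<Rightarrow> 'a list" where
  "del_nth j vs \<equiv> take j vs @ drop (Suc j) vs"

lemma alt_form_move_nth:
  assumes "alt_form p W" "length vs = p" "j < p"
  shows "W vs = (-1) ^ j * W (vs ! j # del_nth j vs)"
proof -
  have "W (take j vs @ vs ! j # drop (Suc j) vs) = (-1) ^ length (take j vs) * W (vs ! j # take j vs @ drop (Suc j) vs)"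
    by (rule alt_form_move_to_front) (use assms in \<open>simp add: min_def\<close>)
  then show ?thesis using assms by (simp add: id_take_nth_drop[symmetric])
qed

text \<open>A symmetric correction term is annihilated by alternation: this is what makes the exterior
  derivative independent of coordinates.\<close>

lemma alternating_sum_symmetric_eq_0:
  fixes B :: "real^'n::finite \<Rightarrow> real^'n \<Rightarrow> real^'m::finite"
  assumes sym: "\<And>u v. B u v = B v u"
  shows "alt_form p V \<Longrightarrow> length vs = Suc p \<Longrightarrow>
    (\<Sum>j<length vs. (-1) ^ j * (\<Sum>k<p. V ((map L (del_nth j vs))[k := B (vs ! j) (del_nth j vs ! k)]))) = 0"
proof (induction vs arbitrary: p V)
  case (Cons v vs)
  let ?A = "\<lambda>V u ws. \<Sum>k<length ws. V ((map L ws)[k := B u (ws ! k)])"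
  have A_Cons: "?A V u (w # ws) = V (B u w # map L ws) + ?A (\<lambda>ws. V (L w # ws)) u ws" for u w ws V
    by (simp add: sum.lessThan_Suc_shift del: sum.lessThan_Suc)
  have len: "length (del_nth j vs) = p - 1" "length (del_nth (Suc j) (v # vs)) = p" if "j < p" for j
    using that Cons.prems by auto
  have "(\<Sum>j<length (v # vs). (-1) ^ j * (\<Sum>k<p. V ((map L (del_nth j (v # vs)))[k := B ((v # vs) ! j) (del_nth j (v # vs) ! k)])))
      = (\<Sum>k<p. V ((map L vs)[k := B v (vs ! k)]))
        - (\<Sum>j<p. (-1) ^ j * ?A V (vs ! j) (v # del_nth j vs))"
    using Cons.prems by (simp add: sum.lessThan_Suc_shift sum_negf min_def del: sum.lessThan_Suc)
  also have "(\<Sum>k<p. V ((map L vs)[k := B v (vs ! k)])) = (\<Sum>k<p. (-1) ^ k * V (B v (vs ! k) # map L (del_nth k vs)))"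
  proof (rule sum.cong)
    fix k assume "k \<in> {..<p}"
    then show "V ((map L vs)[k := B v (vs ! k)]) = (-1) ^ k * V (B v (vs ! k) # map L (del_nth k vs))"
      using alt_form_move_nth[OF Cons.prems(1), of "(map L vs)[k := B v (vs ! k)]" k] Cons.prems
      by (simp add: take_map drop_map)
  qed simp
  also have "(\<Sum>j<p. (-1) ^ j * ?A V (vs ! j) (v # del_nth j vs))
      = (\<Sum>j<p. (-1) ^ j * V (B (vs ! j) v # map L (del_nth j vs)))
        + (\<Sum>j<p. (-1) ^ j * ?A (\<lambda>ws. V (L v # ws)) (vs ! j) (del_nth j vs))"
    unfolding A_Cons by (simp add: distrib_left sum.distrib)
  also have "(\<Sum>j<p. (-1) ^ j * ?A (\<lambda>ws. V (L v # ws)) (vs ! j) (del_nth j vs)) = 0"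
  proof (cases p)
    case (Suc q)
    have "(\<Sum>j<length vs. (-1) ^ j * (\<Sum>k<q. V (L v # (map L (del_nth j vs))[k := B (vs ! j) (del_nth j vs ! k)]))) = 0"
      using Cons.IH[of q "\<lambda>ws. V (L v # ws)"] Cons.prems Suc alt_form_Cons by auto
    moreover have "length (del_nth j vs) = q" if "j < p" for j using len[OF that] Suc by simp
    ultimately show ?thesis using Cons.prems Suc by simp
  qed simp
  finally show ?case by (simp add: sym[of v])
qed simp

section \<open>The exterior derivative in coordinates\<close>

definition ext_d_coord :: "(real^'n::finite \<Rightarrow> (real^'n) list \<Rightarrow> real) \<Rightarrow> real^'n \<Rightarrow> (real^'n) list \<Rightarrow> real" where
  "ext_d_coord W x vs = (\<Sum>j<length vs. (-1) ^ j *
     frechet_derivative (\<lambda>y. W y (del_nth j vs)) (at x) (vs ! j))"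

lemma ext_d_coord_Nil [simp]: "ext_d_coord W x [] = 0"
  by (simp add: ext_d_coord_def)

text \<open>Cartan's formula \<open>\<iota>\<^sub>v d = D\<^sub>v - d \<iota>\<^sub>v\<close> for a constant vector field \<open>v\<close>. It turns statements about the
  exterior derivative into inductions over the list of arguments, with contraction by the head as the
  induction step.\<close>

lemma ext_d_coord_Cons:
  "ext_d_coord W x (v # vs) = frechet_derivative (\<lambda>y. W y vs) (at x) v - ext_d_coord (\<lambda>y ws. W y (v # ws)) x vs"
  by (simp add: ext_d_coord_def sum.lessThan_Suc_shift sum_negf del: sum.lessThan_Suc)

lemma ext_d_coord_cong:
  assumes "open U" "x \<in> U" "\<And>y ws. y \<in> U \<Longrightarrow> length ws = length vs - 1 \<Longrightarrow> W y ws = W' y ws"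
  shows "ext_d_coord W x vs = ext_d_coord W' x vs"
  unfolding ext_d_coord_def
  by (intro sum.cong refl arg_cong2[where f="(*)"] fun_cong[OF frechet_derivative_cong_open[OF assms(1,2)]] assms(3)) auto

lemma frechet_derivative_eqI: "(f has_derivative D) (at x) \<Longrightarrow> frechet_derivative f (at x) v = D v"
  using frechet_derivative_at by fastforce

lemma frechet_derivative_add:
  assumes "f differentiable (at x)" "g differentiable (at x)"
  shows "frechet_derivative (\<lambda>y. f y + g y) (at x) v = frechet_derivative f (at x) v + frechet_derivative g (at x) v"
proof -
  have "((\<lambda>y. f y + g y) has_derivative (\<lambda>v. frechet_derivative f (at x) v + frechet_derivative g (at x) v)) (at x)"
    by (intro has_derivative_add frechet_derivative_worksI assms)
  then show ?thesis by (rule frechet_derivative_eqI)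
qed

lemma frechet_derivative_diff:
  assumes "f differentiable (at x)" "g differentiable (at x)"
  shows "frechet_derivative (\<lambda>y. f y - g y) (at x) v = frechet_derivative f (at x) v - frechet_derivative g (at x) v"
proof -
  have "((\<lambda>y. f y - g y) has_derivative (\<lambda>v. frechet_derivative f (at x) v - frechet_derivative g (at x) v)) (at x)"
    by (intro has_derivative_diff frechet_derivative_worksI assms)
  then show ?thesis by (rule frechet_derivative_eqI)
qed

lemma frechet_derivative_cmult:
  fixes f :: "'a::real_normed_vector \<Rightarrow> real"
  assumes "f differentiable (at x)"
  shows "frechet_derivative (\<lambda>y. a * f y) (at x) v = a * frechet_derivative f (at x) v"
proof -
  have "((\<lambda>y. a * f y) has_derivative (\<lambda>v. a * frechet_derivative f (at x) v)) (at x)"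
    by (intro has_derivative_mult_right frechet_derivative_worksI assms)
  then show ?thesis by (rule frechet_derivative_eqI)
qed

lemma frechet_derivative_mult:
  fixes f :: "'a::real_normed_vector \<Rightarrow> real"
  assumes "f differentiable (at x)" "g differentiable (at x)"
  shows "frechet_derivative (\<lambda>y. f y * g y) (at x) v = f x * frechet_derivative g (at x) v + frechet_derivative f (at x) v * g x"
proof -
  have "((\<lambda>y. f y * g y) has_derivative (\<lambda>v. f x * frechet_derivative g (at x) v + frechet_derivative f (at x) v * g x)) (at x)"
    by (intro has_derivative_mult frechet_derivative_worksI assms)
  then show ?thesis by (rule frechet_derivative_eqI)
qed

lemma frechet_derivative_sum:
  assumes "\<And>i. i \<in> I \<Longrightarrow> f i differentiable (at x)"
  shows "frechet_derivative (\<lambda>y. \<Sum>i\<in>I. f i y) (at x) v = (\<Sum>i\<in>I. frechet_derivative (f i) (at x) v)"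
proof -
  have "((\<lambda>y. \<Sum>i\<in>I. f i y) has_derivative (\<lambda>v. (\<Sum>i\<in>I. frechet_derivative (f i) (at x) v))) (at x)"
    by (intro has_derivative_sum frechet_derivative_worksI assms)
  then show ?thesis by (rule frechet_derivative_eqI)
qed

lemma ext_d_coord_diff:
  assumes "\<And>ws. (\<lambda>y. W y ws) differentiable (at x)" "\<And>ws. (\<lambda>y. W' y ws) differentiable (at x)"
  shows "ext_d_coord (\<lambda>y ws. W y ws - W' y ws) x vs = ext_d_coord W x vs - ext_d_coord W' x vs"
  by (simp add: ext_d_coord_def frechet_derivative_diff assms right_diff_distrib sum_subtractf)

lemma smooth_on_ext_d_coord:
  "open U \<Longrightarrow> (\<And>ws. smooth_on U (\<lambda>x. W x ws)) \<Longrightarrow> smooth_on U (\<lambda>x. ext_d_coord W x vs)"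
  unfolding ext_d_coord_def
  by (intro smooth_on_sum smooth_on_mult smooth_on_frechet_derivative) auto

text \<open>By Cartan's formula, \<open>\<iota>\<^sub>u d d = D\<^sub>u d - d D\<^sub>u + d d \<iota>\<^sub>u\<close>, and \<open>D\<^sub>u\<close> commutes with \<open>d\<close> because second
  derivatives are symmetric.\<close>

lemma ext_d_coord_ext_d_coord:
  assumes "open U" "x \<in> U"
  shows "(\<And>ws. smooth_on U (\<lambda>x. W x ws)) \<Longrightarrow> ext_d_coord (ext_d_coord W) x vs = 0"
proof (induction vs arbitrary: W)
  case (Cons u vs)
  have diff: "(\<lambda>y. W y ws) differentiable (at y)" if "y \<in> U" for ws y
    using smooth_on_differentiable[OF Cons.prems assms(1) that] .
  let ?D = "\<lambda>y ws. frechet_derivative (\<lambda>y. W y ws) (at y) u"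
  have smD: "smooth_on U (\<lambda>y. frechet_derivative (\<lambda>y. W y ws) (at y) v)" for ws v
    using smooth_on_frechet_derivative[OF assms(1) Cons.prems] .
  have "ext_d_coord (\<lambda>y ws. ext_d_coord W y (u # ws)) x vs
      = ext_d_coord (\<lambda>y ws. ?D y ws - ext_d_coord (\<lambda>y ws. W y (u # ws)) y ws) x vs"
    by (simp only: ext_d_coord_Cons)
  also have "\<dots> = ext_d_coord ?D x vs - ext_d_coord (ext_d_coord (\<lambda>y ws. W y (u # ws))) x vs"
    by (intro ext_d_coord_diff smooth_on_differentiable[OF _ assms] smD
        smooth_on_ext_d_coord[OF assms(1)] Cons.prems)
  also have "\<dots> = ext_d_coord ?D x vs" using Cons.IH Cons.prems by simp
  also have "\<dots> = frechet_derivative (\<lambda>y. ext_d_coord W y vs) (at x) u"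
  proof -
    have "frechet_derivative (\<lambda>y. ext_d_coord W y vs) (at x) u =
      (\<Sum>j<length vs. (-1) ^ j * frechet_derivative (\<lambda>y. frechet_derivative (\<lambda>y. W y (del_nth j vs)) (at y) (vs ! j)) (at x) u)"
      unfolding ext_d_coord_def
      using smooth_on_differentiable[OF smD assms] by (simp add: frechet_derivative_sum frechet_derivative_cmult)
    then show ?thesis
      by (simp add: ext_d_coord_def frechet_derivative_commute[OF assms Cons.prems, of _ u])
  qed
  finally show ?case by (simp add: ext_d_coord_Cons[of "ext_d_coord W"])
qed simp

lemma linear_frechet_derivative_param:
  fixes W :: "'a::real_normed_vector \<Rightarrow> 'b::real_vector \<Rightarrow> real"
  assumes "open U" "x \<in> U" "\<And>y. y \<in> U \<Longrightarrow> linear (W y)" "\<And>v. (\<lambda>y. W y v) differentiable (at x)"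
  shows "linear (\<lambda>v. frechet_derivative (\<lambda>y. W y v) (at x) u)"
proof (rule linearI)
  fix v w
  have "frechet_derivative (\<lambda>y. W y (v + w)) (at x) u = frechet_derivative (\<lambda>y. W y v + W y w) (at x) u"
    using linear_add[OF assms(3)] by (intro fun_cong[OF frechet_derivative_cong_open[OF assms(1,2)]])
  then show "frechet_derivative (\<lambda>y. W y (v + w)) (at x) u = frechet_derivative (\<lambda>y. W y v) (at x) u + frechet_derivative (\<lambda>y. W y w) (at x) u"
    by (simp add: frechet_derivative_add assms(4))
next
  fix a v
  have "frechet_derivative (\<lambda>y. W y (a *\<^sub>R v)) (at x) u = frechet_derivative (\<lambda>y. a * W y v) (at x) u"
    using linear_cmul[OF assms(3)] by (intro fun_cong[OF frechet_derivative_cong_open[OF assms(1,2)]]) simp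
  then show "frechet_derivative (\<lambda>y. W y (a *\<^sub>R v)) (at x) u = a *\<^sub>R frechet_derivative (\<lambda>y. W y v) (at x) u"
    by (simp add: frechet_derivative_cmult assms(4))
qed

lemma linear_sum_fun: "(\<And>i. i \<in> I \<Longrightarrow> linear (f i)) \<Longrightarrow> linear (\<lambda>x. \<Sum>i\<in>I. f i x)"
  by (rule linear_compose_sum) blast

lemma linear_cmult_fun: "linear f \<Longrightarrow> linear (\<lambda>x. a * f x :: real)"
  using linear_compose_scale_right[of f a] by simp

lemma linear_ext_d_coord_nth:
  assumes "open U" "x \<in> U"
  shows "(\<And>y. y \<in> U \<Longrightarrow> alt_form p (W y)) \<Longrightarrow> (\<And>ws. (\<lambda>y. W y ws) differentiable (at x)) \<Longrightarrow>
    length vs = Suc p \<Longrightarrow> i < Suc p \<Longrightarrow> linear (\<lambda>v. ext_d_coord W x (vs[i := v]))"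
proof (induction vs arbitrary: i p W)
  case (Cons u vs)
  show ?case
  proof (cases i)
    case 0
    have "linear (\<lambda>v. ext_d_coord (\<lambda>y ws. W y (v # ws)) x vs)"
      unfolding ext_d_coord_def
    proof (intro linear_sum_fun linear_cmult_fun linear_frechet_derivative_param[OF assms])
      fix j y assume "j \<in> {..<length vs}" "y \<in> U"
      then show "linear (\<lambda>v. W y (v # del_nth j vs))"
        using Cons.prems(1)[of y] Cons.prems(3)
        by (cases p) (auto intro!: alt_form_linear_head[of "length vs - 1" "W y"])
    qed (use Cons.prems in auto)
    moreover have "linear (\<lambda>v. frechet_derivative (\<lambda>y. W y vs) (at x) v)"
      using Cons.prems(2) by (rule linear_frechet_derivative)
    ultimately show ?thesis using 0
      by (simp add: ext_d_coord_Cons linear_compose_sub)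
  next
    case (Suc k)
    then obtain q where q: "p = Suc q" "k < Suc q" using Cons.prems(4) by (cases p) auto
    have "linear (\<lambda>v. ext_d_coord (\<lambda>y ws. W y (u # ws)) x (vs[k := v]))"
      using Cons.prems q by (intro Cons.IH) (auto intro: alt_form_Cons)
    moreover have "linear (\<lambda>v. frechet_derivative (\<lambda>y. W y (vs[k := v])) (at x) u)"
      using Cons.prems q by (intro linear_frechet_derivative_param[OF assms]) (auto intro: alt_form_linear_nth)
    ultimately show ?thesis using Suc
      by (simp add: ext_d_coord_Cons linear_compose_sub)
  qed
qed simp

text \<open>If the head does not belong to the repeated pair, both terms of Cartan's formula vanish. If it does,
  \<open>d \<iota>\<^sub>v\<close> reduces to the one summand in which the second copy of \<open>v\<close> is the direction of differentiation,
  and this is \<open>D\<^sub>v\<close> up to the sign of moving \<open>v\<close> to the front.\<close>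

lemma ext_d_coord_repeated:
  assumes "open U" "x \<in> U"
  shows "(\<And>y. y \<in> U \<Longrightarrow> alt_form p (W y)) \<Longrightarrow> (\<And>ws. (\<lambda>y. W y ws) differentiable (at x)) \<Longrightarrow>
    length vs = Suc p \<Longrightarrow> i < j \<Longrightarrow> j < Suc p \<Longrightarrow> vs ! i = vs ! j \<Longrightarrow> ext_d_coord W x vs = 0"
proof (induction vs arbitrary: i j p W)
  case (Cons v vs)
  then obtain k where k: "j = Suc k" "k < p" by (cases j) auto
  then obtain q where q: "p = Suc q" by (cases p) auto
  show ?case
  proof (cases i)
    case 0
    have v: "v = vs ! k" using Cons.prems k 0 by simp
    have "frechet_derivative (\<lambda>y. W y vs) (at x) v
        = frechet_derivative (\<lambda>y. (-1) ^ k * W y (v # del_nth k vs)) (at x) v"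
    proof (intro fun_cong[OF frechet_derivative_cong_open[OF assms]])
      show "W y vs = (-1) ^ k * W y (v # del_nth k vs)" if "y \<in> U" for y
        unfolding v by (rule alt_form_move_nth[OF Cons.prems(1)[OF that]]) (use k Cons.prems(3) in auto)
    qed
    also have "\<dots> = (-1) ^ k * frechet_derivative (\<lambda>y. W y (v # del_nth k vs)) (at x) (vs ! k)"
      using Cons.prems(2) v by (simp add: frechet_derivative_cmult)
    also have "\<dots> = (\<Sum>j<length vs. if j = k then (-1) ^ k * frechet_derivative (\<lambda>y. W y (v # del_nth k vs)) (at x) (vs ! k) else 0)"
      using k Cons.prems(3) by simp
    also have "\<dots> = ext_d_coord (\<lambda>y ws. W y (v # ws)) x vs"
      unfolding ext_d_coord_def
    proof (rule sum.cong, simp)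
      fix j assume j: "j \<in> {..<length vs}"
      show "(if j = k then (-1) ^ k * frechet_derivative (\<lambda>y. W y (v # del_nth k vs)) (at x) (vs ! k) else 0)
          = (-1) ^ j * frechet_derivative (\<lambda>y. W y (v # del_nth j vs)) (at x) (vs ! j)"
      proof (cases "j = k")
        case False
        have "v \<in> set (del_nth j vs)"
        proof (cases "k < j")
          case True
          then have "take j vs ! k = v" "k < length (take j vs)" using v j by auto
          then show ?thesis by (metis in_set_conv_nth Un_iff set_append)
        next
          case False
          with \<open>j \<noteq> k\<close> have "drop (Suc j) vs ! (k - Suc j) = v" "k - Suc j < length (drop (Suc j) vs)"
            using v k Cons.prems(3) by auto
          then show ?thesis by (metis in_set_conv_nth Un_iff set_append)
        qed
        then have "W y (v # del_nth j vs) = 0" if "y \<in> U" for y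
          using alt_form_mem[of q "W y" "del_nth j vs"] Cons.prems(1)[OF that] q j Cons.prems(3) by auto
        then have "frechet_derivative (\<lambda>y. W y (v # del_nth j vs)) (at x) = frechet_derivative (\<lambda>y. 0) (at x)"
          by (rule frechet_derivative_cong_open[OF assms])
        then show ?thesis using False by simp
      qed simp
    qed
    finally show ?thesis by (simp add: ext_d_coord_Cons)
  next
    case (Suc m)
    have "frechet_derivative (\<lambda>y. W y vs) (at x) = frechet_derivative (\<lambda>y. 0) (at x)"
      using alt_form_repeated[OF Cons.prems(1), of _ vs m k] Cons.prems k Suc
      by (intro frechet_derivative_cong_open[OF assms]) simp
    moreover have "ext_d_coord (\<lambda>y ws. W y (v # ws)) x vs = 0"
      using Cons.prems k q Suc by (intro Cons.IH[of q _ m k]) (auto intro: alt_form_Cons)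
    ultimately show ?thesis by (simp add: ext_d_coord_Cons)
  qed
qed simp

lemma alt_form_ext_d_coord:
  assumes "open U" "x \<in> U" "\<And>y. y \<in> U \<Longrightarrow> alt_form p (W y)" "\<And>ws. (\<lambda>y. W y ws) differentiable (at x)"
  shows "alt_form (Suc p) (ext_d_coord W x)"
  unfolding alt_form_def
proof (intro allI impI conjI)
  fix vs :: "(real^'a) list" and i j assume vs: "length vs = Suc p" "i < Suc p"
  show "linear (\<lambda>v. ext_d_coord W x (vs[i := v]))"
    using linear_ext_d_coord_nth[OF assms] vs by blast
  assume "j < Suc p" "i \<noteq> j \<and> vs ! i = vs ! j"
  then show "ext_d_coord W x vs = 0"
    using ext_d_coord_repeated[OF assms vs(1)] vs(2) by (metis linorder_neqE_nat)
qed

lemma alt_form_expand_head: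
  assumes "alt_form (Suc p) W" "length ws = p"
  shows "W (v # ws) = (\<Sum>i\<in>UNIV. v $ i * W (axis i 1 # ws))"
proof -
  interpret linear "\<lambda>v. W (v # ws)" by (rule alt_form_linear_head[OF assms])
  have "W (v # ws) = W ((\<Sum>i\<in>UNIV. v $ i *\<^sub>R axis i 1) # ws)"
    using basis_expansion[of v] by (simp add: scalar_mult_eq_scaleR)
  then show ?thesis by (simp add: sum scale)
qed

text \<open>The product rule for a multilinear form whose coefficients and arguments all vary. The head argument
  is expanded in the standard basis, so that only the product rule for scalar functions is needed.\<close>

lemma has_derivative_alt_form_subst:
  fixes F :: "real^'n::finite \<Rightarrow> (real^'m::finite) list \<Rightarrow> real" and us :: "(real^'n \<Rightarrow> real^'m) list"
  assumes "open U" "x \<in> U"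
  shows "length us = p \<Longrightarrow> (\<And>y. y \<in> U \<Longrightarrow> alt_form p (F y)) \<Longrightarrow> (\<And>ws. (\<lambda>y. F y ws) differentiable (at x)) \<Longrightarrow>
    (\<And>u. u \<in> set us \<Longrightarrow> u differentiable (at x)) \<Longrightarrow>
    ((\<lambda>y. F y (map (\<lambda>u. u y) us)) has_derivative (\<lambda>v. frechet_derivative (\<lambda>y. F y (map (\<lambda>u. u x) us)) (at x) v
       + (\<Sum>k<p. F x ((map (\<lambda>u. u x) us)[k := frechet_derivative (us ! k) (at x) v])))) (at x)"
proof (induction us arbitrary: p F)
  case Nil
  then show ?case using frechet_derivative_worksI by auto
next
  case (Cons u us)
  let ?r = "map (\<lambda>u. u x) us" and ?e = "\<lambda>i::'m. axis i (1::real)"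
  from Cons.prems obtain q where q: "p = Suc q" "length us = q" by auto
  have u: "u differentiable (at x)" using Cons.prems by simp
  have IH: "((\<lambda>y. F y (?e i # map (\<lambda>u. u y) us)) has_derivative
      (\<lambda>v. frechet_derivative (\<lambda>y. F y (?e i # ?r)) (at x) v
       + (\<Sum>k<q. F x (?e i # ?r[k := frechet_derivative (us ! k) (at x) v])))) (at x)" for i
    using Cons.prems q by (intro Cons.IH) (auto intro: alt_form_Cons)
  have exp: "F y (w # ws) = (\<Sum>i\<in>UNIV. w $ i * F y (?e i # ws))" if "y \<in> U" "length ws = q" for y w ws
    using alt_form_expand_head[of q "F y" ws w] Cons.prems(2)[OF that(1)] q that by simp
  have "((\<lambda>y. \<Sum>i\<in>UNIV. u y $ i * F y (?e i # map (\<lambda>u. u y) us)) has_derivative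
     (\<lambda>v. \<Sum>i\<in>UNIV. u x $ i * (frechet_derivative (\<lambda>y. F y (?e i # ?r)) (at x) v
       + (\<Sum>k<q. F x (?e i # ?r[k := frechet_derivative (us ! k) (at x) v])))
       + frechet_derivative u (at x) v $ i * F x (?e i # ?r))) (at x)" (is "(_ has_derivative ?D) _")
    by (intro has_derivative_sum has_derivative_mult IH frechet_derivative_vec_nth(1) u)
  then have "((\<lambda>y. F y (map (\<lambda>u. u y) (u # us))) has_derivative ?D) (at x)"
    by (rule has_derivative_transform_within_open[OF _ assms]) (use exp q in simp)
  moreover have "?D v = frechet_derivative (\<lambda>y. F y (u x # ?r)) (at x) v
       + (\<Sum>k<p. F x ((map (\<lambda>u. u x) (u # us))[k := frechet_derivative ((u # us) ! k) (at x) v]))" for v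
  proof -
    have "frechet_derivative (\<lambda>y. F y (u x # ?r)) (at x) v
        = frechet_derivative (\<lambda>y. \<Sum>i\<in>UNIV. u x $ i * F y (?e i # ?r)) (at x) v"
      using exp q by (intro fun_cong[OF frechet_derivative_cong_open[OF assms]]) simp
    also have "\<dots> = (\<Sum>i\<in>UNIV. u x $ i * frechet_derivative (\<lambda>y. F y (?e i # ?r)) (at x) v)"
      using Cons.prems(3) by (simp add: frechet_derivative_sum frechet_derivative_cmult)
    finally have 1: "frechet_derivative (\<lambda>y. F y (u x # ?r)) (at x) v = \<dots>" .
    have 2: "F x (u x # ?r[k := w]) = (\<Sum>i\<in>UNIV. u x $ i * F x (?e i # ?r[k := w]))" for k w
      using exp[OF assms(2)] q by simp
    have 3: "F x (frechet_derivative u (at x) v # ?r) = (\<Sum>i\<in>UNIV. frechet_derivative u (at x) v $ i * F x (?e i # ?r))"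
      using exp[OF assms(2)] q by simp
    have 4: "(\<Sum>i\<in>UNIV. u x $ i * (\<Sum>k<q. F x (?e i # ?r[k := frechet_derivative (us ! k) (at x) v])))
        = (\<Sum>k<q. F x (u x # ?r[k := frechet_derivative (us ! k) (at x) v]))"
      unfolding 2 by (subst sum.swap) (simp add: sum_distrib_left)
    have 5: "(\<Sum>k<p. F x ((map (\<lambda>u. u x) (u # us))[k := frechet_derivative ((u # us) ! k) (at x) v]))
        = F x (frechet_derivative u (at x) v # ?r) + (\<Sum>k<q. F x (u x # ?r[k := frechet_derivative (us ! k) (at x) v]))"
      using q by (simp add: sum.lessThan_Suc_shift del: sum.lessThan_Suc)
    show ?thesis unfolding 5 1 3 4[symmetric] by (simp add: distrib_left sum.distrib)
  qed
  ultimately show ?case by simp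
qed

text \<open>The derivative of a pulled back form consists of the pullback of the derivative and of terms with
  the second derivative \<open>B\<close> of the map in one of the arguments. As \<open>B\<close> is symmetric, the alternating sum
  of the latter is zero.\<close>

lemma ext_d_coord_pullback:
  fixes T :: "real^'n::finite \<Rightarrow> real^'n"
  assumes U: "open U" "x \<in> U" and U': "open U'" "T ` U \<subseteq> U'"
    and T: "\<And>i. smooth_on U (\<lambda>y. T y $ i)"
    and W: "\<And>z. z \<in> U' \<Longrightarrow> alt_form p (W z)" "\<And>ws. smooth_on U' (\<lambda>z. W z ws)"
    and W': "\<And>y ws. y \<in> U \<Longrightarrow> length ws = p \<Longrightarrow> W' y ws = W (T y) (map (frechet_derivative T (at y)) ws)"
    and vs: "length vs = Suc p"
  shows "ext_d_coord W' x vs = ext_d_coord W (T x) (map (frechet_derivative T (at x)) vs)"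
proof -
  let ?T = "\<lambda>y. frechet_derivative T (at y)"
  have dT: "T differentiable (at y)" if "y \<in> U" for y
    using smooth_on_differentiable[OF T U(1) that] by (rule differentiable_vecI)
  have nth: "?T y w $ i = frechet_derivative (\<lambda>y. T y $ i) (at y) w" if "y \<in> U" for y w i
    using frechet_derivative_vec_nth(2)[OF dT[OF that]] by simp
  have sT: "smooth_on U (\<lambda>y. ?T y w $ i)" for w i
    by (rule smooth_on_cong[OF U(1) _ smooth_on_frechet_derivative[OF U(1) T[of i], of w]]) (simp add: nth)
  have dT2: "(\<lambda>y. ?T y w) differentiable (at x)" for w
    using smooth_on_differentiable[OF sT U] by (rule differentiable_vecI)
  define B where "B = (\<lambda>v w. frechet_derivative (\<lambda>y. ?T y w) (at x) v)"
  have B: "B v w $ i = frechet_derivative (\<lambda>y. frechet_derivative (\<lambda>y. T y $ i) (at y) w) (at x) v" for v w i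
  proof -
    have "B v w $ i = frechet_derivative (\<lambda>y. ?T y w $ i) (at x) v"
      unfolding B_def by (rule frechet_derivative_vec_nth(2)[OF dT2, symmetric])
    also have "\<dots> = frechet_derivative (\<lambda>y. frechet_derivative (\<lambda>y. T y $ i) (at y) w) (at x) v"
      by (intro fun_cong[OF frechet_derivative_cong_open[OF U]] nth)
    finally show ?thesis .
  qed
  have B_sym: "B v w = B w v" for v w
    unfolding vec_eq_iff B by (intro allI frechet_derivative_commute[OF U T])
  have Tx: "T y \<in> U'" if "y \<in> U" for y using that U' by auto
  have dW: "(\<lambda>z. W z ws) differentiable (at (T x))" for ws
    using smooth_on_differentiable[OF W(2) U'(1) Tx[OF U(2)]] .
  have comp: "((\<lambda>y. W (T y) ws) has_derivative (\<lambda>v. frechet_derivative (\<lambda>z. W z ws) (at (T x)) (?T x v))) (at x)" for ws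
    using has_derivative_compose[OF frechet_derivative_worksI[OF dT[OF U(2)]] frechet_derivative_worksI[OF dW]] .
  have dW': "frechet_derivative (\<lambda>y. W' y ws) (at x) v
      = frechet_derivative (\<lambda>z. W z (map (?T x) ws)) (at (T x)) (?T x v)
        + (\<Sum>k<p. W (T x) ((map (?T x) ws)[k := B v (ws ! k)]))" if ws: "length ws = p" for ws v
  proof -
    let ?us = "map (\<lambda>w y. ?T y w) ws"
    have "((\<lambda>y. W (T y) (map (\<lambda>u. u y) ?us)) has_derivative
       (\<lambda>v. frechet_derivative (\<lambda>y. W (T y) (map (\<lambda>u. u x) ?us)) (at x) v
       + (\<Sum>k<p. W (T x) ((map (\<lambda>u. u x) ?us)[k := frechet_derivative (?us ! k) (at x) v])))) (at x)"
      using ws dT2 comp Tx W(1)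
      by (intro has_derivative_alt_form_subst[OF U, where F="\<lambda>y. W (T y)"])
         (auto simp: differentiable_def)
    moreover have "frechet_derivative (\<lambda>y. W (T y) (map (?T x) ws)) (at x) v
        = frechet_derivative (\<lambda>z. W z (map (?T x) ws)) (at (T x)) (?T x v)" for v
      by (rule frechet_derivative_eqI[OF comp])
    ultimately have "((\<lambda>y. W (T y) (map (?T y) ws)) has_derivative
       (\<lambda>v. frechet_derivative (\<lambda>z. W z (map (?T x) ws)) (at (T x)) (?T x v)
        + (\<Sum>k<p. W (T x) ((map (?T x) ws)[k := B v (ws ! k)])))) (at x)"
      using ws by (simp add: o_def B_def)
    from has_derivative_transform_within_open[OF this U, of "\<lambda>y. W' y ws"] show ?thesis
      using W' ws by (intro frechet_derivative_eqI) simp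
  qed
  have len: "length (del_nth j vs) = p" if "j < length vs" for j using that vs by simp
  have "ext_d_coord W' x vs = (\<Sum>j<length vs. (-1) ^ j *
      frechet_derivative (\<lambda>z. W z (map (?T x) (del_nth j vs))) (at (T x)) (?T x (vs ! j)))
     + (\<Sum>j<length vs. (-1) ^ j * (\<Sum>k<p. W (T x) ((map (?T x) (del_nth j vs))[k := B (vs ! j) (del_nth j vs ! k)])))"
    unfolding ext_d_coord_def sum.distrib[symmetric] distrib_left[symmetric]
    by (intro sum.cong refl arg_cong2[where f="(*)"] dW' len) simp
  also have "(\<Sum>j<length vs. (-1) ^ j * (\<Sum>k<p. W (T x) ((map (?T x) (del_nth j vs))[k := B (vs ! j) (del_nth j vs ! k)]))) = 0"
    using alternating_sum_symmetric_eq_0[of B, OF B_sym W(1)[OF Tx[OF U(2)]] vs] .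
  finally show ?thesis by (simp add: ext_d_coord_def take_map drop_map)
qed

section \<open>Forms on an oriented manifold\<close>

locale oriented_atlas =
  fixes \<A> :: "('m::{t2_space, second_countable_topology}, 'n::finite) chart set"
  assumes atlas: "oriented_smooth_atlas \<A>"
begin

lemma ex_chart: obtains c where "c \<in> \<A>" "m \<in> cdom c"
  using atlas unfolding oriented_smooth_atlas_def by blast

context
  fixes c assumes c: "c \<in> \<A>"
begin

lemma open_cdom: "open (cdom c)" and open_cimg: "open (cimg c)"
  and homeo: "homeomorphism (cdom c) (cimg c) (cmap c) (cinv c)"
  using atlas c unfolding oriented_smooth_atlas_def by blast+

lemma cinv_cmap: "m \<in> cdom c \<Longrightarrow> cinv c (cmap c m) = m"
  and cmap_cinv: "x \<in> cimg c \<Longrightarrow> cmap c (cinv c x) = x"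
  and cinv_in: "x \<in> cimg c \<Longrightarrow> cinv c x \<in> cdom c"
  and cmap_in: "m \<in> cdom c \<Longrightarrow> cmap c m \<in> cimg c"
  and cont_cmap: "continuous_on (cdom c) (cmap c)"
  and cont_cinv: "continuous_on (cimg c) (cinv c)"
  using homeo unfolding homeomorphism_def by auto

lemma open_preimage_cinv: "open V \<Longrightarrow> open (cimg c \<inter> cinv c -` V)"
  using continuous_open_preimage[OF cont_cinv open_cimg] .

lemma overlap_eq: "overlap c c' = cimg c \<inter> cinv c -` cdom c'"
proof -
  have "x \<in> overlap c c' \<longleftrightarrow> x \<in> cimg c \<inter> cinv c -` cdom c'" for x
    using cinv_cmap cmap_cinv cmap_in cinv_in by (auto simp: overlap_def image_iff) (metis IntI)
  then show ?thesis by blast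
qed

end

lemma open_overlap: "c \<in> \<A> \<Longrightarrow> c' \<in> \<A> \<Longrightarrow> open (overlap c c')"
  by (simp add: overlap_eq open_preimage_cinv open_cdom)

lemma trans_map_eq: "trans_map c c' x = cmap c' (cinv c x)"
  by (simp add: trans_map_def)

lemma overlap_subset: "c \<in> \<A> \<Longrightarrow> overlap c c' \<subseteq> cimg c"
  and overlapD: "c \<in> \<A> \<Longrightarrow> x \<in> overlap c c' \<Longrightarrow> x \<in> cimg c"
  by (simp_all add: overlap_eq)

lemma trans_map_in: "c \<in> \<A> \<Longrightarrow> c' \<in> \<A> \<Longrightarrow> x \<in> overlap c c' \<Longrightarrow> trans_map c c' x \<in> cimg c'"
  by (simp add: overlap_eq trans_map_eq cmap_in)

lemma cinv_trans_map: "c \<in> \<A> \<Longrightarrow> c' \<in> \<A> \<Longrightarrow> x \<in> overlap c c' \<Longrightarrow> cinv c' (trans_map c c' x) = cinv c x"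
  by (simp add: overlap_eq trans_map_eq cinv_cmap)

lemma smooth_trans_map: "c \<in> \<A> \<Longrightarrow> c' \<in> \<A> \<Longrightarrow> smooth_on (overlap c c') (\<lambda>x. trans_map c c' x $ i)"
  using atlas unfolding oriented_smooth_atlas_def by blast

lemma differentiable_trans_map:
  "c \<in> \<A> \<Longrightarrow> c' \<in> \<A> \<Longrightarrow> x \<in> overlap c c' \<Longrightarrow> trans_map c c' differentiable (at x)"
  by (intro differentiable_vecI smooth_on_differentiable[OF smooth_trans_map open_overlap])

lemma linear_trans_deriv:
  "c \<in> \<A> \<Longrightarrow> c' \<in> \<A> \<Longrightarrow> x \<in> overlap c c' \<Longrightarrow> linear (trans_deriv c c' x)"
  unfolding trans_deriv_def using linear_frechet_derivative[OF differentiable_trans_map] .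

lemma in_forms_iff:
  "\<omega> \<in> forms \<A> p \<longleftrightarrow>
     (\<forall>c x vs. c \<notin> \<A> \<or> x \<notin> cimg c \<or> length vs \<noteq> p \<longrightarrow> \<omega> c x vs = 0) \<and>
     (\<forall>c\<in>\<A>. \<forall>vs. length vs = p \<longrightarrow> smooth_on (cimg c) (\<lambda>x. \<omega> c x vs)) \<and>
     (\<forall>c\<in>\<A>. \<forall>x\<in>cimg c. alt_form p (\<omega> c x)) \<and>
     (\<forall>c\<in>\<A>. \<forall>c'\<in>\<A>. \<forall>x\<in>overlap c c'. \<forall>vs. length vs = p \<longrightarrow>
        \<omega> c x vs = \<omega> c' (trans_map c c' x) (map (trans_deriv c c' x) vs))"
  by (simp add: forms_def alt_form_def)

lemma formsI:
  assumes "\<And>c x vs. c \<notin> \<A> \<or> x \<notin> cimg c \<or> length vs \<noteq> p \<Longrightarrow> \<omega> c x vs = 0"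
    and "\<And>c vs. c \<in> \<A> \<Longrightarrow> length vs = p \<Longrightarrow> smooth_on (cimg c) (\<lambda>x. \<omega> c x vs)"
    and "\<And>c x. c \<in> \<A> \<Longrightarrow> x \<in> cimg c \<Longrightarrow> alt_form p (\<omega> c x)"
    and "\<And>c c' x vs. c \<in> \<A> \<Longrightarrow> c' \<in> \<A> \<Longrightarrow> x \<in> overlap c c' \<Longrightarrow> length vs = p \<Longrightarrow>
        \<omega> c x vs = \<omega> c' (trans_map c c' x) (map (trans_deriv c c' x) vs)"
  shows "\<omega> \<in> forms \<A> p"
  unfolding in_forms_iff using assms by blast

lemma form_zero: "\<omega> \<in> forms \<A> p \<Longrightarrow> c \<notin> \<A> \<or> x \<notin> cimg c \<or> length vs \<noteq> p \<Longrightarrow> \<omega> c x vs = 0"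
  unfolding in_forms_iff by blast

lemma form_smooth:
  assumes "\<omega> \<in> forms \<A> p" "c \<in> \<A>"
  shows "smooth_on (cimg c) (\<lambda>x. \<omega> c x vs)"
proof (cases "length vs = p")
  case False
  then have "(\<lambda>x. \<omega> c x vs) = (\<lambda>x. 0)" using form_zero[OF assms(1)] by auto
  then show ?thesis by simp
qed (use assms in \<open>simp add: in_forms_iff\<close>)

lemma form_alt: "\<omega> \<in> forms \<A> p \<Longrightarrow> c \<in> \<A> \<Longrightarrow> x \<in> cimg c \<Longrightarrow> alt_form p (\<omega> c x)"
  unfolding in_forms_iff by blast

lemma form_pullback:
  "\<omega> \<in> forms \<A> p \<Longrightarrow> c \<in> \<A> \<Longrightarrow> c' \<in> \<A> \<Longrightarrow> x \<in> overlap c c' \<Longrightarrow> length vs = p \<Longrightarrow>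
   \<omega> c x vs = \<omega> c' (trans_map c c' x) (map (trans_deriv c c' x) vs)"
  unfolding in_forms_iff by blast

lemma form_differentiable:
  "\<omega> \<in> forms \<A> p \<Longrightarrow> c \<in> \<A> \<Longrightarrow> x \<in> cimg c \<Longrightarrow> (\<lambda>x. \<omega> c x vs) differentiable (at x)"
  by (rule smooth_on_differentiable[OF form_smooth open_cimg])

lemma form_eqI:
  assumes "\<omega> \<in> forms \<A> p" "\<eta> \<in> forms \<A> q"
    and "\<And>c x vs. c \<in> \<A> \<Longrightarrow> x \<in> cimg c \<Longrightarrow> \<omega> c x vs = \<eta> c x vs"
  shows "\<omega> = \<eta>"
  using assms form_zero by (intro ext) metis

lemma smooth_fun_comp: "f \<in> smooth_funs \<A> \<Longrightarrow> c \<in> \<A> \<Longrightarrow> smooth_on (cimg c) (\<lambda>x. f (cinv c x))"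
  by (simp add: smooth_funs_def o_def)

lemma smooth_fun_differentiable:
  "f \<in> smooth_funs \<A> \<Longrightarrow> c \<in> \<A> \<Longrightarrow> x \<in> cimg c \<Longrightarrow> (\<lambda>x. f (cinv c x)) differentiable (at x)"
  by (rule smooth_on_differentiable[OF smooth_fun_comp open_cimg])

subsection \<open>Module structure\<close>

lemma zero_in_forms [simp]: "0 \<in> forms \<A> p"
  by (simp add: in_forms_iff alt_form_def linear_zero)

lemma add_in_forms [simp]:
  assumes "\<omega> \<in> forms \<A> p" "\<eta> \<in> forms \<A> p"
  shows "\<omega> + \<eta> \<in> forms \<A> p"
proof (rule formsI)
  show "(\<omega> + \<eta>) c x vs = 0" if "c \<notin> \<A> \<or> x \<notin> cimg c \<or> length vs \<noteq> p" for c x vs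
    using form_zero[OF assms(1) that] form_zero[OF assms(2) that] by simp
  show "smooth_on (cimg c) (\<lambda>x. (\<omega> + \<eta>) c x vs)" if "c \<in> \<A>" for c vs
    using smooth_on_add[OF open_cimg form_smooth[OF assms(1)] form_smooth[OF assms(2)], OF that that that] by simp
  show "alt_form p ((\<omega> + \<eta>) c x)" if "c \<in> \<A>" "x \<in> cimg c" for c x
    using form_alt[OF assms(1) that] form_alt[OF assms(2) that]
    by (auto simp: alt_form_def intro!: linear_compose_add)
  show "(\<omega> + \<eta>) c x vs = (\<omega> + \<eta>) c' (trans_map c c' x) (map (trans_deriv c c' x) vs)"
    if "c \<in> \<A>" "c' \<in> \<A>" "x \<in> overlap c c'" "length vs = p" for c c' x vs
    using form_pullback[OF assms(1) that] form_pullback[OF assms(2) that] by simp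
qed

lemma fmult_in_forms [simp]:
  assumes "\<omega> \<in> forms \<A> p" "f \<in> smooth_funs \<A>"
  shows "fmult f \<omega> \<in> forms \<A> p"
proof (rule formsI)
  show "fmult f \<omega> c x vs = 0" if "c \<notin> \<A> \<or> x \<notin> cimg c \<or> length vs \<noteq> p" for c x vs
    using form_zero[OF assms(1) that] by (simp add: fmult_def)
  show "smooth_on (cimg c) (\<lambda>x. fmult f \<omega> c x vs)" if "c \<in> \<A>" for c vs
    using smooth_on_mult[OF open_cimg smooth_fun_comp[OF assms(2)] form_smooth[OF assms(1)], OF that that that]
    by (simp add: fmult_def)
  show "alt_form p (fmult f \<omega> c x)" if "c \<in> \<A>" "x \<in> cimg c" for c x
    using form_alt[OF assms(1) that] by (auto simp: alt_form_def fmult_def intro!: linear_cmult_fun)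
  show "fmult f \<omega> c x vs = fmult f \<omega> c' (trans_map c c' x) (map (trans_deriv c c' x) vs)"
    if "c \<in> \<A>" "c' \<in> \<A>" "x \<in> overlap c c'" "length vs = p" for c c' x vs
    using form_pullback[OF assms(1) that] cinv_trans_map[OF that(1-3)] by (simp add: fmult_def)
qed

lemma const_smooth_fun [simp]: "(\<lambda>_. a) \<in> smooth_funs \<A>"
  by (simp add: smooth_funs_def o_def)

lemma fscale_eq_fmult: "fscale a = fmult (\<lambda>_. a)"
  by (simp add: fscale_def fmult_def fun_eq_iff)

lemma fscale_in_forms [simp]: "\<omega> \<in> forms \<A> p \<Longrightarrow> fscale a \<omega> \<in> forms \<A> p"
  by (simp add: fscale_eq_fmult)

lemma diff_in_forms [simp]:
  assumes "\<omega> \<in> forms \<A> p" "\<eta> \<in> forms \<A> p"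
  shows "\<omega> - \<eta> \<in> forms \<A> p"
proof -
  have "\<omega> - \<eta> = \<omega> + fscale (-1) \<eta>" by (simp add: fun_eq_iff fscale_def)
  then show ?thesis using assms add_in_forms[OF _ fscale_in_forms] by metis
qed

lemma fmult_simps:
  "fmult f (\<omega> + \<eta>) = fmult f \<omega> + fmult f \<eta>"
  "fmult f (\<omega> - \<eta>) = fmult f \<omega> - fmult f \<eta>"
  "fmult f (fscale a \<omega>) = fscale a (fmult f \<omega>)"
  "fmult f (fmult g \<omega>) = fmult g (fmult f \<omega>)"
  "fmult f 0 = 0"
  by (simp_all add: fun_eq_iff fmult_def fscale_def algebra_simps)

subsection \<open>The exterior derivative\<close>

lemma ext_d_eq: "ext_d \<A> \<omega> c x vs = (if c \<in> \<A> \<and> x \<in> cimg c then ext_d_coord (\<omega> c) x vs else 0)"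
  by (simp add: ext_d_def ext_d_coord_def)

text \<open>Invariance under changes of charts is the naturality of the exterior derivative, applied to the
  transition map.\<close>

lemma ext_d_in_forms [simp]:
  assumes "\<omega> \<in> forms \<A> p"
  shows "ext_d \<A> \<omega> \<in> forms \<A> (Suc p)"
proof -
  have zero: "ext_d \<A> \<omega> c x vs = 0" if "length vs \<noteq> Suc p" for c x vs
  proof -
    have "(\<lambda>y. \<omega> c y (del_nth j vs)) = (\<lambda>y. 0)" if "j < length vs" for j
    proof -
      have "length (del_nth j vs) \<noteq> p" using that \<open>length vs \<noteq> Suc p\<close> by auto
      then show ?thesis using form_zero[OF assms] by blast
    qed
    then show ?thesis by (simp add: ext_d_eq ext_d_coord_def)
  qed
  moreover have "smooth_on (cimg c) (\<lambda>x. ext_d \<A> \<omega> c x vs)" if "c \<in> \<A>" for c vs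
    by (rule smooth_on_cong[OF open_cimg[OF that] _ smooth_on_ext_d_coord[OF open_cimg[OF that] form_smooth[OF assms that]]])
       (simp add: ext_d_eq that)
  moreover have "alt_form (Suc p) (ext_d \<A> \<omega> c x)" if "c \<in> \<A>" "x \<in> cimg c" for c x
  proof -
    have "alt_form (Suc p) (ext_d_coord (\<omega> c) x)"
      using alt_form_ext_d_coord[OF open_cimg[OF that(1)] that(2) form_alt[OF assms that(1)]
          form_differentiable[OF assms that]] .
    moreover have "ext_d \<A> \<omega> c x = ext_d_coord (\<omega> c) x" using that by (simp add: fun_eq_iff ext_d_eq)
    ultimately show ?thesis by simp
  qed
  moreover have "ext_d \<A> \<omega> c x vs = ext_d \<A> \<omega> c' (trans_map c c' x) (map (trans_deriv c c' x) vs)"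
    if c: "c \<in> \<A>" "c' \<in> \<A>" and x: "x \<in> overlap c c'" and vs: "length vs = Suc p" for c c' x vs
  proof -
    have "ext_d_coord (\<omega> c) x vs = ext_d_coord (\<omega> c') (trans_map c c' x) (map (frechet_derivative (trans_map c c') (at x)) vs)"
    proof (rule ext_d_coord_pullback[OF open_overlap[OF c] x open_cimg[OF c(2)] _ smooth_trans_map[OF c]])
      show "trans_map c c' ` overlap c c' \<subseteq> cimg c'" using trans_map_in[OF c] by blast
      show "alt_form p (\<omega> c' z)" if "z \<in> cimg c'" for z using form_alt[OF assms c(2) that] .
      show "smooth_on (cimg c') (\<lambda>z. \<omega> c' z ws)" for ws using form_smooth[OF assms c(2)] .
      show "\<omega> c y ws = \<omega> c' (trans_map c c' y) (map (frechet_derivative (trans_map c c') (at y)) ws)"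
        if "y \<in> overlap c c'" "length ws = p" for y ws
        using form_pullback[OF assms c that] by (simp add: trans_deriv_def[abs_def])
    qed (rule vs)
    moreover have "x \<in> cimg c" "trans_map c c' x \<in> cimg c'"
      using overlapD[OF c(1) x] trans_map_in[OF c x] by auto
    ultimately show ?thesis using c by (simp add: ext_d_eq trans_deriv_def[abs_def])
  qed
  moreover have "ext_d \<A> \<omega> c x vs = 0" if "c \<notin> \<A> \<or> x \<notin> cimg c \<or> length vs \<noteq> Suc p" for c x vs
  proof (cases "length vs = Suc p")
    case True
    then have "\<not> (c \<in> \<A> \<and> x \<in> cimg c)" using that by blast
    then show ?thesis by (simp only: ext_d_eq if_False)
  qed (rule zero)
  ultimately show ?thesis unfolding in_forms_iff by blast
qed

lemma ext_d_add:
  assumes "\<omega> \<in> forms \<A> p" "\<eta> \<in> forms \<A> p"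
  shows "ext_d \<A> (\<omega> + \<eta>) = ext_d \<A> \<omega> + ext_d \<A> \<eta>"
proof (intro ext)
  fix c x vs
  show "ext_d \<A> (\<omega> + \<eta>) c x vs = (ext_d \<A> \<omega> + ext_d \<A> \<eta>) c x vs"
    using form_differentiable[OF assms(1), of c x] form_differentiable[OF assms(2), of c x]
    by (simp add: ext_d_eq ext_d_coord_def frechet_derivative_add distrib_left sum.distrib)
qed

lemma ext_d_fscale:
  assumes "\<omega> \<in> forms \<A> p"
  shows "ext_d \<A> (fscale a \<omega>) = fscale a (ext_d \<A> \<omega>)"
proof (intro ext)
  fix c x vs
  show "ext_d \<A> (fscale a \<omega>) c x vs = fscale a (ext_d \<A> \<omega>) c x vs"
    using form_differentiable[OF assms, of c x]
    by (simp add: fscale_def ext_d_eq ext_d_coord_def frechet_derivative_cmult sum_distrib_left mult_ac)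
qed

lemma ext_d_ext_d:
  assumes "\<omega> \<in> forms \<A> p"
  shows "ext_d \<A> (ext_d \<A> \<omega>) = 0"
proof (intro ext)
  fix c x vs
  show "ext_d \<A> (ext_d \<A> \<omega>) c x vs = (0 :: ('m, 'n) form) c x vs"
  proof (cases "c \<in> \<A> \<and> x \<in> cimg c")
    case True
    then have "ext_d_coord (ext_d \<A> \<omega> c) x vs = ext_d_coord (ext_d_coord (\<omega> c)) x vs"
      by (intro ext_d_coord_cong[OF open_cimg]) (auto simp: ext_d_eq)
    also have "\<dots> = 0"
      using ext_d_coord_ext_d_coord[OF open_cimg, where W="\<omega> c"] form_smooth[OF assms] True by blast
    finally show ?thesis using True by (simp add: ext_d_eq)
  next
    case False
    then show ?thesis by (auto simp only: ext_d_eq if_False zero_fun_apply)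
  qed
qed

text \<open>The commutator of \<open>d\<close> with a function is its principal symbol, the wedge product with \<open>df\<close>.\<close>

definition d_comm :: "('m \<Rightarrow> real) \<Rightarrow> ('m, 'n) operator" where
  "d_comm f \<omega> = ext_d \<A> (fmult f \<omega>) - fmult f (ext_d \<A> \<omega>)"

lemma d_comm_in_forms [simp]: "\<omega> \<in> forms \<A> p \<Longrightarrow> f \<in> smooth_funs \<A> \<Longrightarrow> d_comm f \<omega> \<in> forms \<A> (Suc p)"
  by (simp add: d_comm_def)

lemma d_comm_eq:
  assumes "\<omega> \<in> forms \<A> p" "f \<in> smooth_funs \<A>" "c \<in> \<A>" "x \<in> cimg c"
  shows "d_comm f \<omega> c x vs = (\<Sum>j<length vs. (-1) ^ j *
     (frechet_derivative (\<lambda>y. f (cinv c y)) (at x) (vs ! j) * \<omega> c x (del_nth j vs)))"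
  using form_differentiable[OF assms(1,3,4)] smooth_fun_differentiable[OF assms(2-4)] assms
  by (simp add: d_comm_def ext_d_eq ext_d_coord_def fmult_def frechet_derivative_mult
      distrib_left sum.distrib sum_distrib_left mult_ac)

lemma d_comm_fmult:
  assumes "\<omega> \<in> forms \<A> p" "f \<in> smooth_funs \<A>" "g \<in> smooth_funs \<A>"
  shows "d_comm f (fmult g \<omega>) = fmult g (d_comm f \<omega>)"
proof (rule form_eqI[of _ "Suc p" _ "Suc p"])
  show "d_comm f (fmult g \<omega>) c x vs = fmult g (d_comm f \<omega>) c x vs" if "c \<in> \<A>" "x \<in> cimg c" for c x vs
    using d_comm_eq[OF fmult_in_forms[OF assms(1,3)] assms(2) that, of vs]
      d_comm_eq[OF assms(1,2) that, of vs]
    by (simp add: fmult_def sum_distrib_left mult_ac)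
qed (use assms in auto)

subsection \<open>Supports and bump functions\<close>

definition supp_in :: "'m set \<Rightarrow> ('m, 'n) form \<Rightarrow> bool" where
  "supp_in K \<omega> \<longleftrightarrow> (\<forall>c\<in>\<A>. \<forall>m\<in>cdom c. m \<notin> K \<longrightarrow> (\<forall>vs. \<omega> c (cmap c m) vs = 0))"

lemma compact_form_supp:
  assumes "compact K" "supp_in K \<omega>"
  shows "compact (form_supp \<A> \<omega>)"
proof -
  have "form_supp \<A> \<omega> \<subseteq> K" unfolding form_supp_def
    using assms by (intro closure_minimal compact_imp_closed) (auto simp: supp_in_def)
  moreover have "closed (form_supp \<A> \<omega>)" by (simp add: form_supp_def)
  ultimately show ?thesis using compact_Int_closed[OF assms(1)] by (metis inf.absorb_iff2)
qed

lemma supp_in_iff: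
  "supp_in K \<omega> \<longleftrightarrow> (\<forall>c\<in>\<A>. \<forall>x\<in>cimg c. cinv c x \<notin> K \<longrightarrow> (\<forall>vs. \<omega> c x vs = 0))"
  unfolding supp_in_def by (metis cinv_cmap cinv_in cmap_cinv cmap_in)

lemma supp_in_fmult: "supp_in K \<omega> \<Longrightarrow> supp_in K (fmult f \<omega>)"
  by (simp add: supp_in_def fmult_def)

lemma supp_in_fmult_left: "(\<And>m. m \<notin> K \<Longrightarrow> f m = 0) \<Longrightarrow> supp_in K (fmult f \<omega>)"
  by (simp add: supp_in_iff fmult_def)

lemma supp_in_ext_d:
  assumes "compact K" "supp_in K \<omega>"
  shows "supp_in K (ext_d \<A> \<omega>)"
  unfolding supp_in_iff
proof (intro ballI impI allI)
  fix c x vs assume c: "c \<in> \<A>" "x \<in> cimg c" "cinv c x \<notin> K"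
  have "ext_d_coord (\<omega> c) x vs = ext_d_coord (\<lambda>_ _. 0) x vs"
  proof (rule ext_d_coord_cong)
    show "open (cimg c \<inter> cinv c -` (- K))"
      using open_preimage_cinv[OF c(1)] compact_imp_closed[OF assms(1)] by blast
  qed (use c assms(2) in \<open>auto simp: supp_in_iff\<close>)
  then show "ext_d \<A> \<omega> c x vs = 0" by (simp add: ext_d_eq) (simp add: ext_d_coord_def)
qed

definition chart_extend :: "('m, 'n) chart \<Rightarrow> (real^'n \<Rightarrow> real) \<Rightarrow> 'm \<Rightarrow> real" where
  "chart_extend c g m = (if m \<in> cdom c then g (cmap c m) else 0)"

text \<open>A point either lies in the domain of the chart, where the extension is a smooth function of the
  coordinates, or off the compact support, which is closed because the manifold is Hausdorff; near such
  a point the extension is zero.\<close>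

lemma chart_extend_smooth:
  assumes c: "c \<in> \<A>" and g: "smooth_on UNIV g" and K: "compact K" "K \<subseteq> cimg c" "\<And>x. x \<notin> K \<Longrightarrow> g x = 0"
  shows "chart_extend c g \<in> smooth_funs \<A>"
  unfolding smooth_funs_def o_def
proof (safe intro!: smooth_on_local)
  fix c' assume c': "c' \<in> \<A>"
  show "open (cimg c')" using open_cimg[OF c'] .
  fix x assume x: "x \<in> cimg c'"
  have "compact (cinv c ` K)"
    by (rule compact_continuous_image[OF continuous_on_subset[OF cont_cinv[OF c] K(2)] K(1)])
  then have cl: "closed (cinv c ` K)" by (rule compact_imp_closed)
  show "\<exists>U. open U \<and> x \<in> U \<and> U \<subseteq> cimg c' \<and> smooth_on U (\<lambda>x. chart_extend c g (cinv c' x))"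
  proof (cases "cinv c' x \<in> cdom c")
    case True
    have "smooth_on (overlap c' c) (\<lambda>x. g (trans_map c' c x))"
      using g by (intro smooth_on_compose[OF open_overlap[OF c' c] open_UNIV _ smooth_trans_map[OF c' c]]) auto
    then have "smooth_on (overlap c' c) (\<lambda>x. chart_extend c g (cinv c' x))"
      by (rule smooth_on_cong[OF open_overlap[OF c' c], rotated])
         (simp add: overlap_eq[OF c'] trans_map_eq chart_extend_def)
    then show ?thesis using open_overlap[OF c' c] overlap_subset[OF c'] True x
      by (intro exI[of _ "overlap c' c"]) (auto simp: overlap_eq[OF c'])
  next
    case False
    let ?U = "cimg c' \<inter> cinv c' -` (- (cinv c ` K))"
    have "chart_extend c g (cinv c' y) = 0" if "y \<in> ?U" for y
    proof (cases "cinv c' y \<in> cdom c")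
      case True
      then have "cmap c (cinv c' y) \<notin> K" using that cinv_cmap[OF c True] by (metis ComplD IntD2 imageI vimageD)
      then show ?thesis using K(3) by (simp add: chart_extend_def)
    qed (simp add: chart_extend_def)
    moreover have "open ?U" using open_preimage_cinv[OF c'] cl by blast
    ultimately have "smooth_on ?U (\<lambda>x. chart_extend c g (cinv c' x))"
      using smooth_on_cong[of ?U "\<lambda>_. 0" "\<lambda>x. chart_extend c g (cinv c' x)"] by simp
    moreover have "x \<in> ?U" using x False K(2) cinv_in[OF c] by auto
    ultimately show ?thesis using \<open>open ?U\<close> by blast
  qed
qed

text \<open>Besides a bump function, one needs global smooth functions whose differentials at the given point
  are the coordinate differentials. They are bump multiples of the coordinates centred at the point: the
  derivative of the bump function does not contribute there.\<close>

lemma chart_bump_exists: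
  assumes c: "c \<in> \<A>" and m: "m0 \<in> cdom c"
  obtains \<phi> K y where "\<phi> \<in> smooth_funs \<A>" "\<phi> m0 > 0" "\<And>m. \<phi> m \<ge> 0" "compact K" "K \<subseteq> cdom c"
    "\<And>m. m \<notin> K \<Longrightarrow> \<phi> m = 0"
    "\<And>i. y i \<in> smooth_funs \<A>"
    "\<And>i v. frechet_derivative (\<lambda>x. y i (cinv c x)) (at (cmap c m0)) v = v $ i"
proof -
  let ?x0 = "cmap c m0"
  obtain r where r: "r > 0" "cball ?x0 r \<subseteq> cimg c"
    using open_cimg[OF c] cmap_in[OF c m] open_contains_cball by metis
  obtain b where b: "smooth_on UNIV b" "b ?x0 > 0" "\<And>x. b x \<ge> 0" "\<And>x. x \<notin> cball ?x0 r \<Longrightarrow> b x = 0"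
    using smooth_bump_exists[OF r(1), of ?x0] by blast
  let ?K = "cinv c ` cball ?x0 r"
  define g where "g = (\<lambda>i x. b x * ((1 / b ?x0) * (x $ i - ?x0 $ i)))"
  have g: "smooth_on UNIV (g i)" for i unfolding g_def
    by (intro smooth_on_mult smooth_on_diff smooth_on_const smooth_on_nth b(1)) auto
  show thesis
  proof
    show "chart_extend c b \<in> smooth_funs \<A>"
      by (rule chart_extend_smooth[OF c b(1) compact_cball r(2) b(4)])
    show "chart_extend c b m0 > 0" "\<And>m. chart_extend c b m \<ge> 0" using b m by (auto simp: chart_extend_def)
    show "compact ?K"
      by (rule compact_continuous_image[OF continuous_on_subset[OF cont_cinv[OF c] r(2)] compact_cball])
    show "?K \<subseteq> cdom c" using r(2) cinv_in[OF c] by blast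
    show "chart_extend c b m = 0" if "m \<notin> ?K" for m
    proof (cases "m \<in> cdom c")
      case True
      then have "cmap c m \<notin> cball ?x0 r" using that cinv_cmap[OF c True] by (metis imageI)
      then show ?thesis using b(4) by (simp add: chart_extend_def)
    qed (simp add: chart_extend_def)
    show "chart_extend c (g i) \<in> smooth_funs \<A>" for i
      by (rule chart_extend_smooth[OF c g compact_cball r(2)]) (simp add: g_def b(4))
    fix i v
    have der: "(b has_derivative frechet_derivative b (at ?x0)) (at ?x0)"
      using frechet_derivative_worksI[OF smooth_on_differentiable[OF b(1)]] by simp
    have "(g i has_derivative (\<lambda>v. v $ i)) (at ?x0)"
      unfolding g_def using b(2)
      by (auto intro!: derivative_eq_intros der bounded_linear.has_derivative[OF bounded_linear_vec_nth] simp: fun_eq_iff)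
    then have "((\<lambda>x. chart_extend c (g i) (cinv c x)) has_derivative (\<lambda>v. v $ i)) (at ?x0)"
      by (rule has_derivative_transform_within_open[OF _ open_cimg[OF c] cmap_in[OF c m]])
         (simp add: chart_extend_def cinv_in[OF c] cmap_cinv[OF c])
    then show "frechet_derivative (\<lambda>x. chart_extend c (g i) (cinv c x)) (at ?x0) v = v $ i"
      by (rule frechet_derivative_eqI)
  qed
qed

text \<open>Functions are forms of degree 0; wedging with differentials of coordinates produces forms of
  every degree up to the dimension that do not vanish at a given point.\<close>

definition fun_form :: "('m \<Rightarrow> real) \<Rightarrow> ('m, 'n) form" where
  "fun_form f = (\<lambda>c x vs. if c \<in> \<A> \<and> x \<in> cimg c \<and> vs = [] then f (cinv c x) else 0)"

lemma fun_form_in_forms: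
  assumes "f \<in> smooth_funs \<A>"
  shows "fun_form f \<in> forms \<A> 0"
  unfolding in_forms_iff
proof (intro conjI ballI allI impI)
  fix c and vs :: "(real^'n) list" assume c: "c \<in> \<A>" and l: "length vs = 0"
  show "smooth_on (cimg c) (\<lambda>x. fun_form f c x vs)"
    by (rule smooth_on_cong[OF open_cimg[OF c] _ smooth_fun_comp[OF assms c]]) (use c l in \<open>simp add: fun_form_def\<close>)
next
  fix c c' x and vs :: "(real^'n) list" assume "c \<in> \<A>" "c' \<in> \<A>" "x \<in> overlap c c'" "length vs = 0"
  then show "fun_form f c x vs = fun_form f c' (trans_map c c' x) (map (trans_deriv c c' x) vs)"
    using cinv_trans_map[of c c' x] trans_map_in[of c c' x] overlapD[of c x c'] by (simp add: fun_form_def)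
qed (auto simp: fun_form_def alt_form_def)

text \<open>The form \<open>dy\<^sub>i\<^sub>1 \<and> \<dots> \<and> dy\<^sub>i\<^sub>q\<close> has the value \<open>1\<close> on the corresponding coordinate vectors for distinct indices.
  As \<open>p + 1\<close> distinct indices exist, this applies to \<open>q = p + 1\<close>, and the form is \<open>dy\<^sub>i\<^sub>1\<close> wedged with a form
  of degree \<open>p\<close>.\<close>

lemma exists_d_comm_nonzero:
  assumes "p < CARD('n)"
  obtains \<omega> f where "\<omega> \<in> forms \<A> p" "f \<in> smooth_funs \<A>" "d_comm f \<omega> \<noteq> 0"
proof -
  fix m0 :: 'm
  obtain c where c: "c \<in> \<A>" "m0 \<in> cdom c" using ex_chart .
  let ?x0 = "cmap c m0"
  have x0: "?x0 \<in> cimg c" using cmap_in[OF c] .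
  obtain y where y: "\<And>i. y i \<in> smooth_funs \<A>" "\<And>i v. frechet_derivative (\<lambda>x. y i (cinv c x)) (at ?x0) v = v $ i"
    using chart_bump_exists[OF c] by metis
  define W where "W = (\<lambda>is. foldr (\<lambda>i. d_comm (y i)) is (fun_form (\<lambda>_. 1)))"
  have W_forms: "W is \<in> forms \<A> (length is)" for "is"
    by (induction "is") (auto simp: W_def fun_form_in_forms y(1))
  have W_val: "W is c ?x0 (map (\<lambda>i. axis i 1) is) = 1" if "distinct is" for "is"
    using that
  proof (induction "is")
    case Nil
    show ?case using c x0 by (simp add: W_def fun_form_def)
  next
    case (Cons i "is")
    let ?vs = "map (\<lambda>i. axis i (1::real)) (i # is)"
    have "W (i # is) c ?x0 ?vs = (\<Sum>j<length ?vs. (-1) ^ j * ((?vs ! j) $ i * W is c ?x0 (del_nth j ?vs)))"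
      using d_comm_eq[OF W_forms[of "is"] y(1)[of i] c(1) x0, of ?vs] by (simp add: W_def y(2) del: sum.lessThan_Suc)
    also have "\<dots> = W is c ?x0 (map (\<lambda>i. axis i 1) is)
        + (\<Sum>j<length is. (-1) ^ Suc j * ((map (\<lambda>i. axis i 1) is ! j) $ i * W is c ?x0 (del_nth (Suc j) ?vs)))"
      by (simp add: sum.lessThan_Suc_shift del: sum.lessThan_Suc)
    also have "(\<Sum>j<length is. (-1) ^ Suc j * ((map (\<lambda>i. axis i 1) is ! j) $ i * W is c ?x0 (del_nth (Suc j) ?vs))) = 0"
      using Cons.prems by (intro sum.neutral) (auto simp: axis_def in_set_conv_nth)
    finally show ?case using Cons by simp
  qed
  obtain "is" :: "'n list" where is': "set is = UNIV" "distinct is"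
    using finite_distinct_list[of "UNIV :: 'n set"] by auto
  then have len: "length is = CARD('n)" by (metis distinct_card)
  define js where "js = drop (CARD('n) - Suc p) is"
  have js: "distinct js" "length js = Suc p" using is' len assms by (auto simp: js_def)
  then obtain i ks where ks: "js = i # ks" by (cases js) auto
  show thesis
  proof
    show "W ks \<in> forms \<A> p" using W_forms[of ks] js ks by simp
    show "y i \<in> smooth_funs \<A>" by (rule y(1))
    have "d_comm (y i) (W ks) = W js" by (simp add: W_def ks)
    moreover have "W js c ?x0 (map (\<lambda>i. axis i 1) js) \<noteq> 0" using W_val[OF js(1)] by simp
    ultimately show "d_comm (y i) (W ks) \<noteq> 0" by (metis zero_fun_apply)
  qed
qed

end

section \<open>The inner product of alternating forms\<close>

text \<open>The inner product of forms without the factor \<open>1/p!\<close>, for an arbitrary matrix in place of the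
  inverse metric.\<close>

definition contraction :: "real^'n::finite^'n \<Rightarrow> nat \<Rightarrow> ((real^'n) list \<Rightarrow> real) \<Rightarrow> ((real^'n) list \<Rightarrow> real) \<Rightarrow> real" where
  "contraction G p V W = (\<Sum>I\<in>{I. length I = p}. \<Sum>I'\<in>{I. length I = p}.
     (\<Prod>k<p. G $ (I ! k) $ (I' ! k)) * V (map (\<lambda>i. axis i 1) I) * W (map (\<lambda>i. axis i 1) I'))"

lemma sum_lists_Suc:
  fixes F :: "'n::finite list \<Rightarrow> real"
  shows "(\<Sum>I\<in>{I. length I = Suc p}. F I) = (\<Sum>i\<in>UNIV. \<Sum>I\<in>{I. length I = p}. F (i # I))"
proof -
  have eq: "{I :: 'n list. length I = Suc p} = (\<lambda>(i, I). i # I) ` (UNIV \<times> {I. length I = p})"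
    by (auto simp: length_Suc_conv image_iff)
  have "inj_on (\<lambda>(i, I). i # I) (UNIV \<times> {I :: 'n list. length I = p})"
    by (auto simp: inj_on_def)
  then show ?thesis unfolding eq by (simp add: sum.reindex sum.cartesian_product split_def)
qed

lemma contraction_0 [simp]: "contraction G 0 V W = V [] * W []"
  by (simp add: contraction_def)

text \<open>Contracting the first arguments first makes the inner product of forms accessible to induction
  over the degree.\<close>

lemma contraction_Suc:
  "contraction G (Suc p) V W = (\<Sum>i\<in>UNIV. \<Sum>j\<in>UNIV. G $ i $ j *
     contraction G p (\<lambda>vs. V (axis i 1 # vs)) (\<lambda>vs. W (axis j 1 # vs)))"
proof -
  have "contraction G (Suc p) V W = (\<Sum>i\<in>UNIV. \<Sum>I\<in>{I. length I = p}. \<Sum>j\<in>UNIV. \<Sum>I'\<in>{I. length I = p}.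
     (G $ i $ j * (\<Prod>k<p. G $ (I ! k) $ (I' ! k))) * V (axis i 1 # map (\<lambda>i. axis i 1) I) * W (axis j 1 # map (\<lambda>i. axis i 1) I'))"
    by (simp add: contraction_def sum_lists_Suc prod.lessThan_Suc_shift del: prod.lessThan_Suc)
  also have "\<dots> = (\<Sum>i\<in>UNIV. \<Sum>j\<in>UNIV. \<Sum>I\<in>{I. length I = p}. \<Sum>I'\<in>{I. length I = p}.
     (G $ i $ j * (\<Prod>k<p. G $ (I ! k) $ (I' ! k))) * V (axis i 1 # map (\<lambda>i. axis i 1) I) * W (axis j 1 # map (\<lambda>i. axis i 1) I'))"
    by (intro sum.cong refl sum.swap)
  finally show ?thesis by (simp add: contraction_def sum_distrib_left mult.assoc)
qed

lemma contraction_cong: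
  "(\<And>vs. length vs = p \<Longrightarrow> V vs = V' vs) \<Longrightarrow> (\<And>vs. length vs = p \<Longrightarrow> W vs = W' vs) \<Longrightarrow>
   contraction G p V W = contraction G p V' W'"
  unfolding contraction_def by (intro sum.cong refl arg_cong2[where f="(*)"]) auto

lemma contraction_sum_left:
  "contraction G p (\<lambda>vs. \<Sum>a\<in>A. f a * V a vs) W = (\<Sum>a\<in>A. f a * contraction G p (V a) W)"
  unfolding contraction_def
  by (subst sum_distrib_left sum_distrib_right sum.swap[of _ A], simp add: sum_distrib_left sum_distrib_right mult_ac)+
     (simp add: sum.swap[of _ A])

lemma contraction_commute_transpose:
  "contraction G p V W = contraction (transpose G) p W V"
  unfolding contraction_def by (subst sum.swap) (simp add: transpose_def mult_ac)

lemma contraction_sum_right: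
  "contraction G p W (\<lambda>vs. \<Sum>a\<in>A. f a * V a vs) = (\<Sum>a\<in>A. f a * contraction G p W (V a))"
  by (simp add: contraction_commute_transpose[of G] contraction_sum_left)

lemma contraction_expand_heads:
  assumes "alt_form (Suc p) V" "alt_form (Suc p) W"
  shows "contraction G p (\<lambda>vs. V (u # vs)) (\<lambda>vs. W (v # vs))
    = (\<Sum>a\<in>UNIV. \<Sum>b\<in>UNIV. u $ a * v $ b * contraction G p (\<lambda>vs. V (axis a 1 # vs)) (\<lambda>vs. W (axis b 1 # vs)))"
proof -
  have "contraction G p (\<lambda>vs. V (u # vs)) (\<lambda>vs. W (v # vs))
    = contraction G p (\<lambda>vs. \<Sum>a\<in>UNIV. u $ a * V (axis a 1 # vs)) (\<lambda>vs. \<Sum>b\<in>UNIV. v $ b * W (axis b 1 # vs))"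
    by (rule contraction_cong; rule alt_form_expand_head) (use assms in auto)
  then show ?thesis
    by (simp add: contraction_sum_left contraction_sum_right sum_distrib_left mult.assoc)
qed

text \<open>The contraction is tensorial: a change of basis can be moved from the arguments to the inverse metric.
  Hence the inner product of forms does not depend on the chart.\<close>

lemma contraction_pullback:
  fixes T :: "real^'n::finite \<Rightarrow> real^'n"
  assumes T: "linear T" and G': "\<And>a b. G' $ a $ b = (\<Sum>i\<in>UNIV. \<Sum>j\<in>UNIV. G $ i $ j * T (axis i 1) $ a * T (axis j 1) $ b)"
  shows "alt_form p V \<Longrightarrow> alt_form p W \<Longrightarrow>
    contraction G p (\<lambda>vs. V (map T vs)) (\<lambda>vs. W (map T vs)) = contraction G' p V W"
proof (induction p arbitrary: V W)
  case (Suc p)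
  let ?C = "\<lambda>a b. contraction G' p (\<lambda>vs. V (axis a 1 # vs)) (\<lambda>vs. W (axis b 1 # vs))"
  have IH: "contraction G p (\<lambda>vs. V (T (axis i 1) # map T vs)) (\<lambda>vs. W (T (axis j 1) # map T vs))
     = (\<Sum>a\<in>UNIV. \<Sum>b\<in>UNIV. T (axis i 1) $ a * T (axis j 1) $ b * ?C a b)" for i j
    by (rule trans[OF Suc.IH[OF alt_form_Cons[OF Suc.prems(1)] alt_form_Cons[OF Suc.prems(2)]]
          contraction_expand_heads[OF Suc.prems]])
  have "contraction G (Suc p) (\<lambda>vs. V (map T vs)) (\<lambda>vs. W (map T vs))
     = (\<Sum>i\<in>UNIV. \<Sum>j\<in>UNIV. \<Sum>a\<in>UNIV. \<Sum>b\<in>UNIV. G $ i $ j * T (axis i 1) $ a * T (axis j 1) $ b * ?C a b)"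
    by (simp add: contraction_Suc IH sum_distrib_left mult.assoc)
  also have "\<dots> = (\<Sum>a\<in>UNIV. \<Sum>b\<in>UNIV. \<Sum>i\<in>UNIV. \<Sum>j\<in>UNIV. G $ i $ j * T (axis i 1) $ a * T (axis j 1) $ b * ?C a b)"
  proof -
    have "(\<Sum>i\<in>UNIV. \<Sum>j\<in>UNIV. \<Sum>a\<in>UNIV. \<Sum>b\<in>UNIV. F i j a b) = (\<Sum>a\<in>UNIV. \<Sum>b\<in>UNIV. \<Sum>i\<in>UNIV. \<Sum>j\<in>UNIV. F i j a b)"
      for F :: "'n \<Rightarrow> 'n \<Rightarrow> 'n \<Rightarrow> 'n \<Rightarrow> real"
      unfolding sum.cartesian_product
      by (rule sum.reindex_bij_witness[of _ "\<lambda>(a,b,i,j). (i,j,a,b)" "\<lambda>(i,j,a,b). (a,b,i,j)"]) auto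
    then show ?thesis .
  qed
  also have "\<dots> = contraction G' (Suc p) V W"
    by (simp add: contraction_Suc G' sum_distrib_right)
  finally show ?case .
qed simp

text \<open>Symmetric elimination: a positive semidefinite matrix is a sum of squares of linear forms.\<close>

lemma psd_sum_squares:
  fixes G :: "'n \<Rightarrow> 'n \<Rightarrow> real"
  assumes "finite S"
  shows "(\<And>i j. i \<in> S \<Longrightarrow> j \<in> S \<Longrightarrow> G i j = G j i) \<Longrightarrow> (\<And>v. (\<Sum>i\<in>S. \<Sum>j\<in>S. v i * G i j * v j) \<ge> 0) \<Longrightarrow>
    \<exists>m w. \<forall>i\<in>S. \<forall>j\<in>S. G i j = (\<Sum>k<(m::nat). w k i * w k j)"
  using assms
proof (induction S arbitrary: G rule: finite_induct)
  case empty then show ?case by auto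
next
  case (insert s S)
  have two: "v s * G s s * v s + 2 * v s * (\<Sum>j\<in>S. G s j * v j) + (\<Sum>i\<in>S. \<Sum>j\<in>S. v i * G i j * v j) \<ge> 0" for v
  proof -
    have "(\<Sum>i\<in>S. v i * G i s * v s) = v s * (\<Sum>j\<in>S. G s j * v j)"
      using insert.prems(1)[of s] by (simp add: sum_distrib_left mult_ac)
    moreover have "(\<Sum>j\<in>S. v s * G s j * v j) = v s * (\<Sum>j\<in>S. G s j * v j)"
      by (simp add: sum_distrib_left mult_ac)
    ultimately show ?thesis using insert.prems(2)[of v] insert.hyps by (simp add: sum.distrib)
  qed
  define r where "r = G s s"
  have r0: "r \<ge> 0" using two[of "\<lambda>i. if i = s then 1 else 0"] insert.hyps
    by (simp add: r_def if_distrib cong: if_cong)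
  define w where "w = (\<lambda>i. if r = 0 then 0 else G s i / sqrt r)"
  have col: "G s j = w s * w j" if "j \<in> insert s S" for j
  proof (cases "r = 0")
    case True
    have "G s j = 0"
    proof (cases "j = s")
      case False
      then have j: "j \<in> S" using that by simp
      show ?thesis
      proof (rule ccontr)
        assume n: "G s j \<noteq> 0"
        \<comment> \<open>a linear function of \<open>t\<close> with nonzero slope is not bounded below; this is a value where it is \<open>-1\<close>\<close>
        let ?t = "- (G j j + 1) / (2 * G s j)"
        let ?v = "\<lambda>i. if i = s then ?t else if i = j then 1 else 0"
        have "?v s * G s s * ?v s + 2 * ?v s * (\<Sum>i\<in>S. G s i * ?v i) + (\<Sum>i\<in>S. \<Sum>k\<in>S. ?v i * G i k * ?v k) = 2 * ?t * G s j + G j j"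
        proof -
          have "(\<Sum>i\<in>S. G s i * ?v i) = (\<Sum>i\<in>S. if i = j then G s j else 0)"
            using insert.hyps by (intro sum.cong) auto
          also have "\<dots> = G s j" using j insert.hyps by simp
          finally have 1: "(\<Sum>i\<in>S. G s i * ?v i) = G s j" .
          have "(\<Sum>i\<in>S. \<Sum>k\<in>S. ?v i * G i k * ?v k) = (\<Sum>i\<in>S. \<Sum>k\<in>S. if i = j then (if k = j then G j j else 0) else 0)"
            using insert.hyps by (intro sum.cong) auto
          also have "\<dots> = (\<Sum>i\<in>S. if i = j then G j j else 0)"
            using j insert.hyps by (intro sum.cong) auto
          also have "\<dots> = G j j" using j insert.hyps by simp
          finally show ?thesis using 1 True by (simp add: r_def)
        qed
        then have "2 * ?t * G s j + G j j \<ge> 0" using two[of ?v] by simp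
        moreover have "2 * ?t * G s j = - (G j j + 1)" using n by simp
        ultimately show False by linarith
      qed
    qed (use True r_def in simp)
    then show ?thesis using True by (simp add: w_def)
  next
    case False
    then show ?thesis using r0 by (simp add: w_def r_def real_div_sqrt real_sqrt_mult_self[symmetric])
  qed
  let ?G = "\<lambda>i j. G i j - w i * w j"
  have "\<exists>m u. \<forall>i\<in>S. \<forall>j\<in>S. ?G i j = (\<Sum>k<(m::nat). u k i * u k j)"
  proof (rule insert.IH)
    show "?G i j = ?G j i" if "i \<in> S" "j \<in> S" for i j using insert.prems(1) that by simp
    fix v :: "'n \<Rightarrow> real"
    let ?q = "\<Sum>i\<in>S. \<Sum>j\<in>S. v i * G i j * v j" and ?l = "\<Sum>j\<in>S. w j * v j"
    have "(\<Sum>i\<in>S. \<Sum>j\<in>S. v i * ?G i j * v j) = ?q - ?l * ?l"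
      by (simp add: sum_product algebra_simps sum_subtractf)
    moreover have "?q \<ge> ?l * ?l"
    proof (cases "r = 0")
      case True
      have "(\<Sum>i\<in>S. \<Sum>j\<in>S. (v(s := 0)) i * G i j * (v(s := 0)) j) = ?q"
        using insert.hyps by (intro sum.cong refl) auto
      then have "?q \<ge> 0" using two[of "v(s := 0)"] by simp
      then show ?thesis using True by (simp add: w_def)
    next
      case False
      then have sr: "sqrt r > 0" "w s = sqrt r" using r0 by (auto simp: w_def r_def real_div_sqrt)
      \<comment> \<open>the coordinate at \<open>s\<close> is chosen such that the quadratic form becomes minimal\<close>
      let ?v = "v(s := - ?l / sqrt r)"
      have "(\<Sum>j\<in>S. G s j * ?v j) = sqrt r * ?l"
        using col sr insert.hyps unfolding sum_distrib_left by (intro sum.cong) auto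
      moreover have "(\<Sum>i\<in>S. \<Sum>j\<in>S. ?v i * G i j * ?v j) = ?q"
        using insert.hyps by (intro sum.cong refl) auto
      ultimately have "(- ?l / sqrt r) * r * (- ?l / sqrt r) + 2 * (- ?l / sqrt r) * (sqrt r * ?l) + ?q \<ge> 0"
        using two[of ?v] by (simp add: r_def)
      moreover have "(- ?l / sqrt r) * r * (- ?l / sqrt r) = ?l * ?l" using sr r0 by (simp add: field_simps)
      moreover have "2 * (- ?l / sqrt r) * (sqrt r * ?l) = - 2 * ?l * ?l" using sr by simp
      ultimately show ?thesis by linarith
    qed
    ultimately show "(\<Sum>i\<in>S. \<Sum>j\<in>S. v i * ?G i j * v j) \<ge> 0" by simp
  qed
  then obtain m u where u: "\<And>i j. i \<in> S \<Longrightarrow> j \<in> S \<Longrightarrow> ?G i j = (\<Sum>k<(m::nat). u k i * u k j)" by blast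
  let ?w = "\<lambda>k i. if k = m then w i else if i = s then 0 else u k i"
  have "G i j = (\<Sum>k<Suc m. ?w k i * ?w k j)" if "i \<in> insert s S" "j \<in> insert s S" for i j
  proof -
    have "(\<Sum>k<Suc m. ?w k i * ?w k j) = w i * w j + (if i = s \<or> j = s then 0 else \<Sum>k<m. u k i * u k j)"
      by simp
    also have "\<dots> = G i j"
      using u[of i j] col[of i] col[of j] that insert.prems(1)[of s i] by (auto simp: mult.commute)
    finally show ?thesis by simp
  qed
  then show ?case by (intro exI[of _ "Suc m"] exI[of _ ?w] ballI)
qed

text \<open>If \<open>G = \<Sum>k. w\<^sub>k w\<^sub>k\<^sup>T\<close>, then \<open>|V|\<^sup>2\<close> is the sum of the squared lengths of the contractions of \<open>V\<close> with the
  \<open>w\<^sub>k\<close>. If it vanishes, so do all these contractions, and the \<open>w\<^sub>k\<close> span because \<open>G\<close> is invertible.\<close>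

lemma contraction_nonneg_posdef:
  fixes G :: "real^'n::finite^'n"
  assumes sym: "transpose G = G" and pos: "\<And>v. v \<noteq> 0 \<Longrightarrow> v \<bullet> (G *v v) > 0"
  shows "alt_form p V \<Longrightarrow> contraction G p V V \<ge> 0"
    and "alt_form p V \<Longrightarrow> contraction G p V V = 0 \<Longrightarrow> length vs = p \<Longrightarrow> V vs = 0"
proof -
  have ge: "v \<bullet> (G *v v) \<ge> 0" for v using pos[of v] by (cases "v = 0") auto
  then have psd: "(\<Sum>i\<in>UNIV. \<Sum>j\<in>UNIV. v i * G $ i $ j * v j) \<ge> 0" for v
    using ge[of "\<chi> i. v i"] by (simp add: inner_vec_def matrix_vector_mult_def sum_distrib_left mult.assoc)
  have symG: "G $ i $ j = G $ j $ i" for i j using sym by (metis transpose_def vec_lambda_beta)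
  obtain m :: nat and w where w: "\<And>i j. G $ i $ j = (\<Sum>k<m. w k i * w k j)"
    using psd_sum_squares[of UNIV "\<lambda>i j. G $ i $ j"] symG psd by auto
  let ?w = "\<lambda>k. \<chi> i. w k i"
  have rec: "contraction G (Suc p) V V = (\<Sum>k<m. contraction G p (\<lambda>vs. V (?w k # vs)) (\<lambda>vs. V (?w k # vs)))"
    if "alt_form (Suc p) V" for p V
  proof -
    let ?C = "\<lambda>a b. contraction G p (\<lambda>vs. V (axis a 1 # vs)) (\<lambda>vs. V (axis b 1 # vs))"
    have "(\<Sum>k<m. contraction G p (\<lambda>vs. V (?w k # vs)) (\<lambda>vs. V (?w k # vs)))
       = (\<Sum>k<m. \<Sum>a\<in>UNIV. \<Sum>b\<in>UNIV. w k a * w k b * ?C a b)"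
      by (intro sum.cong refl) (subst contraction_expand_heads[OF that that], simp)
    also have "\<dots> = (\<Sum>a\<in>UNIV. \<Sum>b\<in>UNIV. \<Sum>k<m. w k a * w k b * ?C a b)"
      by (subst sum.swap, intro sum.cong refl, subst sum.swap) simp
    finally show ?thesis by (simp add: contraction_Suc w sum_distrib_right)
  qed
  show nonneg: "contraction G p V V \<ge> 0" if "alt_form p V" for p V
    using that
  proof (induction p arbitrary: V)
    case (Suc p)
    then show ?case using alt_form_Cons by (auto simp: rec intro!: sum_nonneg)
  qed simp
  have surj: "\<exists>u. v = G *v u" for v
  proof -
    have "inj ((*v) G)"
      using pos by (subst linear_injective_0[OF matrix_vector_mul_linear]) force
    then show ?thesis using linear_injective_imp_surjective[OF matrix_vector_mul_linear] by (metis surjD)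
  qed
  show "V vs = 0" if "alt_form p V" "contraction G p V V = 0" "length vs = p"
    using that
  proof (induction p arbitrary: V vs)
    case (Suc p)
    then obtain v us where vs: "vs = v # us" "length us = p" by (cases vs) auto
    have "contraction G p (\<lambda>vs. V (?w k # vs)) (\<lambda>vs. V (?w k # vs)) = 0" if "k < m" for k
      using Suc.prems(2) rec[OF Suc.prems(1)] nonneg[OF alt_form_Cons[OF Suc.prems(1)]] that
      by (simp add: sum_nonneg_eq_0_iff)
    then have z: "V (?w k # us) = 0" if "k < m" for k
      using Suc.IH[OF alt_form_Cons[OF Suc.prems(1)]] vs(2) that by blast
    obtain u where u: "v = G *v u" using surj by blast
    have v_eq: "v = (\<Sum>k<m. (\<Sum>j\<in>UNIV. w k j * u $ j) *\<^sub>R ?w k)"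
    proof (rule vec_eq_iff[THEN iffD2], intro allI)
      fix i
      have "v $ i = (\<Sum>j\<in>UNIV. \<Sum>k<m. w k i * w k j * u $ j)"
        by (simp add: u matrix_vector_mult_def w sum_distrib_right)
      also have "\<dots> = (\<Sum>k<m. \<Sum>j\<in>UNIV. w k i * w k j * u $ j)" by (rule sum.swap)
      finally show "v $ i = (\<Sum>k<m. (\<Sum>j\<in>UNIV. w k j * u $ j) *\<^sub>R ?w k) $ i"
        by (simp add: sum_distrib_left sum_distrib_right mult_ac)
    qed
    interpret linear "\<lambda>v. V (v # us)" by (rule alt_form_linear_head[OF Suc.prems(1) vs(2)])
    have "V (v # us) = (\<Sum>k<m. (\<Sum>j\<in>UNIV. w k j * u $ j) *\<^sub>R V (?w k # us))"
      by (subst v_eq) (simp only: sum scale)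
    then show ?case using z vs by simp
  qed simp
qed

section \<open>Positive definite matrices\<close>

text \<open>The determinant does not vanish on the segment from the unit matrix to \<open>H\<close>, which consists of
  positive definite matrices.\<close>

lemma posdef_det_pos:
  fixes H :: "real^'n::finite^'n"
  assumes pos: "\<And>v. v \<noteq> 0 \<Longrightarrow> v \<bullet> (H *v v) > 0"
  shows "det H > 0"
proof (rule ccontr)
  assume n: "\<not> det H > 0"
  define P where "P = (\<lambda>t. (\<chi> i j. (1 - t) * mat 1 $ i $ j + t * H $ i $ j) :: real^'n^'n)"
  have "continuous_on {0..1} (\<lambda>t. det (P t))"
    unfolding det_def P_def by (auto intro!: continuous_intros)
  moreover have "P 0 = mat 1" "P 1 = H" by (simp_all add: P_def vec_eq_iff)
  ultimately obtain t where t: "0 \<le> t" "t \<le> 1" "det (P t) = 0"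
    using IVT2'[of "\<lambda>t. det (P t)" 1 0 0] n by auto
  have "P t *v v = (1 - t) *\<^sub>R v + t *\<^sub>R (H *v v)" for v
  proof -
    have "P t = (1 - t) *\<^sub>R mat 1 + t *\<^sub>R H" by (simp add: P_def vec_eq_iff)
    then show ?thesis by (simp add: matrix_vector_mult_add_rdistrib scaleR_matrix_vector_assoc[symmetric])
  qed
  then have "v \<bullet> (P t *v v) = (1 - t) * (v \<bullet> v) + t * (v \<bullet> (H *v v))" for v by (simp add: inner_add_right)
  then have "v \<bullet> (P t *v v) > 0" if "v \<noteq> 0" for v
    using pos[OF that] that t
    by (cases "t = 1") (auto intro!: add_pos_nonneg mult_pos_pos mult_nonneg_nonneg)
  then have "P t *v v = 0 \<Longrightarrow> v = 0" for v by force
  then have "invertible (P t)"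
    using matrix_left_invertible_ker[of "P t"] invertible_left_inverse by blast
  then show False using t(3) invertible_det_nz by blast
qed

lemma matrix_inv_works:
  fixes A :: "real^'n::finite^'n"
  assumes "det A \<noteq> 0"
  shows "A ** matrix_inv A = mat 1" "matrix_inv A ** A = mat 1"
  using assms invertible_det_nz[of A] someI_ex[of "\<lambda>B. A ** B = mat 1 \<and> B ** A = mat 1"]
  unfolding matrix_inv_def invertible_def by blast+

lemma matrix_inv_eqI:
  fixes A :: "real^'n::finite^'n"
  assumes "A ** B = mat 1"
  shows "matrix_inv A = B"
proof -
  have "det A \<noteq> 0" using assms by (metis det_I det_mul mult_zero_left zero_neq_one)
  then have "B = matrix_inv A ** (A ** B)" by (simp add: matrix_mul_assoc matrix_inv_works)
  then show ?thesis by (simp add: assms)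
qed

text \<open>Cramer's rule shows that the inverse depends continuously on the matrix.\<close>

lemma matrix_inv_eq_cramer:
  fixes A :: "real^'n::finite^'n"
  assumes "det A \<noteq> 0"
  shows "matrix_inv A $ k $ j = det (\<chi> i l. if l = k then axis j 1 $ i else A $ i $ l) / det A"
proof -
  have "A ** matrix_inv A = mat 1"
    using matrix_inv_works(1)[OF assms] .
  then have "A *v (matrix_inv A *v axis j 1) = axis j 1"
    by (simp add: matrix_vector_mul_assoc)
  then have "matrix_inv A *v axis j 1 = (\<chi> k. det (\<chi> i l. if l = k then axis j 1 $ i else A $ i $ l) / det A)"
    using cramer[OF assms] by blast
  then show ?thesis by (simp add: matrix_vector_mult_basis column_def vec_eq_iff)
qed

lemma continuous_on_matrix_inv:
  fixes A :: "'a::topological_space \<Rightarrow> real^'n::finite^'n"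
  assumes "\<And>i j. continuous_on S (\<lambda>x. A x $ i $ j)" "\<And>x. x \<in> S \<Longrightarrow> det (A x) \<noteq> 0"
  shows "continuous_on S (\<lambda>x. matrix_inv (A x) $ k $ j)"
proof -
  have "continuous_on S (\<lambda>x. det (\<chi> i l. if l = k then axis j 1 $ i else A x $ i $ l))"
    unfolding det_def
  proof (intro continuous_on_sum continuous_on_mult continuous_on_const continuous_on_prod)
    fix \<pi> :: "'n \<Rightarrow> 'n" and i :: 'n
    show "continuous_on S (\<lambda>x. (\<chi> i l. if l = k then axis j 1 $ i else A x $ i $ l) $ i $ \<pi> i)"
      using assms(1)[of i "\<pi> i"] by (cases "\<pi> i = k") auto
  qed
  moreover have "continuous_on S (\<lambda>x. det (A x))"
    unfolding det_def
    by (intro continuous_on_sum continuous_on_mult continuous_on_const continuous_on_prod assms(1))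
  ultimately have "continuous_on S (\<lambda>x. det (\<chi> i l. if l = k then axis j 1 $ i else A x $ i $ l) / det (A x))"
    using assms(2) by (intro continuous_on_divide) auto
  then show ?thesis by (rule continuous_on_eq) (simp add: matrix_inv_eq_cramer assms(2))
qed

section \<open>Integration of forms\<close>

locale riemannian = oriented_atlas \<A>
  for \<A> :: "('m::{t2_space, second_countable_topology}, 'n::finite) chart set" +
  fixes h :: "('m, 'n) metric" and vol :: "'m measure"
  assumes metric: "riemannian_metric \<A> h" and volume: "riemannian_volume \<A> h vol"
begin

abbreviation hinv :: "('m, 'n) chart \<Rightarrow> real^'n \<Rightarrow> real^'n^'n" where
  "hinv c x \<equiv> matrix_inv (h c x)"

lemma h_smooth: "c \<in> \<A> \<Longrightarrow> smooth_on (cimg c) (\<lambda>x. h c x $ i $ j)"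
  and h_sym: "c \<in> \<A> \<Longrightarrow> x \<in> cimg c \<Longrightarrow> transpose (h c x) = h c x"
  and h_pos: "c \<in> \<A> \<Longrightarrow> x \<in> cimg c \<Longrightarrow> v \<noteq> 0 \<Longrightarrow> v \<bullet> (h c x *v v) > 0"
  and h_trans: "c \<in> \<A> \<Longrightarrow> c' \<in> \<A> \<Longrightarrow> x \<in> overlap c c' \<Longrightarrow>
     h c x = transpose (matrix (trans_deriv c c' x)) ** h c' (trans_map c c' x) ** matrix (trans_deriv c c' x)"
  using metric unfolding riemannian_metric_def by blast+

lemma det_h_pos: "c \<in> \<A> \<Longrightarrow> x \<in> cimg c \<Longrightarrow> det (h c x) > 0"
  by (rule posdef_det_pos) (rule h_pos)

lemma h_hinv: "c \<in> \<A> \<Longrightarrow> x \<in> cimg c \<Longrightarrow> h c x ** hinv c x = mat 1"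
  and hinv_h: "c \<in> \<A> \<Longrightarrow> x \<in> cimg c \<Longrightarrow> hinv c x ** h c x = mat 1"
  using matrix_inv_works[of "h c x"] det_h_pos[of c x] by auto

lemma hinv_sym:
  assumes "c \<in> \<A>" "x \<in> cimg c"
  shows "transpose (hinv c x) = hinv c x"
proof -
  have "transpose (hinv c x ** h c x) = mat 1" by (simp add: hinv_h[OF assms] transpose_mat)
  then have "h c x ** transpose (hinv c x) = mat 1"
    by (simp add: matrix_transpose_mul h_sym[OF assms])
  then show ?thesis using matrix_inv_eqI by metis
qed

lemma hinv_pos:
  assumes "c \<in> \<A>" "x \<in> cimg c" "v \<noteq> 0"
  shows "v \<bullet> (hinv c x *v v) > 0"
proof -
  let ?u = "hinv c x *v v"
  have v: "v = h c x *v ?u" by (simp add: matrix_vector_mul_assoc h_hinv[OF assms(1,2)])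
  then have "?u \<noteq> 0" using assms(3) by auto
  then have "?u \<bullet> (h c x *v ?u) > 0" by (rule h_pos[OF assms(1,2)])
  then show ?thesis using v by (simp add: inner_commute)
qed

lemma hinv_trans:
  assumes c: "c \<in> \<A>" "c' \<in> \<A>" and x: "x \<in> overlap c c'"
  shows "hinv c' (trans_map c c' x) $ a $ b = (\<Sum>i\<in>UNIV. \<Sum>j\<in>UNIV.
    hinv c x $ i $ j * trans_deriv c c' x (axis i 1) $ a * trans_deriv c c' x (axis j 1) $ b)"
proof -
  let ?T = "matrix (trans_deriv c c' x)" and ?h' = "h c' (trans_map c c' x)"
  have xi: "x \<in> cimg c" using overlapD[OF c(1) x] .
  have "transpose ?T ** (?h' ** ?T ** hinv c x) = mat 1"
    using h_hinv[OF c(1) xi] unfolding h_trans[OF c x] by (simp add: matrix_mul_assoc)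
  then have "(?h' ** ?T ** hinv c x) ** transpose ?T = mat 1"
    using matrix_left_right_inverse by blast
  then have "?h' ** (?T ** hinv c x ** transpose ?T) = mat 1" by (simp add: matrix_mul_assoc)
  then have "hinv c' (trans_map c c' x) = ?T ** hinv c x ** transpose ?T" by (rule matrix_inv_eqI)
  then show ?thesis
    by (simp add: matrix_matrix_mult_def transpose_def matrix_def sum_distrib_right)
       (subst sum.swap, simp add: mult_ac)
qed

abbreviation inner :: "nat \<Rightarrow> ('m, 'n) form \<Rightarrow> ('m, 'n) form \<Rightarrow> 'm \<Rightarrow> real" where
  "inner \<equiv> form_inner \<A> h"

lemma form_inner_at_eq: "form_inner_at h p \<omega> \<eta> c x = contraction (hinv c x) p (\<omega> c x) (\<eta> c x) / fact p"
  by (simp add: form_inner_at_def contraction_def)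

lemma form_inner_some_chart:
  obtains c where "c \<in> \<A>" "m \<in> cdom c" "\<And>p \<omega> \<eta>. inner p \<omega> \<eta> m = form_inner_at h p \<omega> \<eta> c (cmap c m)"
proof -
  let ?c = "SOME c. c \<in> \<A> \<and> m \<in> cdom c"
  have "\<exists>c. c \<in> \<A> \<and> m \<in> cdom c" using ex_chart by metis
  then have "?c \<in> \<A> \<and> m \<in> cdom ?c" by (rule someI_ex)
  then show thesis using that[of ?c] by (simp add: form_inner_def Let_def)
qed

lemma form_inner_chart:
  assumes c: "c \<in> \<A>" "m \<in> cdom c" and f: "\<omega> \<in> forms \<A> p" "\<eta> \<in> forms \<A> p"
  shows "inner p \<omega> \<eta> m = form_inner_at h p \<omega> \<eta> c (cmap c m)"
proof -
  obtain c0 where c0: "c0 \<in> \<A>" "m \<in> cdom c0" and eq: "inner p \<omega> \<eta> m = form_inner_at h p \<omega> \<eta> c0 (cmap c0 m)"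
    using form_inner_some_chart[of m] by metis
  let ?x = "cmap c0 m"
  have x: "?x \<in> overlap c0 c" using c c0 by (auto simp: overlap_def)
  have tx: "trans_map c0 c ?x = cmap c m" by (simp add: trans_map_eq cinv_cmap[OF c0])
  have cx: "cmap c m \<in> cimg c" by (rule cmap_in[OF c])
  have "contraction (hinv c0 ?x) p (\<omega> c0 ?x) (\<eta> c0 ?x)
      = contraction (hinv c0 ?x) p (\<lambda>vs. \<omega> c (cmap c m) (map (trans_deriv c0 c ?x) vs))
          (\<lambda>vs. \<eta> c (cmap c m) (map (trans_deriv c0 c ?x) vs))"
    using form_pullback[OF f(1) c0(1) c(1) x] form_pullback[OF f(2) c0(1) c(1) x]
    by (intro contraction_cong) (simp_all add: tx)
  also have "\<dots> = contraction (hinv c (cmap c m)) p (\<omega> c (cmap c m)) (\<eta> c (cmap c m))"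
    by (rule contraction_pullback[OF linear_trans_deriv[OF c0(1) c(1) x]
          hinv_trans[OF c0(1) c(1) x, unfolded tx] form_alt[OF f(1) c(1) cx] form_alt[OF f(2) c(1) cx]])
  finally show ?thesis by (simp add: eq form_inner_at_eq)
qed

lemma form_inner_add_right: "inner p \<omega> (\<eta> + \<theta>) m = inner p \<omega> \<eta> m + inner p \<omega> \<theta> m"
  by (rule form_inner_some_chart[of m])
     (simp add: form_inner_at_def distrib_left sum.distrib add_divide_distrib)

lemma form_inner_diff_left: "inner p (\<omega> - \<theta>) \<eta> m = inner p \<omega> \<eta> m - inner p \<theta> \<eta> m"
  by (rule form_inner_some_chart[of m])
     (simp add: form_inner_at_def left_diff_distrib right_diff_distrib sum_subtractf diff_divide_distrib)

lemma form_inner_fmult_right: "inner p \<omega> (fmult f \<eta>) m = f m * inner p \<omega> \<eta> m"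
  by (rule form_inner_some_chart[of m])
     (simp add: form_inner_at_def fmult_def cinv_cmap sum_distrib_left mult_ac)

lemma form_inner_fmult_left: "inner p (fmult f \<omega>) \<eta> m = f m * inner p \<omega> \<eta> m"
  by (rule form_inner_some_chart[of m])
     (simp add: form_inner_at_def fmult_def cinv_cmap sum_distrib_left mult_ac)

lemma form_inner_diff_right: "inner p \<omega> (\<eta> - \<theta>) m = inner p \<omega> \<eta> m - inner p \<omega> \<theta> m"
  by (rule form_inner_some_chart[of m])
     (simp add: form_inner_at_def right_diff_distrib sum_subtractf diff_divide_distrib)

lemma form_inner_outside_supp: "supp_in K \<omega> \<Longrightarrow> m \<notin> K \<Longrightarrow> inner p \<omega> \<eta> m = 0"
  by (rule form_inner_some_chart[of m]) (simp add: form_inner_at_def supp_in_def)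

lemma form_inner_nonneg:
  assumes "\<omega> \<in> forms \<A> p"
  shows "inner p \<omega> \<omega> m \<ge> 0"
proof -
  obtain c where c: "c \<in> \<A>" "m \<in> cdom c" using ex_chart .
  show ?thesis
    using contraction_nonneg_posdef(1)[OF hinv_sym[OF c(1) cmap_in[OF c]] hinv_pos[OF c(1) cmap_in[OF c]]
        form_alt[OF assms c(1) cmap_in[OF c]]]
    by (simp add: form_inner_chart[OF c assms assms] form_inner_at_eq)
qed

lemma form_inner_eq_0D:
  assumes "\<omega> \<in> forms \<A> p" "inner p \<omega> \<omega> m = 0" "c \<in> \<A>" "m \<in> cdom c"
  shows "\<omega> c (cmap c m) vs = 0"
proof (cases "length vs = p")
  case True
  have "contraction (hinv c (cmap c m)) p (\<omega> c (cmap c m)) (\<omega> c (cmap c m)) = 0"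
    using assms(2) by (simp add: form_inner_chart[OF assms(3,4,1,1)] form_inner_at_eq)
  then show ?thesis
    using contraction_nonneg_posdef(2)[OF hinv_sym hinv_pos form_alt[OF assms(1)]] True assms(3) cmap_in[OF assms(3,4)]
    by blast
qed (use form_zero[OF assms(1)] in simp)

lemma continuous_on_form_inner:
  assumes c: "c \<in> \<A>" and f: "\<omega> \<in> forms \<A> p" "\<eta> \<in> forms \<A> p"
  shows "continuous_on (cdom c) (inner p \<omega> \<eta>)"
proof -
  have h: "continuous_on (cimg c) (\<lambda>x. hinv c x $ i $ j)" for i j
  proof (rule continuous_on_matrix_inv)
    show "continuous_on (cimg c) (\<lambda>x. h c x $ i $ j)" for i j by (rule smooth_on_continuous[OF h_smooth[OF c]])
    show "det (h c x) \<noteq> 0" if "x \<in> cimg c" for x using det_h_pos[OF c that] by simp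
  qed
  have "continuous_on (cimg c) (\<lambda>x. form_inner_at h p \<omega> \<eta> c x)"
    unfolding form_inner_at_def
    by (intro continuous_on_mult continuous_on_const continuous_on_sum continuous_on_prod h
        smooth_on_continuous[OF form_smooth[OF f(1) c]] smooth_on_continuous[OF form_smooth[OF f(2) c]])
  then have "continuous_on (cdom c) (\<lambda>m. form_inner_at h p \<omega> \<eta> c (cmap c m))"
    by (rule continuous_on_compose2[OF _ cont_cmap[OF c]]) (use cmap_in[OF c] in blast)
  then show ?thesis by (rule continuous_on_eq) (simp add: form_inner_chart[OF c _ f])
qed

subsection \<open>Integration against the Riemannian volume\<close>

lemma sets_vol: "sets vol = sets borel"
  using volume by (simp add: riemannian_volume_def)

lemma space_vol: "space vol = UNIV"
  using sets_eq_imp_space_eq[OF sets_vol] by simp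

lemma emeasure_vol_chart:
  "c \<in> \<A> \<Longrightarrow> A \<in> sets borel \<Longrightarrow> A \<subseteq> cdom c \<Longrightarrow>
   emeasure vol A = (\<integral>\<^sup>+x. ennreal (sqrt (det (h c x))) * indicator (cmap c ` A) x \<partial>lborel)"
  using volume unfolding riemannian_volume_def by blast

lemma continuous_on_sqrt_det: "c \<in> \<A> \<Longrightarrow> continuous_on (cimg c) (\<lambda>x. sqrt (det (h c x)))"
  unfolding det_def
  by (intro continuous_on_real_sqrt continuous_on_sum continuous_on_mult continuous_on_const continuous_on_prod
      smooth_on_continuous[OF h_smooth])

lemma emeasure_vol_compact:
  assumes c: "c \<in> \<A>" and K: "compact K" "K \<subseteq> cdom c"
  shows "emeasure vol K < \<infinity>"
proof -
  let ?L = "cmap c ` K"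
  have L: "compact ?L" by (rule compact_continuous_image[OF continuous_on_subset[OF cont_cmap[OF c] K(2)] K(1)])
  have "?L \<subseteq> cimg c" using K(2) cmap_in[OF c] by blast
  then have "compact ((\<lambda>x. sqrt (det (h c x))) ` ?L)"
    by (intro compact_continuous_image continuous_on_subset[OF continuous_on_sqrt_det[OF c]] L)
  then obtain B where B: "\<And>x. x \<in> ?L \<Longrightarrow> sqrt (det (h c x)) \<le> B"
    by (metis bdd_above.unfold bounded_imp_bdd_above compact_imp_bounded imageI)
  have "emeasure vol K = (\<integral>\<^sup>+x. ennreal (sqrt (det (h c x))) * indicator ?L x \<partial>lborel)"
    using K by (intro emeasure_vol_chart[OF c]) (auto intro: borel_closed compact_imp_closed)
  also have "\<dots> \<le> (\<integral>\<^sup>+x. ennreal B * indicator ?L x \<partial>lborel)"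
    using B by (intro nn_integral_mono) (auto split: split_indicator intro: ennreal_leI)
  also have "\<dots> = ennreal B * emeasure lborel ?L"
    using L by (intro nn_integral_cmult_indicator) (auto intro: borel_closed compact_imp_closed)
  also have "\<dots> < \<infinity>"
    using emeasure_compact_finite[OF L] by (simp add: ennreal_mult_less_top)
  finally show ?thesis .
qed

text \<open>The density \<open>sqrt (det h)\<close> is positive, so a null set in the image of a chart is Lebesgue null, and
  nonempty open sets are not.\<close>

lemma emeasure_vol_open_pos:
  assumes c: "c \<in> \<A>" and U: "open U" "U \<subseteq> cdom c" "U \<noteq> {}"
  shows "emeasure vol U \<noteq> 0"
proof
  assume "emeasure vol U = 0"
  let ?L = "cmap c ` U"
  have L: "?L = cimg c \<inter> cinv c -` U"
    using U(2) cmap_in[OF c] cinv_cmap[OF c] cmap_cinv[OF c] by (force simp: image_iff)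
  then have oL: "open ?L" using open_preimage_cinv[OF c U(1)] by simp
  have eq: "ennreal (sqrt (det (h c x))) * indicator ?L x = ennreal (indicator ?L x *\<^sub>R sqrt (det (h c x)))" for x
    by (auto split: split_indicator)
  have "(\<lambda>x. indicator ?L x *\<^sub>R sqrt (det (h c x))) \<in> borel_measurable borel"
    by (rule borel_measurable_continuous_on_indicator[OF _ continuous_on_subset[OF continuous_on_sqrt_det[OF c]]])
       (use oL L in auto)
  then have meas: "(\<lambda>x. ennreal (sqrt (det (h c x))) * indicator ?L x) \<in> borel_measurable lborel"
    unfolding eq by simp
  have "(\<integral>\<^sup>+x. ennreal (sqrt (det (h c x))) * indicator ?L x \<partial>lborel) = 0"
    using emeasure_vol_chart[OF c _ U(2)] \<open>emeasure vol U = 0\<close> U(1) by simp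
  then have "AE x in lborel. ennreal (sqrt (det (h c x))) * indicator ?L x = 0"
    using nn_integral_0_iff_AE[OF meas] by simp
  then have "AE x in lborel. x \<notin> ?L"
  proof eventually_elim
    case (elim x)
    show ?case
    proof
      assume x: "x \<in> ?L"
      then have "det (h c x) > 0" using L det_h_pos[OF c] by blast
      then show False using elim x by simp
    qed
  qed
  then have "?L \<in> null_sets lborel"
    using oL by (subst (asm) AE_iff_null_sets[symmetric]) auto
  then have "?L \<in> null_sets lebesgue" by (rule null_sets_completionI)
  then have "negligible ?L" by (simp add: negligible_iff_null_sets)
  then show False using open_not_negligible[OF oL] U(3) by blast
qed

lemma continuous_on_extend_0:
  assumes c: "c \<in> \<A>" and K: "compact K" "K \<subseteq> cdom c" and g: "continuous_on (cdom c) g" "\<And>m. m \<notin> K \<Longrightarrow> g m = 0"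
  shows "continuous_on UNIV (g :: 'm \<Rightarrow> real)"
proof -
  have "continuous_on (- K) g"
    by (rule continuous_on_eq[OF continuous_on_const[of _ 0]]) (simp add: g(2))
  then have "continuous_on (cdom c \<union> - K) g"
    using K open_cdom[OF c] g(1) compact_imp_closed by (intro continuous_on_open_Un) auto
  moreover have "cdom c \<union> - K = UNIV" using K(2) by blast
  ultimately show ?thesis by simp
qed

lemma integrable_compact_supp:
  assumes c: "c \<in> \<A>" and K: "compact K" "K \<subseteq> cdom c" and g: "continuous_on (cdom c) g" "\<And>m. m \<notin> K \<Longrightarrow> g m = 0"
  shows "integrable vol (g :: 'm \<Rightarrow> real)"
proof -
  have cont: "continuous_on UNIV g" by (rule continuous_on_extend_0[OF assms])
  have "compact (g ` K)" by (rule compact_continuous_image[OF continuous_on_subset[OF cont] K(1)]) simp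
  then obtain B where B: "\<And>m. m \<in> K \<Longrightarrow> norm (g m) \<le> B"
    by (metis bounded_iff compact_imp_bounded imageI)
  show ?thesis
  proof (rule integrableI_bounded_set[of K])
    show "K \<in> sets vol" using K(1) by (simp add: sets_vol borel_closed compact_imp_closed)
    show "g \<in> borel_measurable vol"
      using borel_measurable_continuous_onI[OF cont] measurable_cong_sets[OF sets_vol refl] by blast
    show "emeasure vol K < \<infinity>" by (rule emeasure_vol_compact[OF c K])
  qed (use B g(2) in auto)
qed

lemma integral_eq_0_imp_eq_0:
  assumes c: "c \<in> \<A>" and K: "compact K" "K \<subseteq> cdom c" and g: "continuous_on (cdom c) g" "\<And>m. m \<notin> K \<Longrightarrow> g m = 0"
    and nonneg: "\<And>m. g m \<ge> 0" and int: "(LINT m|vol. g m) = (0 :: real)"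
  shows "g m = 0"
proof (rule ccontr)
  assume m: "g m \<noteq> 0"
  let ?U = "{m \<in> cdom c. g m > 0}"
  have "AE m in vol. g m = 0"
    using integral_nonneg_eq_0_iff_AE[OF integrable_compact_supp[OF c K g]] nonneg int by simp
  moreover have oU: "open ?U"
  proof -
    have "open (cdom c \<inter> g -` {0<..})" by (rule continuous_open_preimage[OF g(1) open_cdom[OF c]]) simp
    moreover have "cdom c \<inter> g -` {0<..} = ?U" by auto
    ultimately show ?thesis by simp
  qed
  ultimately have "emeasure vol ?U = 0"
  proof -
    assume ae: "AE m in vol. g m = 0"
    have "AE m in vol. m \<notin> ?U" using ae by eventually_elim simp
    then show "emeasure vol ?U = 0"
      using oU by (subst (asm) AE_iff_measurable[OF _ refl]) (auto simp: space_vol sets_vol)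
  qed
  moreover have "m \<in> ?U" using m g(2) K(2) nonneg[of m] by force
  ultimately show False using emeasure_vol_open_pos[OF c oU] by blast
qed

text \<open>The pairing is only evaluated with a first argument of this kind, so that all integrals take place
  in a single chart.\<close>

definition test_form :: "nat \<Rightarrow> ('m, 'n) form \<Rightarrow> bool" where
  "test_form p \<omega> \<longleftrightarrow> \<omega> \<in> forms \<A> p \<and> (\<exists>c\<in>\<A>. \<exists>K. compact K \<and> K \<subseteq> cdom c \<and> supp_in K \<omega>)"

lemma test_form_in_forms: "test_form p \<omega> \<Longrightarrow> \<omega> \<in> forms \<A> p"
  by (simp add: test_form_def)

lemma test_form_fmult: "test_form p \<omega> \<Longrightarrow> f \<in> smooth_funs \<A> \<Longrightarrow> test_form p (fmult f \<omega>)"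
  unfolding test_form_def by (meson supp_in_fmult fmult_in_forms)

lemma test_form_ext_d: "test_form p \<omega> \<Longrightarrow> test_form (Suc p) (ext_d \<A> \<omega>)"
  unfolding test_form_def by (meson supp_in_ext_d ext_d_in_forms)

lemma test_form_compact: "test_form p \<omega> \<Longrightarrow> compact (form_supp \<A> \<omega>)"
  unfolding test_form_def using compact_form_supp by blast

definition pairing :: "nat \<Rightarrow> ('m, 'n) form \<Rightarrow> ('m, 'n) form \<Rightarrow> real" where
  "pairing p \<omega> \<eta> = (LINT m|vol. inner p \<omega> \<eta> m)"

lemma integrable_inner:
  assumes "test_form p \<omega>" "\<eta> \<in> forms \<A> p"
  shows "integrable vol (inner p \<omega> \<eta>)"
proof -
  obtain c K where cK: "c \<in> \<A>" "compact K" "K \<subseteq> cdom c" "supp_in K \<omega>" "\<omega> \<in> forms \<A> p"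
    using assms(1) unfolding test_form_def by blast
  show ?thesis
    by (rule integrable_compact_supp[OF cK(1-3) continuous_on_form_inner[OF cK(1,5) assms(2)]
          form_inner_outside_supp[OF cK(4)]])
qed

lemma pairing_add_right:
  "test_form p \<omega> \<Longrightarrow> \<eta> \<in> forms \<A> p \<Longrightarrow> \<theta> \<in> forms \<A> p \<Longrightarrow> pairing p \<omega> (\<eta> + \<theta>) = pairing p \<omega> \<eta> + pairing p \<omega> \<theta>"
  by (simp add: pairing_def form_inner_add_right integrable_inner)

lemma pairing_diff_right:
  "test_form p \<omega> \<Longrightarrow> \<eta> \<in> forms \<A> p \<Longrightarrow> \<theta> \<in> forms \<A> p \<Longrightarrow> pairing p \<omega> (\<eta> - \<theta>) = pairing p \<omega> \<eta> - pairing p \<omega> \<theta>"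
  by (simp add: pairing_def form_inner_diff_right integrable_inner)

lemma pairing_diff_left:
  "test_form p \<omega> \<Longrightarrow> test_form p \<theta> \<Longrightarrow> \<eta> \<in> forms \<A> p \<Longrightarrow> pairing p (\<omega> - \<theta>) \<eta> = pairing p \<omega> \<eta> - pairing p \<theta> \<eta>"
  by (simp add: pairing_def form_inner_diff_left integrable_inner)

lemma pairing_fmult: "pairing p (fmult f \<omega>) \<eta> = pairing p \<omega> (fmult f \<eta>)"
  by (simp add: pairing_def form_inner_fmult_left form_inner_fmult_right)

lemma pairing_fscale: "pairing p \<omega> (fscale a \<eta>) = a * pairing p \<omega> \<eta>"
  by (simp add: pairing_def fscale_eq_fmult form_inner_fmult_right)

lemma pairing_self_eq_0D:
  assumes "test_form p \<omega>" "pairing p \<omega> \<omega> = 0"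
  shows "\<omega> = 0"
proof (rule form_eqI[OF test_form_in_forms[OF assms(1)] zero_in_forms])
  obtain c K where cK: "c \<in> \<A>" "compact K" "K \<subseteq> cdom c" "supp_in K \<omega>" "\<omega> \<in> forms \<A> p"
    using assms(1) unfolding test_form_def by blast
  have z: "inner p \<omega> \<omega> m = 0" for m
    by (rule integral_eq_0_imp_eq_0[OF cK(1-3) continuous_on_form_inner[OF cK(1,5,5)]
          form_inner_outside_supp[OF cK(4)] form_inner_nonneg[OF cK(5)] assms(2)[unfolded pairing_def]])
  show "\<omega> c x vs = 0 c x vs" if "c \<in> \<A>" "x \<in> cimg c" for c x vs
    using form_inner_eq_0D[OF cK(5) z that(1) cinv_in[OF that]] cmap_cinv[OF that] by simp
qed

text \<open>Test against \<open>\<phi> \<theta>\<close> with a bump function \<open>\<phi>\<close>: the integrand \<open>\<phi> |\<theta>|\<^sup>2\<close> is nonnegative.\<close>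

lemma pairing_nondegenerate:
  assumes \<theta>: "\<theta> \<in> forms \<A> p" and z: "\<And>\<omega>. test_form p \<omega> \<Longrightarrow> pairing p \<omega> \<theta> = 0"
  shows "\<theta> = 0"
proof (rule form_eqI[OF \<theta> zero_in_forms])
  fix c x vs assume c: "c \<in> \<A>" "x \<in> cimg c"
  let ?m = "cinv c x"
  obtain \<phi> K where \<phi>: "\<phi> \<in> smooth_funs \<A>" "\<phi> ?m > 0" "\<And>m. \<phi> m \<ge> 0" "compact K" "K \<subseteq> cdom c" "\<And>m. m \<notin> K \<Longrightarrow> \<phi> m = 0"
    using chart_bump_exists[OF c(1) cinv_in[OF c]] by metis
  have t: "test_form p (fmult \<phi> \<theta>)"
    unfolding test_form_def using \<phi> \<theta> c supp_in_fmult_left[of K \<phi> \<theta>] by auto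
  have "inner p (fmult \<phi> \<theta>) \<theta> ?m = 0"
  proof (rule integral_eq_0_imp_eq_0[OF c(1) \<phi>(4,5) continuous_on_form_inner[OF c(1) test_form_in_forms[OF t] \<theta>]])
    show "inner p (fmult \<phi> \<theta>) \<theta> m = 0" if "m \<notin> K" for m
      using \<phi>(6)[OF that] by (simp add: form_inner_fmult_left)
    show "inner p (fmult \<phi> \<theta>) \<theta> m \<ge> 0" for m
      using \<phi>(3)[of m] form_inner_nonneg[OF \<theta>] by (simp add: form_inner_fmult_left)
    show "(LINT m|vol. inner p (fmult \<phi> \<theta>) \<theta> m) = 0" using z[OF t] by (simp add: pairing_def)
  qed
  then have "inner p \<theta> \<theta> ?m = 0" using \<phi>(2) by (simp add: form_inner_fmult_left)
  then show "\<theta> c x vs = 0 c x vs"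
    using form_inner_eq_0D[OF \<theta> _ c(1) cinv_in[OF c]] cmap_cinv[OF c] by simp
qed

lemma forms_eqI_pairing:
  assumes "\<eta> \<in> forms \<A> p" "\<theta> \<in> forms \<A> p" "\<And>\<omega>. test_form p \<omega> \<Longrightarrow> pairing p \<omega> \<eta> = pairing p \<omega> \<theta>"
  shows "\<eta> = \<theta>"
  using pairing_nondegenerate[of "\<eta> - \<theta>" p] assms by (simp add: pairing_diff_right)

end

section \<open>The codifferential\<close>

locale hodge = riemannian \<A> h vol
  for \<A> :: "('m::{t2_space, second_countable_topology}, 'n::finite) chart set"
    and h :: "('m, 'n) metric" and vol :: "'m measure" +
  fixes \<delta> :: "('m, 'n) operator"
  assumes codiff: "codifferential \<A> h vol \<delta>"
begin

abbreviation d :: "('m, 'n) operator" where "d \<equiv> ext_d \<A>"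

lemma codiff_0: "\<eta> \<in> forms \<A> 0 \<Longrightarrow> \<delta> \<eta> = 0"
  and codiff_Suc_in_forms: "\<eta> \<in> forms \<A> (Suc p) \<Longrightarrow> \<delta> \<eta> \<in> forms \<A> p"
  using codiff unfolding codifferential_def by blast+

lemma codiff_in_forms: "\<eta> \<in> forms \<A> p \<Longrightarrow> \<delta> \<eta> \<in> forms \<A> (p - 1)"
  by (cases p) (auto simp: codiff_0 codiff_Suc_in_forms)

lemma codiff_adjoint:
  "test_form p \<omega> \<Longrightarrow> \<eta> \<in> forms \<A> (Suc p) \<Longrightarrow> pairing p \<omega> (\<delta> \<eta>) = pairing (Suc p) (d \<omega>) \<eta>"
  using codiff test_form_in_forms[of p \<omega>] test_form_compact[of p \<omega>]
  unfolding codifferential_def pairing_def by metis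

text \<open>The codifferential is known only through its adjointness to \<open>d\<close>. Its linearity, \<open>\<delta>\<^sup>2 = 0\<close> and its order
  therefore all rest on the nondegeneracy of the pairing.\<close>

lemma codiff_add:
  assumes "\<eta> \<in> forms \<A> p" "\<theta> \<in> forms \<A> p"
  shows "\<delta> (\<eta> + \<theta>) = \<delta> \<eta> + \<delta> \<theta>"
proof (cases p)
  case 0
  then show ?thesis using assms add_in_forms[OF assms] by (simp add: codiff_0 del: add_in_forms)
next
  case (Suc q)
  note f = assms[unfolded Suc]
  have "pairing q \<omega> (\<delta> (\<eta> + \<theta>)) = pairing q \<omega> (\<delta> \<eta> + \<delta> \<theta>)" if "test_form q \<omega>" for \<omega>
    using that f codiff_Suc_in_forms
    by (simp add: codiff_adjoint pairing_add_right test_form_ext_d)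
  then show ?thesis using f codiff_Suc_in_forms by (intro forms_eqI_pairing[of _ q]) auto
qed

lemma codiff_fscale:
  assumes "\<eta> \<in> forms \<A> p"
  shows "\<delta> (fscale a \<eta>) = fscale a (\<delta> \<eta>)"
proof (cases p)
  case 0
  have "fscale a 0 = (0 :: ('m, 'n) form)" by (simp add: fscale_def fun_eq_iff)
  then show ?thesis using assms 0 fscale_in_forms[of \<eta> 0 a] by (simp add: codiff_0 del: fscale_in_forms)
next
  case (Suc q)
  note f = assms[unfolded Suc]
  have "pairing q \<omega> (\<delta> (fscale a \<eta>)) = pairing q \<omega> (fscale a (\<delta> \<eta>))" if "test_form q \<omega>" for \<omega>
    using that f by (simp add: codiff_adjoint pairing_fscale)
  then show ?thesis using f codiff_Suc_in_forms by (intro forms_eqI_pairing[of _ q]) auto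
qed

lemma pairing_0_right: "pairing p \<omega> 0 = 0"
proof -
  have "fscale 0 0 = (0 :: ('m, 'n) form)" by (simp add: fscale_def fun_eq_iff)
  then show ?thesis using pairing_fscale[of p \<omega> 0 0] by simp
qed

lemma codiff_codiff:
  assumes "\<eta> \<in> forms \<A> p"
  shows "\<delta> (\<delta> \<eta>) = 0"
proof (cases "p \<le> 1")
  case True
  then have "\<delta> \<eta> \<in> forms \<A> 0" using codiff_in_forms[OF assms] by (cases p) auto
  then show ?thesis by (rule codiff_0)
next
  case False
  then obtain q where q: "p = Suc (Suc q)" by (metis One_nat_def Suc_le_mono le0 not0_implies_Suc)
  note f = assms[unfolded q]
  have "pairing q \<omega> (\<delta> (\<delta> \<eta>)) = pairing q \<omega> 0" if "test_form q \<omega>" for \<omega>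
  proof -
    have "pairing q \<omega> (\<delta> (\<delta> \<eta>)) = pairing (Suc (Suc q)) (d (d \<omega>)) \<eta>"
      using that f codiff_Suc_in_forms[OF f] by (simp add: codiff_adjoint test_form_ext_d)
    also have "\<dots> = pairing (Suc (Suc q)) (fmult (\<lambda>_. 0) (d (d \<omega>))) \<eta>"
      using ext_d_ext_d[OF test_form_in_forms[OF that]] by (simp add: fmult_simps)
    also have "\<dots> = 0" by (simp add: pairing_def form_inner_fmult_left)
    finally show ?thesis by (simp add: pairing_0_right)
  qed
  then show ?thesis using codiff_Suc_in_forms[OF codiff_Suc_in_forms[OF f]]
    by (intro forms_eqI_pairing[of _ q]) auto
qed

text \<open>The commutator of \<open>\<delta>\<close> with a function is minus the adjoint of wedging with its differential.\<close>

definition codiff_comm :: "('m \<Rightarrow> real) \<Rightarrow> ('m, 'n) operator" where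
  "codiff_comm f \<eta> = \<delta> (fmult f \<eta>) - fmult f (\<delta> \<eta>)"

lemma codiff_comm_0: "\<eta> \<in> forms \<A> 0 \<Longrightarrow> f \<in> smooth_funs \<A> \<Longrightarrow> codiff_comm f \<eta> = 0"
  by (simp add: codiff_comm_def codiff_0 fmult_simps)

lemma codiff_comm_Suc_in_forms:
  "\<eta> \<in> forms \<A> (Suc p) \<Longrightarrow> f \<in> smooth_funs \<A> \<Longrightarrow> codiff_comm f \<eta> \<in> forms \<A> p"
  by (simp add: codiff_comm_def codiff_Suc_in_forms)

lemma pairing_d_comm: "test_form p \<omega> \<Longrightarrow> f \<in> smooth_funs \<A> \<Longrightarrow> pairing (Suc p) (d_comm f \<omega>) \<eta>
    = pairing (Suc p) (d (fmult f \<omega>)) \<eta> - pairing (Suc p) (fmult f (d \<omega>)) \<eta>" if "\<eta> \<in> forms \<A> (Suc p)"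
  unfolding d_comm_def
  by (intro pairing_diff_left test_form_ext_d test_form_fmult that)

lemma codiff_comm_adjoint:
  assumes "test_form p \<omega>" "\<eta> \<in> forms \<A> (Suc p)" "f \<in> smooth_funs \<A>"
  shows "pairing p \<omega> (codiff_comm f \<eta>) = - pairing (Suc p) (d_comm f \<omega>) \<eta>"
proof -
  have "pairing p \<omega> (codiff_comm f \<eta>) = pairing p \<omega> (\<delta> (fmult f \<eta>)) - pairing p (fmult f \<omega>) (\<delta> \<eta>)"
    using assms by (simp add: codiff_comm_def pairing_diff_right codiff_Suc_in_forms pairing_fmult)
  also have "\<dots> = pairing (Suc p) (fmult f (d \<omega>)) \<eta> - pairing (Suc p) (d (fmult f \<omega>)) \<eta>"
    unfolding codiff_adjoint[OF assms(1) fmult_in_forms[OF assms(2,3)]]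
      codiff_adjoint[OF test_form_fmult[OF assms(1,3)] assms(2)]
    by (simp add: pairing_fmult)
  finally show ?thesis using assms by (simp add: pairing_d_comm)
qed

lemma codiff_comm_fmult:
  assumes "\<eta> \<in> forms \<A> p" "f \<in> smooth_funs \<A>" "g \<in> smooth_funs \<A>"
  shows "codiff_comm f (fmult g \<eta>) = fmult g (codiff_comm f \<eta>)"
proof (cases p)
  case 0
  then show ?thesis using assms codiff_comm_0 by (simp add: fmult_simps)
next
  case (Suc q)
  note \<eta> = assms(1)[unfolded Suc]
  show ?thesis
  proof (rule forms_eqI_pairing[of _ q])
    fix \<omega> assume t: "test_form q \<omega>"
    have "pairing q \<omega> (codiff_comm f (fmult g \<eta>)) = - pairing (Suc q) (d_comm f (fmult g \<omega>)) \<eta>"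
      using assms t \<eta> by (simp add: codiff_comm_adjoint d_comm_fmult[OF test_form_in_forms[OF t]] pairing_fmult)
    then show "pairing q \<omega> (codiff_comm f (fmult g \<eta>)) = pairing q \<omega> (fmult g (codiff_comm f \<eta>))"
      using assms t \<eta> by (simp add: codiff_comm_adjoint test_form_fmult pairing_fmult[symmetric])
  qed (use assms \<eta> in \<open>simp_all add: codiff_comm_Suc_in_forms\<close>)
qed

end

section \<open>Differential operators and their principal symbols\<close>

context oriented_atlas
begin

text \<open>Sums of forms have to stay sums: evaluating them pointwise would break the terms to which the rules
  for operators apply.\<close>

declare plus_fun_apply [simp del] minus_apply [simp del] zero_fun_apply [simp del]

abbreviation comm :: "('m \<Rightarrow> real) \<Rightarrow> ('m, 'n) operator \<Rightarrow> ('m, 'n) operator" where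
  "comm f D \<equiv> (\<lambda>\<omega>. D (fmult f \<omega>) - fmult f (D \<omega>))"

lemma fscale_simps:
  "fscale a (\<omega> + \<eta>) = fscale a \<omega> + fscale a \<eta>"
  "fscale a (\<omega> - \<eta>) = fscale a \<omega> - fscale a \<eta>"
  "fscale a (fscale b \<omega>) = fscale (a * b) \<omega>"
  "fscale 1 \<omega> = \<omega>" "fscale 0 \<omega> = 0" "fscale a 0 = 0"
  by (simp_all add: fun_eq_iff fscale_def algebra_simps plus_fun_apply minus_apply zero_fun_apply)

lemma fscale_add_left: "fscale (a + b) \<omega> = fscale a \<omega> + fscale b \<omega>"
  by (simp add: fun_eq_iff fscale_def algebra_simps plus_fun_apply)

lemma linear_opI:
  assumes "\<And>\<omega>. \<omega> \<in> forms \<A> p \<Longrightarrow> D \<omega> \<in> forms \<A> q"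
    and "\<And>\<omega> \<eta>. \<omega> \<in> forms \<A> p \<Longrightarrow> \<eta> \<in> forms \<A> p \<Longrightarrow> D (\<omega> + \<eta>) = D \<omega> + D \<eta>"
    and "\<And>a \<omega>. \<omega> \<in> forms \<A> p \<Longrightarrow> D (fscale a \<omega>) = fscale a (D \<omega>)"
  shows "linear_op \<A> p q D"
  using assms by (simp add: linear_op_def)

lemma linear_opD:
  assumes "linear_op \<A> p q D" "\<omega> \<in> forms \<A> p"
  shows "D \<omega> \<in> forms \<A> q" "\<eta> \<in> forms \<A> p \<Longrightarrow> D (\<omega> + \<eta>) = D \<omega> + D \<eta>" "D (fscale a \<omega>) = fscale a (D \<omega>)"
    "\<eta> \<in> forms \<A> p \<Longrightarrow> D (\<omega> - \<eta>) = D \<omega> - D \<eta>"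
proof -
  show 1: "D \<omega> \<in> forms \<A> q" "\<eta> \<in> forms \<A> p \<Longrightarrow> D (\<omega> + \<eta>) = D \<omega> + D \<eta>" "D (fscale a \<omega>) = fscale a (D \<omega>)" for \<eta> a
    using assms by (simp_all add: linear_op_def)
  have neg: "\<omega> - \<eta> = \<omega> + fscale (-1) \<eta>" for \<omega> \<eta> :: "('m, 'n) form" by (simp add: fun_eq_iff fscale_def plus_fun_apply minus_apply)
  show "D (\<omega> - \<eta>) = D \<omega> - D \<eta>" if "\<eta> \<in> forms \<A> p"
    unfolding neg using assms that by (simp add: linear_op_def)
qed

lemma linear_op_0: "linear_op \<A> p q D \<Longrightarrow> D 0 = 0"
  using linear_opD(3)[of p q D 0 0] by (simp add: fscale_simps)

lemma linear_op_cong: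
  assumes "\<And>\<omega>. \<omega> \<in> forms \<A> p \<Longrightarrow> D \<omega> = D' \<omega>" "linear_op \<A> p q D"
  shows "linear_op \<A> p q D'"
  using assms(2) unfolding linear_op_def by (simp add: assms(1)[symmetric])

lemma linear_op_zero: "linear_op \<A> p q (\<lambda>_. 0)"
  by (rule linear_opI) (simp_all add: fscale_simps)

lemma linear_op_id: "linear_op \<A> p p id"
  by (rule linear_opI) simp_all

lemma linear_op_comp: "linear_op \<A> p q D \<Longrightarrow> linear_op \<A> q r E \<Longrightarrow> linear_op \<A> p r (\<lambda>\<omega>. E (D \<omega>))"
  by (simp add: linear_op_def)

lemma linear_op_add: "linear_op \<A> p q D \<Longrightarrow> linear_op \<A> p q E \<Longrightarrow> linear_op \<A> p q (\<lambda>\<omega>. D \<omega> + E \<omega>)"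
  by (simp add: linear_op_def fscale_simps)

lemma linear_op_fscale: "linear_op \<A> p q D \<Longrightarrow> linear_op \<A> p q (\<lambda>\<omega>. fscale a (D \<omega>))"
  by (simp add: linear_op_def fscale_simps mult.commute)

lemma linear_op_comm: "linear_op \<A> p q D \<Longrightarrow> f \<in> smooth_funs \<A> \<Longrightarrow> linear_op \<A> p q (comm f D)"
  by (simp add: linear_op_def fscale_simps fmult_simps)

subsection \<open>Order\<close>

lemma diff_op_linear: "diff_op \<A> p q k D \<Longrightarrow> linear_op \<A> p q D"
  by (cases k) auto

lemma diff_op_SucI:
  "linear_op \<A> p q D \<Longrightarrow> (\<And>f. f \<in> smooth_funs \<A> \<Longrightarrow> diff_op \<A> p q k (comm f D)) \<Longrightarrow> diff_op \<A> p q (Suc k) D"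
  and diff_op_SucD: "diff_op \<A> p q (Suc k) D \<Longrightarrow> f \<in> smooth_funs \<A> \<Longrightarrow> diff_op \<A> p q k (comm f D)"
  by simp_all

lemma diff_op_cong:
  "(\<And>\<omega>. \<omega> \<in> forms \<A> p \<Longrightarrow> D \<omega> = D' \<omega>) \<Longrightarrow> diff_op \<A> p q k D \<Longrightarrow> diff_op \<A> p q k D'"
proof (induction k arbitrary: D D')
  case 0
  then show ?case using linear_op_cong[of p D D' q] by auto
next
  case (Suc k)
  have "diff_op \<A> p q k (comm f D')" if "f \<in> smooth_funs \<A>" for f
    by (rule Suc.IH[of "comm f D"]) (use Suc.prems that in auto)
  then show ?case using Suc.prems linear_op_cong[of p D D' q] by simp
qed

lemma diff_op_zero: "diff_op \<A> p q k (\<lambda>_. 0)"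
  by (induction k) (simp_all add: linear_op_zero fmult_simps)

lemma diff_op_Suc: "diff_op \<A> p q k D \<Longrightarrow> diff_op \<A> p q (Suc k) D"
proof (induction k arbitrary: D)
  case 0
  have "diff_op \<A> p q 0 (comm f D)" if "f \<in> smooth_funs \<A>" for f
    by (rule diff_op_cong[OF _ diff_op_zero]) (use 0 that in auto)
  then show ?case using 0 by simp
next
  case (Suc k)
  show ?case
    by (rule diff_op_SucI[OF diff_op_linear[OF Suc.prems] Suc.IH[OF diff_op_SucD[OF Suc.prems]]])
qed

lemma diff_op_mono: "k \<le> k' \<Longrightarrow> diff_op \<A> p q k D \<Longrightarrow> diff_op \<A> p q k' D"
  by (induction k' rule: dec_induct) (auto simp: diff_op_Suc simp del: diff_op.simps)

lemma diff_op_add: "diff_op \<A> p q k D \<Longrightarrow> diff_op \<A> p q k E \<Longrightarrow> diff_op \<A> p q k (\<lambda>\<omega>. D \<omega> + E \<omega>)"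
proof (induction k arbitrary: D E)
  case 0
  then show ?case by (simp add: linear_op_add fmult_simps)
next
  case (Suc k)
  have "diff_op \<A> p q k (comm f (\<lambda>\<omega>. D \<omega> + E \<omega>))" if "f \<in> smooth_funs \<A>" for f
    by (rule diff_op_cong[OF _ Suc.IH[of "comm f D" "comm f E"]]) (use Suc.prems that in \<open>auto simp: fmult_simps\<close>)
  then show ?case using Suc.prems by (simp add: linear_op_add)
qed

lemma diff_op_fscale: "diff_op \<A> p q k D \<Longrightarrow> diff_op \<A> p q k (\<lambda>\<omega>. fscale a (D \<omega>))"
proof (induction k arbitrary: D)
  case 0
  then show ?case by (simp add: linear_op_fscale fmult_simps)
next
  case (Suc k)
  have "diff_op \<A> p q k (comm f (\<lambda>\<omega>. fscale a (D \<omega>)))" if "f \<in> smooth_funs \<A>" for f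
    by (rule diff_op_cong[OF _ Suc.IH[of "comm f D"]]) (use Suc.prems that in \<open>auto simp: fmult_simps fscale_simps\<close>)
  then show ?case using Suc.prems by (simp add: linear_op_fscale)
qed

text \<open>Taking the commutator with a function is a derivation. Both the orders and the symbols of composites follow
  from this by induction over the sum of the orders.\<close>

lemma comm_comp:
  assumes "linear_op \<A> p q D" "linear_op \<A> q r E" "f \<in> smooth_funs \<A>" "\<omega> \<in> forms \<A> p"
  shows "comm f (\<lambda>\<omega>. E (D \<omega>)) \<omega> = E (comm f D \<omega>) + comm f E (D \<omega>)"
  using assms linear_opD(4)[OF assms(2), of "D (fmult f \<omega>)" "fmult f (D \<omega>)"] linear_opD(1)[OF assms(1)] by simp

lemma diff_op_comp:
  "diff_op \<A> p q k D \<Longrightarrow> diff_op \<A> q r m E \<Longrightarrow> diff_op \<A> p r (k + m) (\<lambda>\<omega>. E (D \<omega>))"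
proof (induction "k + m" arbitrary: k m D E)
  case 0
  then show ?case by (auto simp: linear_op_comp linear_op_def)
next
  case (Suc n)
  note lin = diff_op_linear[OF Suc.prems(1)] diff_op_linear[OF Suc.prems(2)]
  have "diff_op \<A> p r n (comm f (\<lambda>\<omega>. E (D \<omega>)))" if f: "f \<in> smooth_funs \<A>" for f
  proof (rule diff_op_cong[OF comm_comp[OF lin f, symmetric] diff_op_add])
    show "diff_op \<A> p r n (\<lambda>\<omega>. E (comm f D \<omega>))"
    proof (cases k)
      case 0
      show ?thesis by (rule diff_op_cong[OF _ diff_op_zero]) (use 0 Suc.prems f linear_op_0[OF lin(2)] in auto)
    next
      case (Suc k')
      then show ?thesis
        using Suc.hyps(1)[of k' m "comm f D" E] Suc.hyps(2) Suc.prems diff_op_SucD[OF _ f] by auto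
    qed
    show "diff_op \<A> p r n (\<lambda>\<omega>. comm f E (D \<omega>))"
    proof (cases m)
      case 0
      show ?thesis by (rule diff_op_cong[OF _ diff_op_zero]) (use 0 Suc.prems f linear_opD(1)[OF lin(1)] in auto)
    next
      case (Suc m')
      then show ?thesis using Suc.hyps(1)[of k m' D "comm f E"] Suc.hyps(2) Suc.prems f by auto
    qed
  qed
  then show ?case using Suc.hyps(2)[symmetric] linear_op_comp[OF lin] by simp
qed

subsection \<open>Principal symbols\<close>

text \<open>\<open>symbol f p q k D S\<close> says that the \<open>k\<close>-fold commutator of \<open>D\<close> with \<open>f\<close> is \<open>k!\<close> times the
  operator \<open>S\<close>: this is the principal symbol at the covectors \<open>df\<close>, which is multiplicative.\<close>

fun symbol :: "('m \<Rightarrow> real) \<Rightarrow> nat \<Rightarrow> nat \<Rightarrow> nat \<Rightarrow> ('m, 'n) operator \<Rightarrow> ('m, 'n) operator \<Rightarrow> bool" where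
  "symbol f p q 0 D S \<longleftrightarrow> linear_op \<A> p q D \<and> (\<forall>\<omega>\<in>forms \<A> p. D (fmult f \<omega>) = fmult f (D \<omega>) \<and> D \<omega> = S \<omega>)"
| "symbol f p q (Suc k) D S \<longleftrightarrow> linear_op \<A> p q D \<and>
     symbol f p q k (\<lambda>\<omega>. fscale (1 / real (Suc k)) (comm f D \<omega>)) S"

lemma symbol_linear: "symbol f p q k D S \<Longrightarrow> linear_op \<A> p q D"
  by (cases k) auto

context
  fixes f assumes f: "f \<in> smooth_funs \<A>"
begin

lemma symbol_cong:
  "(\<And>\<omega>. \<omega> \<in> forms \<A> p \<Longrightarrow> D \<omega> = D' \<omega>) \<Longrightarrow> (\<And>\<omega>. \<omega> \<in> forms \<A> p \<Longrightarrow> S \<omega> = S' \<omega>) \<Longrightarrow>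
   symbol f p q k D S \<Longrightarrow> symbol f p q k D' S'"
proof (induction k arbitrary: D D')
  case 0
  have "D' (fmult f \<omega>) = fmult f (D' \<omega>) \<and> D' \<omega> = S' \<omega>" if "\<omega> \<in> forms \<A> p" for \<omega>
    using 0(3) 0(1)[OF that] 0(1)[OF fmult_in_forms[OF that f]] 0(2)[OF that] that by auto
  then show ?case using linear_op_cong[of p D D' q] 0(1,3) by simp
next
  case (Suc k)
  have "symbol f p q k (\<lambda>\<omega>. fscale (1 / real (Suc k)) (comm f D' \<omega>)) S'"
    by (rule Suc.IH[of "\<lambda>\<omega>. fscale (1 / real (Suc k)) (comm f D \<omega>)"]) (use Suc.prems f in auto)
  then show ?case using Suc.prems linear_op_cong[of p D D' q] by simp
qed

lemma symbol_unique: "symbol f p q k D S \<Longrightarrow> symbol f p q k D T \<Longrightarrow> \<omega> \<in> forms \<A> p \<Longrightarrow> S \<omega> = T \<omega>"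
  by (induction k arbitrary: D) auto

lemma symbol_add_fscale:
  "symbol f p q k D S \<Longrightarrow> symbol f p q k E T \<Longrightarrow>
   symbol f p q k (\<lambda>\<omega>. fscale a (D \<omega>) + fscale b (E \<omega>)) (\<lambda>\<omega>. fscale a (S \<omega>) + fscale b (T \<omega>))"
proof (induction k arbitrary: D E)
  case 0
  then show ?case by (simp add: linear_op_add linear_op_fscale fmult_simps)
next
  case (Suc k)
  let ?n = "\<lambda>D \<omega>. fscale (1 / real (Suc k)) (comm f D \<omega>)"
  have "symbol f p q k (?n (\<lambda>\<omega>. fscale a (D \<omega>) + fscale b (E \<omega>))) (\<lambda>\<omega>. fscale a (S \<omega>) + fscale b (T \<omega>))"
    by (rule symbol_cong[OF _ _ Suc.IH[of "?n D" "?n E"]])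
       (use Suc.prems f in \<open>auto simp: fmult_simps fscale_simps mult.commute\<close>)
  then show ?case using Suc.prems by (simp add: linear_op_add linear_op_fscale)
qed

lemma symbol_zero: "symbol f p q k (\<lambda>_. 0) (\<lambda>_. 0)"
  by (induction k) (simp_all add: linear_op_zero fmult_simps fscale_simps)

lemma symbol_fscale: "symbol f p q k D S \<Longrightarrow> symbol f p q k (\<lambda>\<omega>. fscale a (D \<omega>)) (\<lambda>\<omega>. fscale a (S \<omega>))"
  using symbol_add_fscale[OF _ symbol_zero, of p q k D S a 0] by (simp add: fscale_simps)

lemma symbol_comp:
  "symbol f p q k D S \<Longrightarrow> symbol f q r m E T \<Longrightarrow> symbol f p r (k + m) (\<lambda>\<omega>. E (D \<omega>)) (\<lambda>\<omega>. T (S \<omega>))"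
proof (induction "k + m" arbitrary: k m D E)
  case 0
  then have "k = 0" "m = 0" by auto
  then show ?case using 0 linear_op_comp[of p q D r E] linear_opD(1)[of p q D] by auto
next
  case (Suc n)
  note lin = symbol_linear[OF Suc.prems(1)] symbol_linear[OF Suc.prems(2)]
  let ?c = "1 / real (Suc n)" and ?ST = "\<lambda>\<omega>. T (S \<omega>)"
  have 1: "symbol f p r n (\<lambda>\<omega>. E (fscale ?c (comm f D \<omega>))) (\<lambda>\<omega>. fscale (real k * ?c) (?ST \<omega>))"
  proof (cases k)
    case 0
    have "comm f D \<omega> = 0" if "\<omega> \<in> forms \<A> p" for \<omega>
      using Suc.prems(1) 0 that by simp
    then show ?thesis
      by (intro symbol_cong[OF _ _ symbol_zero]) (simp_all add: 0 fscale_simps linear_op_0[OF lin(2)])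
  next
    case (Suc k')
    have n: "n = k' + m" using Suc Suc.hyps(2) by simp
    have "symbol f p q k' (\<lambda>\<omega>. fscale (1 / real (Suc k')) (comm f D \<omega>)) S"
      using Suc.prems(1) unfolding Suc symbol.simps by blast
    then have "symbol f p r n (\<lambda>\<omega>. E (fscale (1 / real (Suc k')) (comm f D \<omega>))) ?ST"
      using Suc.hyps(1)[OF n _ Suc.prems(2)] n by blast
    then have "symbol f p r n (\<lambda>\<omega>. fscale (real k * ?c) (E (fscale (1 / real (Suc k')) (comm f D \<omega>)))) (\<lambda>\<omega>. fscale (real k * ?c) (?ST \<omega>))"
      by (rule symbol_fscale)
    then show ?thesis
    proof (rule symbol_cong[rotated 2])
      fix \<omega> assume "\<omega> \<in> forms \<A> p"
      then have "comm f D \<omega> \<in> forms \<A> q" using linear_opD(1)[OF lin(1)] f by simp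
      then show "fscale (real k * ?c) (E (fscale (1 / real (Suc k')) (comm f D \<omega>))) = E (fscale ?c (comm f D \<omega>))"
        unfolding linear_opD(3)[OF lin(2) \<open>comm f D \<omega> \<in> forms \<A> q\<close>] fscale_simps(3) Suc by simp
    qed simp
  qed
  have 2: "symbol f p r n (\<lambda>\<omega>. fscale ?c (comm f E (D \<omega>))) (\<lambda>\<omega>. fscale (real m * ?c) (?ST \<omega>))"
  proof (cases m)
    case 0
    have "comm f E (D \<omega>) = 0" if "\<omega> \<in> forms \<A> p" for \<omega>
      using Suc.prems(2) 0 linear_opD(1)[OF lin(1) that] by simp
    then show ?thesis
      by (intro symbol_cong[OF _ _ symbol_zero]) (simp_all add: 0 fscale_simps)
  next
    case (Suc m')
    have n: "n = k + m'" using Suc Suc.hyps(2) by simp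
    have "symbol f q r m' (\<lambda>\<omega>. fscale (1 / real (Suc m')) (comm f E \<omega>)) T"
      using Suc.prems(2) unfolding Suc symbol.simps by blast
    then have "symbol f p r n (\<lambda>\<omega>. fscale (1 / real (Suc m')) (comm f E (D \<omega>))) ?ST"
      using Suc.hyps(1)[OF n Suc.prems(1)] n by blast
    then have "symbol f p r n (\<lambda>\<omega>. fscale (real m * ?c) (fscale (1 / real (Suc m')) (comm f E (D \<omega>)))) (\<lambda>\<omega>. fscale (real m * ?c) (?ST \<omega>))"
      by (rule symbol_fscale)
    then show ?thesis
      by (rule symbol_cong[rotated 2]) (simp_all add: Suc fscale_simps)
  qed
  have "symbol f p r n (\<lambda>\<omega>. fscale ?c (comm f (\<lambda>\<omega>. E (D \<omega>)) \<omega>)) ?ST"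
  proof (rule symbol_cong[OF _ _ symbol_add_fscale[OF 1 2, of 1 1]])
    fix \<omega> assume \<omega>: "\<omega> \<in> forms \<A> p"
    then have "comm f D \<omega> \<in> forms \<A> q" using linear_opD(1)[OF lin(1)] f by simp
    then show "fscale 1 (E (fscale ?c (comm f D \<omega>))) + fscale 1 (fscale ?c (comm f E (D \<omega>))) = fscale ?c (comm f (\<lambda>\<omega>. E (D \<omega>)) \<omega>)"
      unfolding comm_comp[OF lin f \<omega>] linear_opD(3)[OF lin(2) \<open>comm f D \<omega> \<in> forms \<A> q\<close>]
      by (simp only: fscale_simps mult_1)
    have "real k + real m = real (Suc n)" using Suc.hyps(2) by simp
    then have "real k * ?c + real m * ?c = 1" by (simp add: add_divide_distrib[symmetric] del: of_nat_Suc)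
    then show "fscale 1 (fscale (real k * ?c) (?ST \<omega>)) + fscale 1 (fscale (real m * ?c) (?ST \<omega>)) = ?ST \<omega>"
      by (simp only: fscale_simps(4) flip: fscale_add_left)
  qed
  then show ?case using Suc.hyps(2)[symmetric] linear_op_comp[OF lin] by simp
qed

text \<open>One commutator more than the order gives zero, so a differential operator of order \<open>k\<close> has vanishing
  symbol of order \<open>k + 1\<close>.\<close>

lemma diff_op_symbol_0: "diff_op \<A> p q k D \<Longrightarrow> symbol f p q (Suc k) D (\<lambda>_. 0)"
proof (induction k arbitrary: D)
  case 0
  have "symbol f p q 0 (\<lambda>\<omega>. fscale (1 / real (Suc 0)) (comm f D \<omega>)) (\<lambda>_. 0)"
    by (rule symbol_cong[OF _ _ symbol_zero]) (use 0 f in \<open>auto simp: fscale_simps\<close>)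
  then show ?case using 0 by simp
next
  case (Suc k)
  have "symbol f p q (Suc k) (comm f D) (\<lambda>_. 0)" by (rule Suc.IH[OF diff_op_SucD[OF Suc.prems f]])
  from symbol_fscale[OF this, of "1 / real (Suc (Suc k))"] show ?case
    using Suc.prems by (simp add: fscale_simps)
qed

end

end

section \<open>The order of the fourth-order factor\<close>

context hodge
begin

declare plus_fun_apply [simp del] minus_apply [simp del] zero_fun_apply [simp del]

lemma linear_d: "linear_op \<A> p (Suc p) d"
  by (rule linear_opI) (simp_all add: ext_d_add ext_d_fscale)

lemma linear_codiff: "linear_op \<A> (Suc p) p \<delta>"
  by (rule linear_opI) (simp_all add: codiff_Suc_in_forms codiff_add codiff_fscale)

lemma d_0: "d 0 = 0" and codiff_of_0: "\<delta> 0 = 0"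
  using linear_op_0[OF linear_d] linear_op_0[OF linear_codiff] by auto

lemma linear_codiff_d: "linear_op \<A> p p (\<lambda>\<omega>. \<delta> (d \<omega>))"
  by (rule linear_op_comp[OF linear_d linear_codiff])

lemma linear_d_codiff: "linear_op \<A> p p (\<lambda>\<omega>. d (\<delta> \<omega>))"
proof (cases p)
  case 0
  show ?thesis by (rule linear_op_cong[OF _ linear_op_zero]) (simp add: 0 codiff_0 d_0)
qed (simp add: linear_op_comp[OF linear_codiff linear_d])

lemma diff_op_d: "diff_op \<A> p (Suc p) 1 d"
  using linear_d linear_op_comm[OF linear_d] d_comm_fmult by (simp add: d_comm_def)

lemma diff_op_codiff: "diff_op \<A> (Suc p) p 1 \<delta>"
  using linear_codiff linear_op_comm[OF linear_codiff] codiff_comm_fmult by (simp add: codiff_comm_def)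

lemma diff_op_codiff_d: "diff_op \<A> p p 2 (\<lambda>\<omega>. \<delta> (d \<omega>))"
  using diff_op_comp[OF diff_op_d diff_op_codiff] by (simp only: one_add_one)

lemma diff_op_d_codiff: "diff_op \<A> p p 2 (\<lambda>\<omega>. d (\<delta> \<omega>))"
proof (cases p)
  case 0
  show ?thesis by (rule diff_op_cong[OF _ diff_op_zero]) (simp add: 0 codiff_0 d_0)
next
  case (Suc q)
  show ?thesis using diff_op_comp[OF diff_op_codiff diff_op_d] by (simp only: one_add_one Suc)
qed

lemma diff_op_id: "diff_op \<A> p p 0 (\<lambda>\<omega>. \<omega>)"
  using linear_op_id by (simp add: id_def)

lemma diff_eq_fscale: "\<omega> - \<eta> = fscale 1 \<omega> + fscale (-1) \<eta>" for \<omega> \<eta> :: "('m, 'n) form"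
  by (simp add: fun_eq_iff fscale_def plus_fun_apply minus_apply)

text \<open>Sums and scalings of operators unfold to those of forms. The factor \<open>1\<close> lets both summands of the
  second factor match the rules for linear combinations.\<close>

lemma P_tilde_apply:
  "P_tilde d \<delta> J l = (\<lambda>\<omega>. (\<lambda>\<theta>. fscale ((2 * real l + 1) / 2) (\<delta> (d \<theta>)) + fscale ((2 * real l - 1) / 2) (d (\<delta> \<theta>)))
     ((\<lambda>\<omega>. fscale 1 (d (\<delta> \<omega>) - \<delta> (d \<omega>)) + fscale (2 * real l * (2 * J / real CARD('n))) \<omega>) \<omega>))"
  by (rule ext) (simp only: P_tilde_def oscale_def o_def plus_fun_apply minus_apply id_def fscale_simps(4))

lemma diff_op_P_tilde: "diff_op \<A> p p 4 (P_tilde d \<delta> J l)"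
proof -
  have "diff_op \<A> p p 2 (\<lambda>\<omega>. d (\<delta> \<omega>) - \<delta> (d \<omega>))"
    unfolding diff_eq_fscale by (rule diff_op_add[OF diff_op_fscale[OF diff_op_d_codiff] diff_op_fscale[OF diff_op_codiff_d]])
  moreover have "diff_op \<A> p p 2 (\<lambda>\<omega>. \<omega>)" by (rule diff_op_mono[OF _ diff_op_id]) simp
  ultimately have "diff_op \<A> p p 2
      (\<lambda>\<omega>. fscale 1 (d (\<delta> \<omega>) - \<delta> (d \<omega>)) + fscale (2 * real l * (2 * J / real CARD('n))) \<omega>)"
    by (intro diff_op_add diff_op_fscale)
  from diff_op_comp[OF this diff_op_add[OF diff_op_fscale[OF diff_op_codiff_d] diff_op_fscale[OF diff_op_d_codiff]]]
  show ?thesis unfolding P_tilde_apply by (simp only: numeral_plus_numeral Num.add_num_simps)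
qed

lemma pairing_commute: "pairing p \<alpha> \<beta> = pairing p \<beta> \<alpha>"
proof -
  have "inner p \<alpha> \<beta> m = inner p \<beta> \<alpha> m" for m
  proof -
    obtain c where c: "c \<in> \<A>" "m \<in> cdom c" "\<And>p \<omega> \<eta>. inner p \<omega> \<eta> m = form_inner_at h p \<omega> \<eta> c (cmap c m)"
      using form_inner_some_chart[of m] by blast
    then show ?thesis
      by (simp add: form_inner_at_eq contraction_commute_transpose[of _ p "\<alpha> c (cmap c m)"] hinv_sym cmap_in)
  qed
  then show ?thesis by (simp add: pairing_def)
qed

context
  fixes f assumes f: "f \<in> smooth_funs \<A>"
begin

abbreviation "\<epsilon> \<equiv> d_comm f"
abbreviation "\<kappa> \<equiv> codiff_comm f"

lemma linear_d_comm: "linear_op \<A> p (Suc p) \<epsilon>"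
  using linear_op_comm[OF linear_d f] by (rule linear_op_cong[rotated]) (simp add: d_comm_def)

lemma linear_codiff_comm: "linear_op \<A> (Suc p) p \<kappa>"
  using linear_op_comm[OF linear_codiff f] by (rule linear_op_cong[rotated]) (simp add: codiff_comm_def)

lemma symbol_d: "symbol f p (Suc p) 1 d \<epsilon>"
  using linear_d linear_op_comm[OF linear_d f] d_comm_fmult f by (simp add: d_comm_def fscale_simps)

lemma symbol_codiff: "symbol f (Suc p) p 1 \<delta> \<kappa>"
  using linear_codiff linear_op_comm[OF linear_codiff f] codiff_comm_fmult f by (simp add: codiff_comm_def fscale_simps)

lemma d_comm_0: "\<epsilon> 0 = 0" and codiff_comm_of_0: "\<kappa> 0 = 0"
  using linear_op_0[OF linear_d_comm] linear_op_0[OF linear_codiff_comm] by auto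

lemma symbol_codiff_d: "symbol f p p 2 (\<lambda>\<omega>. \<delta> (d \<omega>)) (\<lambda>\<omega>. \<kappa> (\<epsilon> \<omega>))"
  using symbol_comp[OF f symbol_d symbol_codiff] by (simp only: one_add_one)

lemma symbol_d_codiff: "symbol f p p 2 (\<lambda>\<omega>. d (\<delta> \<omega>)) (\<lambda>\<omega>. \<epsilon> (\<kappa> \<omega>))"
proof (cases p)
  case 0
  show ?thesis
    by (rule symbol_cong[OF f _ _ symbol_zero[OF f]]) (simp_all add: 0 codiff_0 d_0 codiff_comm_0[OF _ f] d_comm_0)
next
  case (Suc q)
  show ?thesis using symbol_comp[OF f symbol_codiff symbol_d] by (simp only: one_add_one Suc)
qed

text \<open>This is the symbol of \<open>d\<^sup>2 = 0\<close>.\<close>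

lemma d_comm_d_comm:
  assumes "\<omega> \<in> forms \<A> p"
  shows "\<epsilon> (\<epsilon> \<omega>) = 0"
proof -
  have "symbol f p (Suc (Suc p)) (1 + 1) (\<lambda>_. 0) (\<lambda>\<omega>. \<epsilon> (\<epsilon> \<omega>))"
    by (rule symbol_cong[OF f _ _ symbol_comp[OF f symbol_d symbol_d]]) (simp_all add: ext_d_ext_d)
  from symbol_unique[OF f this symbol_zero[OF f] assms] show ?thesis by simp
qed

lemma linear_codiff_comm_d_comm: "linear_op \<A> p p (\<lambda>\<omega>. \<kappa> (\<epsilon> \<omega>))"
  by (rule linear_op_comp[OF linear_d_comm linear_codiff_comm])

lemma d_comm_codiff_comm_in_forms: "\<omega> \<in> forms \<A> p \<Longrightarrow> \<epsilon> (\<kappa> \<omega>) \<in> forms \<A> p"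
  by (cases p) (auto simp: codiff_comm_0[OF _ f] d_comm_0 d_comm_in_forms[OF codiff_comm_Suc_in_forms[OF _ f] f])

lemma d_comm_d_comm_codiff_comm: "\<omega> \<in> forms \<A> p \<Longrightarrow> \<epsilon> (\<epsilon> (\<kappa> \<omega>)) = 0"
  by (cases p) (auto simp: codiff_comm_0[OF _ f] d_comm_0 d_comm_d_comm[OF codiff_comm_Suc_in_forms[OF _ f]])

text \<open>Up to sign \<open>\<kappa>\<close> is the adjoint of \<open>\<epsilon>\<close>, so \<open>\<kappa> \<epsilon>\<close> is self-adjoint and semidefinite and
  nilpotency forces \<open>\<epsilon>\<close> to vanish.\<close>

lemma d_comm_eq_0_of_cube:
  assumes "\<omega> \<in> forms \<A> p" and \<phi>: "\<phi> \<in> smooth_funs \<A>" "\<And>q \<theta>. \<theta> \<in> forms \<A> q \<Longrightarrow> test_form q (fmult \<phi> \<theta>)"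
    and cube: "\<kappa> (\<epsilon> (\<kappa> (\<epsilon> (\<kappa> (\<epsilon> \<omega>))))) = 0"
  shows "fmult \<phi> (\<epsilon> \<omega>) = 0"
proof -
  let ?X = "\<lambda>\<omega>. \<kappa> (\<epsilon> \<omega>)"
  have X: "?X \<theta> \<in> forms \<A> p" if "\<theta> \<in> forms \<A> p" for \<theta>
    using linear_opD(1)[OF linear_codiff_comm_d_comm that] .
  have X_mult: "?X (fmult \<phi> \<theta>) = fmult \<phi> (?X \<theta>)" if "\<theta> \<in> forms \<A> p" for \<theta>
    using that \<phi>(1) f by (simp add: d_comm_fmult codiff_comm_fmult[of _ "Suc p"])
  define a0 where "a0 = fmult \<phi> \<omega>"
  define a1 where "a1 = fmult \<phi> (?X \<omega>)"
  define a2 where "a2 = fmult \<phi> (?X (?X \<omega>))"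
  note X1 = X[OF assms(1)] and X2 = X[OF X[OF assms(1)]]
  have t: "test_form p a0" "test_form p a1" "test_form p a2"
    using \<phi>(2) assms(1) X1 X2 by (auto simp: a0_def a1_def a2_def)
  have e: "a1 = ?X a0" "a2 = ?X a1" "?X a2 = 0"
    using X_mult assms(1) X1 X2 cube by (simp_all add: a0_def a1_def a2_def fmult_simps)
  have adj: "pairing p \<alpha> (?X \<beta>) = - pairing (Suc p) (\<epsilon> \<alpha>) (\<epsilon> \<beta>)" if "test_form p \<alpha>" "\<beta> \<in> forms \<A> p" for \<alpha> \<beta>
    using codiff_comm_adjoint[OF that(1) d_comm_in_forms[OF that(2) f] f] .
  have sym: "pairing p \<alpha> (?X \<beta>) = pairing p \<beta> (?X \<alpha>)" if "test_form p \<alpha>" "test_form p \<beta>" for \<alpha> \<beta>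
    using adj[OF that(1) test_form_in_forms[OF that(2)]] adj[OF that(2) test_form_in_forms[OF that(1)]]
      pairing_commute[of "Suc p" "\<epsilon> \<alpha>"] by simp
  \<comment> \<open>\<open>|a\<^sub>2|\<^sup>2 = \<langle>a\<^sub>2, X a\<^sub>1\<rangle> = \<langle>a\<^sub>1, X a\<^sub>2\<rangle> = 0\<close>, and likewise one step down\<close>
  have "pairing p a2 a2 = 0"
    using sym[OF t(3) t(2)] unfolding e(2)[symmetric] e(3) by (simp add: pairing_0_right)
  then have a2: "a2 = 0" by (rule pairing_self_eq_0D[OF t(3)])
  have "pairing p a1 a1 = 0"
    using sym[OF t(2) t(1)] unfolding e(1)[symmetric] e(2)[symmetric] a2 by (simp add: pairing_0_right)
  then have a1: "a1 = 0" by (rule pairing_self_eq_0D[OF t(2)])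
  have "pairing (Suc p) (\<epsilon> a0) (\<epsilon> a0) = 0"
    using adj[OF t(1) test_form_in_forms[OF t(1)]] unfolding e(1)[symmetric] a1 by (simp add: pairing_0_right)
  moreover have "\<epsilon> a0 = fmult \<phi> (\<epsilon> \<omega>)"
    using assms(1) \<phi>(1) f by (simp add: a0_def d_comm_fmult)
  ultimately show ?thesis
    using pairing_self_eq_0D[OF \<phi>(2)[OF d_comm_in_forms[OF assms(1) f]]] by simp
qed

text \<open>The constant term of the second factor has lower order and drops out.\<close>

lemma symbol_P_tilde:
  "symbol f p p 4 (P_tilde d \<delta> J l)
    (\<lambda>\<omega>. (\<lambda>\<theta>. fscale ((2 * real l + 1) / 2) (\<kappa> (\<epsilon> \<theta>)) + fscale ((2 * real l - 1) / 2) (\<epsilon> (\<kappa> \<theta>))) (\<epsilon> (\<kappa> \<omega>) - \<kappa> (\<epsilon> \<omega>)))"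
proof -
  let ?c = "2 * real l * (2 * J / real CARD('n))"
  have id: "symbol f p p 2 (\<lambda>\<omega>. \<omega>) (\<lambda>_. 0)"
    using diff_op_symbol_0[OF f diff_op_Suc[OF diff_op_id[of p]]] by (simp only: numeral_2_eq_2)
  have "symbol f p p 2 (\<lambda>\<omega>. d (\<delta> \<omega>) - \<delta> (d \<omega>)) (\<lambda>\<omega>. \<epsilon> (\<kappa> \<omega>) - \<kappa> (\<epsilon> \<omega>))"
    unfolding diff_eq_fscale by (rule symbol_add_fscale[OF f symbol_d_codiff symbol_codiff_d])
  from symbol_add_fscale[OF f this id, of 1 ?c]
  have "symbol f p p 2 (\<lambda>\<omega>. fscale 1 (d (\<delta> \<omega>) - \<delta> (d \<omega>)) + fscale ?c \<omega>) (\<lambda>\<omega>. \<epsilon> (\<kappa> \<omega>) - \<kappa> (\<epsilon> \<omega>))"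
    by (simp only: fscale_simps(4,6) add_0_right)
  from symbol_comp[OF f this symbol_add_fscale[OF f symbol_codiff_d symbol_d_codiff]]
  show ?thesis unfolding P_tilde_apply by (simp only: numeral_plus_numeral Num.add_num_simps)
qed

text \<open>With \<open>X = \<kappa> \<epsilon>\<close> and \<open>Y = \<epsilon> \<kappa>\<close> one has \<open>X Y = 0\<close>, as \<open>\<epsilon>\<^sup>2 = 0\<close>. The vanishing symbol is
  \<open>(a X + b Y) (Y - X)\<close> with \<open>a > 0\<close>, and composing with \<open>X\<close> leaves \<open>- a X\<^sup>3\<close>.\<close>

lemma cube_eq_0_of_low_order:
  assumes "diff_op \<A> p p 3 (P_tilde d \<delta> J l)" and \<omega>: "\<omega> \<in> forms \<A> p"
  shows "\<kappa> (\<epsilon> (\<kappa> (\<epsilon> (\<kappa> (\<epsilon> \<omega>))))) = 0"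
proof -
  let ?X = "\<lambda>\<omega>. \<kappa> (\<epsilon> \<omega>)" and ?Y = "\<lambda>\<omega>. \<epsilon> (\<kappa> \<omega>)"
  let ?a = "(2 * real l + 1) / 2" and ?b = "(2 * real l - 1) / 2"
  note linX = linear_opD[OF linear_codiff_comm_d_comm]
  have X: "?X \<theta> \<in> forms \<A> p" if "\<theta> \<in> forms \<A> p" for \<theta> using linX(1)[OF that] .
  have Y: "?Y \<theta> \<in> forms \<A> p" if "\<theta> \<in> forms \<A> p" for \<theta> using d_comm_codiff_comm_in_forms[OF that] .
  have XY: "?X (?Y \<theta>) = 0" if "\<theta> \<in> forms \<A> p" for \<theta>
    using d_comm_d_comm_codiff_comm[OF that] codiff_comm_of_0 by simp
  define \<theta> where "\<theta> = ?Y \<omega> - ?X \<omega>"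
  have \<theta>: "\<theta> \<in> forms \<A> p" unfolding \<theta>_def using X Y \<omega> by simp
  have "symbol f p p (Suc 3) (P_tilde d \<delta> J l) (\<lambda>_. 0)"
    by (rule diff_op_symbol_0[OF f assms(1)])
  then have "symbol f p p 4 (P_tilde d \<delta> J l) (\<lambda>_. 0)" by (simp only: Suc_numeral Num.add_num_simps)
  from symbol_unique[OF f symbol_P_tilde this \<omega>]
  have "fscale ?a (?X \<theta>) + fscale ?b (?Y \<theta>) = 0" unfolding \<theta>_def .
  then have "?X (fscale ?a (?X \<theta>) + fscale ?b (?Y \<theta>)) = 0"
    using linear_op_0[OF linear_codiff_comm_d_comm] by simp
  then have "fscale ?a (?X (?X \<theta>)) = 0"
    unfolding linX(2)[OF fscale_in_forms[OF X[OF \<theta>]] fscale_in_forms[OF Y[OF \<theta>]]] linX(3)[OF X[OF \<theta>]] linX(3)[OF Y[OF \<theta>]] XY[OF \<theta>]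
    by (simp only: fscale_simps(6) add_0_right)
  then have "fscale (1 / ?a) (fscale ?a (?X (?X \<theta>))) = 0" by (simp only: fscale_simps(6))
  moreover have "1 / ?a * ?a = 1" by (simp add: field_simps add_nonneg_eq_0_iff)
  ultimately have XX: "?X (?X \<theta>) = 0" by (simp only: fscale_simps(3,4))
  have "?X \<theta> = ?X (?Y \<omega>) - ?X (?X \<omega>)"
    unfolding \<theta>_def by (rule linX(4)[OF Y[OF \<omega>] X[OF \<omega>]])
  then have "?X \<theta> = fscale (-1) (?X (?X \<omega>))"
    unfolding XY[OF \<omega>] diff_eq_fscale by (simp only: fscale_simps(6) add_0_left)
  then have "fscale (-1) (?X (?X (?X \<omega>))) = 0"
    using XX linX(3)[OF X[OF X[OF \<omega>]], of "-1"] by simp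
  then have "fscale (-1) (fscale (-1) (?X (?X (?X \<omega>)))) = 0" by (simp only: fscale_simps(6))
  then show ?thesis by (simp add: fscale_simps)
qed

end

lemma not_diff_op_P_tilde:
  assumes p: "p < CARD('n)"
  shows "\<not> diff_op \<A> p p 3 (P_tilde d \<delta> J l)"
proof
  assume low: "diff_op \<A> p p 3 (P_tilde d \<delta> J l)"
  obtain \<omega> f where \<omega>: "\<omega> \<in> forms \<A> p" and f: "f \<in> smooth_funs \<A>" and ne: "d_comm f \<omega> \<noteq> 0"
    using exists_d_comm_nonzero[OF p] .
  have F: "d_comm f \<omega> \<in> forms \<A> (Suc p)" using \<omega> f by simp
  have "\<exists>c x vs. d_comm f \<omega> c x vs \<noteq> 0"
    using ne by (simp only: fun_eq_iff zero_fun_apply not_all simp_thms)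
  then obtain c x vs where x: "d_comm f \<omega> c x vs \<noteq> 0" by blast
  then have c: "c \<in> \<A>" "x \<in> cimg c" using form_zero[OF F] by blast+
  obtain \<phi> K where \<phi>: "\<phi> \<in> smooth_funs \<A>" "\<phi> (cinv c x) > 0" "compact K" "K \<subseteq> cdom c" "\<And>m. m \<notin> K \<Longrightarrow> \<phi> m = 0"
    using chart_bump_exists[OF c(1) cinv_in[OF c]] by metis
  have "test_form q (fmult \<phi> \<theta>)" if "\<theta> \<in> forms \<A> q" for q \<theta>
    unfolding test_form_def using that \<phi> c(1) supp_in_fmult_left[of K \<phi> \<theta>] by (meson fmult_in_forms)
  then have "fmult \<phi> (d_comm f \<omega>) = 0"
    by (rule d_comm_eq_0_of_cube[OF f \<omega> \<phi>(1) _ cube_eq_0_of_low_order[OF f low \<omega>]])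
  then have "fmult \<phi> (d_comm f \<omega>) c x vs = 0" by (simp add: zero_fun_apply)
  then have "\<phi> (cinv c x) * d_comm f \<omega> c x vs = 0" by (simp add: fmult_def)
  then show False using \<phi>(2) x by simp
qed

lemma order_P_tilde:
  assumes "p < CARD('n)"
  shows "diff_op_of_order \<A> p p 4 (P_tilde d \<delta> J l)"
  unfolding diff_op_of_order_def
proof (intro conjI allI impI diff_op_P_tilde)
  fix j :: nat assume "j < 4"
  then have "j \<le> 3" by simp
  then show "\<not> diff_op \<A> p p j (P_tilde d \<delta> J l)"
    using diff_op_mono not_diff_op_P_tilde[OF assms] by blast
qed

end

section \<open>Polynomials in a pair of mutually annihilating operators\<close>

context oriented_atlas
begin

declare plus_fun_apply [simp del] minus_apply [simp del] zero_fun_apply [simp del]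

lemma sum_op_apply: "(\<Sum>i\<in>I. F i) \<omega> = (\<Sum>i\<in>I. F i \<omega>)" for F :: "'i \<Rightarrow> ('m, 'n) operator"
  by (induction I rule: infinite_finite_induct) (simp_all add: zero_fun_apply plus_fun_apply)

lemma opoly_apply: "opoly P A \<omega> = (\<Sum>i\<le>degree P. fscale (coeff P i) ((A ^^ i) \<omega>))"
  for A :: "('m, 'n) operator"
  by (simp add: opoly_def sum_op_apply oscale_def)

lemma opoly_0: "opoly 0 A \<omega> = 0" for A :: "('m, 'n) operator"
  by (simp add: opoly_apply fscale_simps)

context
  fixes p A assumes A: "linear_op \<A> p p A"
begin

lemma linear_op_sum:
  assumes "finite I" "\<And>i. i \<in> I \<Longrightarrow> g i \<in> forms \<A> p"
  shows "(\<Sum>i\<in>I. g i) \<in> forms \<A> p \<and> A (\<Sum>i\<in>I. g i) = (\<Sum>i\<in>I. A (g i))"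
  using assms
proof (induction I rule: finite_induct)
  case empty
  show ?case using linear_op_0[OF A] by simp
next
  case (insert i I)
  then show ?case using linear_opD(2)[OF A, of "g i" "\<Sum>i\<in>I. g i"] by simp
qed

lemma funpow_in_forms: "\<omega> \<in> forms \<A> p \<Longrightarrow> (A ^^ i) \<omega> \<in> forms \<A> p"
  by (induction i) (auto simp: linear_opD(1)[OF A])

lemma opoly_in_forms: "\<omega> \<in> forms \<A> p \<Longrightarrow> opoly P A \<omega> \<in> forms \<A> p"
  unfolding opoly_apply by (rule conjunct1[OF linear_op_sum]) (auto simp: funpow_in_forms)

lemma opoly_pCons:
  assumes "\<omega> \<in> forms \<A> p"
  shows "opoly (pCons a P) A \<omega> = fscale a \<omega> + A (opoly P A \<omega>)"
proof (cases "P = 0")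
  case True
  then show ?thesis using linear_op_0[OF A] by (simp add: opoly_0) (simp add: opoly_apply)
next
  case False
  have "A (opoly P A \<omega>) = (\<Sum>i\<le>degree P. A (fscale (coeff P i) ((A ^^ i) \<omega>)))"
    unfolding opoly_apply by (rule conjunct2[OF linear_op_sum]) (auto simp: funpow_in_forms[OF assms])
  also have "\<dots> = (\<Sum>i\<le>degree P. fscale (coeff P i) ((A ^^ Suc i) \<omega>))"
    using linear_opD(3)[OF A funpow_in_forms[OF assms]] by simp
  finally show ?thesis using False by (simp add: opoly_apply sum.atMost_Suc_shift del: sum.atMost_Suc funpow.simps)
qed

lemma opoly_const: "\<omega> \<in> forms \<A> p \<Longrightarrow> opoly [:a:] A \<omega> = fscale a \<omega>"
  using linear_op_0[OF A] by (simp add: opoly_pCons opoly_0)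

lemma linear_opoly: "linear_op \<A> p p (opoly P A)"
proof (induction P)
  case 0
  show ?case by (rule linear_op_cong[OF _ linear_op_zero]) (simp add: opoly_0)
next
  case (pCons a P)
  have "linear_op \<A> p p (\<lambda>\<omega>. fscale a (id \<omega>) + A (opoly P A \<omega>))"
    by (intro linear_op_add linear_op_fscale linear_op_id linear_op_comp[OF pCons.IH A])
  then show ?case by (rule linear_op_cong[rotated]) (simp add: opoly_pCons)
qed

lemma opoly_add:
  assumes "\<omega> \<in> forms \<A> p"
  shows "opoly (P + Q) A \<omega> = opoly P A \<omega> + opoly Q A \<omega>"
proof (induction P Q rule: poly_induct2)
  case (pCons a P b Q)
  then show ?case
    using linear_opD(2)[OF A opoly_in_forms[OF assms] opoly_in_forms[OF assms], of P Q]
    by (simp add: opoly_pCons[OF assms] fscale_add_left)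
qed (simp add: opoly_0)

lemma opoly_smult:
  assumes "\<omega> \<in> forms \<A> p"
  shows "opoly (smult a P) A \<omega> = fscale a (opoly P A \<omega>)"
proof (induction P)
  case (pCons b P)
  then show ?case using linear_opD(3)[OF A opoly_in_forms[OF assms], of a P]
    by (simp add: opoly_pCons[OF assms] fscale_simps)
qed (simp add: opoly_0 fscale_simps)

lemma opoly_mult:
  assumes "\<omega> \<in> forms \<A> p"
  shows "opoly (P * Q) A \<omega> = opoly P A (opoly Q A \<omega>)"
proof (induction P)
  case (pCons a P)
  then show ?case
    by (simp add: opoly_pCons[OF assms] opoly_pCons[OF opoly_in_forms[OF assms]] opoly_add[OF assms] opoly_smult[OF assms]
        fscale_simps)
qed (simp add: opoly_0)

end

end

locale annihilating_pair = oriented_atlas \<A>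
  for \<A> :: "('m::{t2_space, second_countable_topology}, 'n::finite) chart set" +
  fixes p :: nat and A B :: "('m, 'n) operator"
  assumes A: "linear_op \<A> p p A" and B: "linear_op \<A> p p B"
    and AB: "\<omega> \<in> forms \<A> p \<Longrightarrow> A (B \<omega>) = 0" and BA: "\<omega> \<in> forms \<A> p \<Longrightarrow> B (A \<omega>) = 0"
begin

declare plus_fun_apply [simp del] minus_apply [simp del] zero_fun_apply [simp del]

lemma swap: "annihilating_pair \<A> p B A"
  using A B AB BA by unfold_locales

lemma A_opoly_B:
  assumes "\<omega> \<in> forms \<A> p"
  shows "A (opoly Q B \<omega>) = fscale (poly Q 0) (A \<omega>)"
proof (cases Q)
  case (pCons q Q')
  have "A (B (opoly Q' B \<omega>)) = 0" by (rule AB[OF opoly_in_forms[OF B assms]])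
  then show ?thesis
    using linear_opD(2)[OF A fscale_in_forms[OF assms] linear_opD(1)[OF B opoly_in_forms[OF B assms]]] linear_opD(3)[OF A assms]
    by (simp add: pCons opoly_pCons[OF B assms])
qed

text \<open>This is the relation \<open>P(x) Q(y) = Q(0) P(x) + P(0) Q(y) - P(0) Q(0)\<close> in \<open>\<real>[x, y]/(xy)\<close>.\<close>

lemma opoly_A_opoly_B:
  assumes "\<omega> \<in> forms \<A> p"
  shows "opoly P A (opoly Q B \<omega>) = fscale (poly Q 0) (opoly P A \<omega>) + fscale (poly P 0) (opoly Q B \<omega> - fscale (poly Q 0) \<omega>)"
proof (induction P)
  case 0
  show ?case by (simp add: opoly_0 fscale_simps)
next
  case (pCons a P)
  let ?\<eta> = "opoly Q B \<omega>" and ?q = "poly Q 0"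
  note \<eta> = opoly_in_forms[OF B assms, of Q] and P = opoly_in_forms[OF A assms, of P]
  have A_lin: "A (fscale x \<alpha> + fscale y \<beta>) = fscale x (A \<alpha>) + fscale y (A \<beta>)"
    if "\<alpha> \<in> forms \<A> p" "\<beta> \<in> forms \<A> p" for x y \<alpha> \<beta>
    using that linear_opD(2)[OF A fscale_in_forms[OF that(1)] fscale_in_forms[OF that(2)]] linear_opD(3)[OF A] by simp
  have "A (?\<eta> - fscale ?q \<omega>) = 0"
    using linear_opD(4)[OF A \<eta> fscale_in_forms[OF assms]] linear_opD(3)[OF A assms] A_opoly_B[OF assms] by simp
  then have "A (opoly P A ?\<eta>) = fscale ?q (A (opoly P A \<omega>))"
    unfolding pCons.IH using A_lin[OF P diff_in_forms[OF \<eta> fscale_in_forms[OF assms]]] by (simp add: fscale_simps)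
  then show ?case
    unfolding opoly_pCons[OF A \<eta>] opoly_pCons[OF A assms]
    by (simp add: fun_eq_iff fscale_def plus_fun_apply minus_apply algebra_simps)
qed

text \<open>\<open>represents P Q D\<close>: the operator \<open>D\<close> is the image of the class in \<open>\<real>[x, y]/(xy)\<close> that restricts
  to \<open>P\<close> on the axis \<open>y = 0\<close> and to \<open>Q\<close> on the axis \<open>x = 0\<close>.\<close>

definition represents :: "real poly \<Rightarrow> real poly \<Rightarrow> ('m, 'n) operator \<Rightarrow> bool" where
  "represents P Q D \<longleftrightarrow> poly P 0 = poly Q 0 \<and>
     (\<forall>\<omega>\<in>forms \<A> p. D \<omega> = opoly P A \<omega> + opoly Q B \<omega> - fscale (poly P 0) \<omega>)"

text \<open>An element of \<open>\<real>[x, y]/(xy)\<close> is determined by its restrictions to the two axes. This reduces an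
  identity between operators to two identities between polynomial functions of one variable.\<close>

lemma represents_unique:
  assumes "represents P Q D" "represents P' Q' D'" "\<And>z. poly P z = poly P' z" "\<And>z. poly Q z = poly Q' z" "\<omega> \<in> forms \<A> p"
  shows "D \<omega> = D' \<omega>"
proof -
  have "P = P'" "Q = Q'" using assms(3,4) by (auto simp: poly_eq_poly_eq_iff[symmetric] fun_eq_iff)
  then show ?thesis using assms by (simp add: represents_def)
qed

lemma represents_linear:
  assumes "represents P Q D"
  shows "linear_op \<A> p p D"
proof (rule linear_op_cong)
  show "linear_op \<A> p p (\<lambda>\<omega>. (opoly P A \<omega> + opoly Q B \<omega>) + fscale (- poly P 0) (id \<omega>))"
    by (intro linear_op_add linear_op_fscale linear_op_id linear_opoly A B)
  show "(opoly P A \<omega> + opoly Q B \<omega>) + fscale (- poly P 0) (id \<omega>) = D \<omega>" if "\<omega> \<in> forms \<A> p" for \<omega>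
    using assms that by (simp add: represents_def fun_eq_iff fscale_def plus_fun_apply minus_apply)
qed

lemma represents_const: "represents [:a:] [:a:] (a *\<^sub>o id)"
  by (simp add: represents_def opoly_const[OF A] opoly_const[OF B] oscale_def)

lemma represents_A: "represents [:0, 1:] 0 A"
  by (auto simp: represents_def opoly_pCons[OF A] opoly_const[OF A] opoly_0 fscale_simps linear_op_0[OF A])

lemma represents_B: "represents 0 [:0, 1:] B"
  by (auto simp: represents_def opoly_pCons[OF B] opoly_const[OF B] opoly_0 fscale_simps linear_op_0[OF B])

lemma represents_add: "represents P Q D \<Longrightarrow> represents P' Q' D' \<Longrightarrow> represents (P + P') (Q + Q') (D + D')"
  by (auto simp: represents_def plus_fun_apply[of D D'] opoly_add[OF A] opoly_add[OF B] fscale_add_left)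

lemma represents_scale: "represents P Q D \<Longrightarrow> represents (smult a P) (smult a Q) (a *\<^sub>o D)"
  by (auto simp: represents_def oscale_def opoly_smult[OF A] opoly_smult[OF B] fscale_simps)

lemma represents_diff:
  assumes "represents P Q D" "represents P' Q' D'"
  shows "represents (P - P') (Q - Q') (D - D')"
proof -
  have eq: "D - D' = D + (-1) *\<^sub>o D'"
    by (intro ext) (simp add: oscale_def fscale_def plus_fun_apply minus_apply)
  show ?thesis unfolding eq using represents_add[OF assms(1) represents_scale[OF assms(2), of "-1"]] by simp
qed

lemma represents_comp:
  assumes D: "represents P Q D" and D': "represents P' Q' D'"
  shows "represents (P * P') (Q * Q') (D \<circ> D')"
  unfolding represents_def
proof (intro conjI ballI)
  show "poly (P * P') 0 = poly (Q * Q') 0" using assms by (simp add: represents_def)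
  fix \<omega> assume \<omega>: "\<omega> \<in> forms \<A> p"
  let ?c = "poly P 0" and ?c' = "poly P' 0"
  interpret sw: annihilating_pair \<A> p B A by (rule swap)
  let ?u = "opoly P' A \<omega>" and ?v = "opoly Q' B \<omega>"
  have f: "?u \<in> forms \<A> p" "?v \<in> forms \<A> p" "?u + ?v \<in> forms \<A> p" "fscale ?c' \<omega> \<in> forms \<A> p"
    using opoly_in_forms[OF A \<omega>] opoly_in_forms[OF B \<omega>] \<omega> by auto
  have c: "poly Q 0 = ?c" "poly Q' 0 = ?c'" using assms by (simp_all add: represents_def)
  have lin: "opoly R X (?u + ?v - fscale ?c' \<omega>) = opoly R X ?u + opoly R X ?v - fscale ?c' (opoly R X \<omega>)"
    if "linear_op \<A> p p X" for R X
    using linear_opD(4)[OF linear_opoly[OF that] f(3,4)] linear_opD(2)[OF linear_opoly[OF that] f(1,2)]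
      linear_opD(3)[OF linear_opoly[OF that] \<omega>] by simp
  have D'\<omega>: "D' \<omega> = ?u + ?v - fscale ?c' \<omega>" using D' \<omega> by (simp add: represents_def)
  have "D' \<omega> \<in> forms \<A> p" using D'\<omega> f by simp
  then have "(D \<circ> D') \<omega> = opoly P A (D' \<omega>) + opoly Q B (D' \<omega>) - fscale ?c (D' \<omega>)"
    using D by (simp add: represents_def)
  also have "\<dots> = opoly (P * P') A \<omega> + opoly (Q * Q') B \<omega> - fscale (poly (P * P') 0) \<omega>"
    unfolding D'\<omega> lin[OF A] lin[OF B] opoly_mult[OF A \<omega>] opoly_mult[OF B \<omega>] opoly_A_opoly_B[OF \<omega>] sw.opoly_A_opoly_B[OF \<omega>] c
    by (simp add: fun_eq_iff fscale_def plus_fun_apply minus_apply algebra_simps)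
  finally show "(D \<circ> D') \<omega> = opoly (P * P') A \<omega> + opoly (Q * Q') B \<omega> - fscale (poly (P * P') 0) \<omega>" .
qed

lemma represents_opoly:
  assumes D: "represents P Q D"
  shows "represents (pcompose R P) (pcompose R Q) (opoly R D)"
proof (induction R)
  case 0
  show ?case by (simp add: represents_def opoly_0 fscale_simps)
next
  case (pCons a R)
  have "represents ([:a:] + P * pcompose R P) ([:a:] + Q * pcompose R Q) (a *\<^sub>o id + (D \<circ> opoly R D))"
    by (rule represents_add[OF represents_const represents_comp[OF D pCons.IH]])
  moreover have "opoly (pCons a R) D \<omega> = (a *\<^sub>o id + (D \<circ> opoly R D)) \<omega>" if "\<omega> \<in> forms \<A> p" for \<omega>
    unfolding opoly_pCons[OF represents_linear[OF D] that] by (simp add: oscale_def plus_fun_apply)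
  ultimately show ?case by (simp add: represents_def pcompose_pCons)
qed

lemma represents_oprod:
  assumes "\<And>k. k \<in> set ks \<Longrightarrow> represents (P k) (Q k) (F k)"
  shows "represents (prod_list (map P ks)) (prod_list (map Q ks)) (oprod F ks)"
  using assms
proof (induction ks)
  case Nil
  have "1 *\<^sub>o id = (id :: ('m, 'n) operator)" by (simp add: fun_eq_iff oscale_def fscale_def)
  moreover have "oprod F [] = id" by (simp only: oprod_def list.map foldr_Nil id_apply)
  ultimately show ?case using represents_const[of 1] by (metis pCons_one list.map(1) prod_list.Nil)
next
  case (Cons k ks)
  have "oprod F (k # ks) = F k \<circ> oprod F ks" by (simp only: oprod_def list.map foldr_Cons o_apply)
  moreover have "represents (P k * prod_list (map P ks)) (Q k * prod_list (map Q ks)) (F k \<circ> oprod F ks)"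
    by (rule represents_comp) (use Cons in auto)
  ultimately show ?case by (simp only: list.map prod_list.Cons)
qed

end

section \<open>Polynomial identities\<close>

text \<open>This is \<open>R\<^sub>N(y; 0)\<close>, and also the second polynomial of the Branson--Gover operator if \<open>\<beta>/2\<close> is a natural
  number below \<open>N\<close>.\<close>

definition casimir_poly :: "nat \<Rightarrow> real poly" where
  "casimir_poly N = (\<Prod>i<N. [: - (real i * (real i + 1)), 1 :])"

lemma R_poly_0: "R_poly N 0 = casimir_poly N"
  unfolding R_poly_def casimir_poly_def
  by (rule prod.reindex_bij_witness[of _ Suc "\<lambda>l. l - 1"]) (auto simp: algebra_simps)

lemma degree_casimir_poly: "degree (casimir_poly N) \<le> N"
  using degree_R_poly[of N 0] by (simp add: R_poly_0)

lemma pochhammer_eq_prod: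
  "pochhammer (b - real m + 1) (2 * m) = (\<Prod>i<m. b * (b + 1) - real i * (real i + 1))" for b :: real
proof (induction m)
  case (Suc m)
  have "pochhammer (b - real (Suc m) + 1) (2 * Suc m) = pochhammer (b - real m) (Suc (Suc (2 * m)))" by simp
  also have "\<dots> = (b - real m) * (pochhammer (b - real m + 1) (2 * m) * (b + real m + 1))"
    unfolding pochhammer_rec[of "b - real m"] pochhammer_Suc[of "b - real m + 1"] by simp
  finally show ?case unfolding Suc.IH prod.lessThan_Suc by (simp add: algebra_simps)
qed simp

text \<open>Telescoping: each summand is the difference of two consecutive products in which the
  factors \<open>y - i (i + 1)\<close> are replaced one by one by \<open>b (b + 1) - i (i + 1)\<close>.\<close>

lemma poly_R1_poly:
  fixes b :: real
  shows "poly (R1_poly (2 * b) N) y = (\<Prod>i<N. y - real i * (real i + 1)) - (\<Prod>i<N. b * (b + 1) - real i * (real i + 1))"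
proof -
  let ?a = "\<lambda>i. real i * (real i + 1)" and ?c = "b * (b + 1)"
  define f where "f = (\<lambda>m. (\<Prod>i<m. ?c - ?a i) * (\<Prod>i\<in>{m..<N}. y - ?a i))"
  have R: "poly (R_poly j (real N)) y = (\<Prod>i\<in>{N - j..<N}. y - ?a i)" if "j \<le> N" for j
    unfolding R_poly_def poly_prod
    by (rule prod.reindex_bij_witness[of _ "\<lambda>i. N - i" "\<lambda>l. N - l"]) (use that in \<open>auto simp: of_nat_diff\<close>)
  have "poly (R1_poly (2 * b) N) y = (\<Sum>j=1..N. pochhammer (b - real N + real j + 1) (2 * (N - j)) * ((y - ?c) * poly (R_poly (j - 1) (real N)) y))"
    by (simp add: R1_poly_def poly_sum left_diff_distrib)
  also have "\<dots> = (\<Sum>m<N. f m - f (Suc m))"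
  proof (rule sum.reindex_bij_witness[of _ "\<lambda>m. N - m" "\<lambda>j. N - j"])
    fix j assume j: "j \<in> {1..N}"
    let ?m = "N - j"
    have "b - real N + real j + 1 = b - real ?m + 1" using j by (simp add: of_nat_diff)
    then have e1: "pochhammer (b - real N + real j + 1) (2 * (N - j)) = (\<Prod>i<?m. ?c - ?a i)"
      using pochhammer_eq_prod[of b ?m] by (simp only:)
    have "{N - (j - 1)..<N} = {Suc ?m..<N}" using j by auto
    then have e2: "poly (R_poly (j - 1) (real N)) y = (\<Prod>i\<in>{Suc ?m..<N}. y - ?a i)"
      using R[of "j - 1"] j by (metis diff_le_self le_trans atLeastAtMost_iff)
    have "{?m..<N} = insert ?m {Suc ?m..<N}" using j by auto
    then have e3: "(\<Prod>i\<in>{?m..<N}. y - ?a i) = (y - ?a ?m) * (\<Prod>i\<in>{Suc ?m..<N}. y - ?a i)" by simp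
    show "f ?m - f (Suc ?m) = pochhammer (b - real N + real j + 1) (2 * (N - j)) * ((y - ?c) * poly (R_poly (j - 1) (real N)) y)"
      unfolding f_def e1 e2 e3 prod.lessThan_Suc by (simp add: algebra_simps)
  qed auto
  also have "\<dots> = f 0 - f N" by (rule sum_lessThan_telescope')
  finally show ?thesis by (simp add: f_def atLeast0LessThan)
qed

text \<open>The product subtracted in the telescoped form contains the factor with \<open>i = l\<close>, which is zero.\<close>

lemma R1_poly_eq:
  assumes "l < N"
  shows "R1_poly (2 * real l) N = casimir_poly N"
proof -
  have "(\<Prod>i<N. real l * (real l + 1) - real i * (real i + 1)) = 0"
    by (rule prod_zero) (use assms in auto)
  then have "poly (R1_poly (2 * real l) N) y = poly (casimir_poly N) y" for y
    by (simp add: poly_R1_poly casimir_poly_def poly_prod)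
  then show ?thesis by (simp add: poly_eq_poly_eq_iff[symmetric] fun_eq_iff)
qed

text \<open>A product formula valid for every \<open>t\<close>. For \<open>t = 0\<close> only the leading coefficient \<open>1\<close> survives.\<close>

lemma poly_hom_casimir_poly:
  "poly (hom_poly N t s (casimir_poly N)) z = (\<Prod>i<N. z + t * (s - real i * (real i + 1)))"
proof (cases "t = 0")
  case False
  then have "poly (hom_poly N t s (casimir_poly N)) z = t ^ N * (\<Prod>i<N. z / t + s - real i * (real i + 1))"
    unfolding poly_hom_poly[OF degree_casimir_poly False] by (simp add: casimir_poly_def poly_prod)
  also have "\<dots> = (\<Prod>i<N. t * (z / t + s - real i * (real i + 1)))" by (simp add: prod.distrib)
  finally show ?thesis using False by (simp add: algebra_simps)
next
  case True
  let ?q = "pcompose (casimir_poly N) [: s, 1 :]"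
  have q: "?q = (\<Prod>i<N. [: s - real i * (real i + 1), 1 :])"
    by (simp add: casimir_poly_def pcompose_prod pcompose_pCons)
  have "degree ?q = N" unfolding q by (subst degree_prod_eq_sum_degree) auto
  moreover have "lead_coeff ?q = 1" unfolding q by (simp add: lead_coeff_prod)
  ultimately have "coeff ?q N = 1" by simp
  moreover have "hom_poly N 0 s (casimir_poly N) = (\<Sum>i\<le>N. if i = N then monom (coeff ?q N) N else 0)"
    unfolding hom_poly_def by (intro sum.cong) auto
  ultimately show ?thesis using True by (simp add: poly_monom)
qed

abbreviation casimir_prod :: "nat \<Rightarrow> real \<Rightarrow> real \<Rightarrow> real \<Rightarrow> real" where
  "casimir_prod N t s z \<equiv> (\<Prod>i<N. z + t * (s - real i * (real i + 1)))"

lemma casimir_prod_eq_0: "i < N \<Longrightarrow> casimir_prod N t (real i * (real i + 1)) 0 = 0"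
  by (rule prod_zero) auto

lemma casimir_prod_factored:
  "casimir_prod N t (b * (b - 1)) z = (\<Prod>k=1..N. z + t * ((b - real k) * (b + real k - 1)))"
  by (simp add: prod.atLeast1_atMost_eq algebra_simps)

lemma casimir_prod_factored':
  "casimir_prod N t (b * (b + 1)) z = (\<Prod>k=1..N. z + t * ((b - real k + 1) * (b + real k)))"
  by (simp add: prod.atLeast1_atMost_eq algebra_simps)

context
  fixes l N :: nat and S :: "nat set"
  assumes l: "1 \<le> l" "l < N"
  defines "S \<equiv> {1..N} - {l, l + 1}"
begin

lemma prod_split_off: "(\<Prod>k=1..N. g k) = g l * g (l + 1) * (\<Prod>k\<in>S. g k)" for g :: "nat \<Rightarrow> real"
proof -
  have eq: "{1..N} = insert l (insert (l + 1) S)" using l by (auto simp: S_def)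
  have "finite S" "l \<notin> S" "l + 1 \<notin> S" by (auto simp: S_def)
  then show ?thesis unfolding eq by simp
qed

lemma prod_shift_quotient:
  "(\<Prod>k=1..M. (real l + real k) / (real l + real k - 1)) = (real l + real M) / real l"
proof (induction M)
  case (Suc M)
  have "(\<Prod>k=1..Suc M. (real l + real k) / (real l + real k - 1))
      = (real l + real M) / real l * ((real l + real (Suc M)) / (real l + real (Suc M) - 1))"
    using Suc.IH by (simp add: prod.nat_ivl_Suc')
  also have "real l + real (Suc M) - 1 = real l + real M" by simp
  also have "(real l + real M) / real l * ((real l + real (Suc M)) / (real l + real M)) = (real l + real (Suc M)) / real l"
  proof -
    have "real l + real M \<noteq> 0" using l by linarith
    then show ?thesis by simp
  qed
  finally show ?case .
qed (use l in simp)

text \<open>Up to the quotients \<open>(l + k) / (l + k - 1)\<close>, whose product telescopes, both sides are products of the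
  same linear factors. The factors for \<open>k = l\<close> and \<open>k = l + 1\<close> are \<open>z\<close> and \<open>z - 2 l t\<close>; they come from the
  fourth-order operator.\<close>

lemma first_axis_identity:
  "(real l + real N) * casimir_prod N t (real l * (real l - 1)) z =
    - (2 * real l / (2 * real l - 1)) * ((2 * real l + 1) / 2 * z * (2 * real l * t - z)) *
    (\<Prod>k\<in>S. (real l - real k) * (real l + real k) * t + (real l + real k) / (real l + real k - 1) * z)"
proof -
  let ?u = "\<lambda>k. z + t * ((real l - real k) * (real l + real k - 1))"
  let ?w = "\<lambda>k. (real l + real k) / (real l + real k - 1)"
  define c where "c = 2 * real l / (2 * real l - 1)"
  define e where "e = (2 * real l + 1) / 2"
  have "(real l + real N) / real l = ?w l * ?w (l + 1) * (\<Prod>k\<in>S. ?w k)"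
    using prod_shift_quotient[of N] prod_split_off[of ?w] by simp
  also have "?w l * ?w (l + 1) = c * ((2 * real l + 1) / (2 * real l))" by (simp add: c_def)
  finally have W: "(real l + real N) / real l = c * ((2 * real l + 1) / (2 * real l)) * (\<Prod>k\<in>S. ?w k)" .
  have "real l + real N = real l * ((real l + real N) / real l)" using l by simp
  also have "\<dots> = c * (real l * ((2 * real l + 1) / (2 * real l))) * (\<Prod>k\<in>S. ?w k)" unfolding W by (simp only: mult_ac)
  also have "real l * ((2 * real l + 1) / (2 * real l)) = (2 * real l + 1) / 2" using l by simp
  finally have lN: "real l + real N = c * ((2 * real l + 1) / 2) * (\<Prod>k\<in>S. ?w k)" .
  have "(real l - real k) * (real l + real k) * t + ?w k * z = ?w k * ?u k" if "k \<in> S" for k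
  proof -
    have "1 \<le> k" using that by (simp add: S_def)
    then have "real l + real k - 1 \<noteq> 0" using l by linarith
    then have "?w k * (t * ((real l - real k) * (real l + real k - 1))) = (real l - real k) * (real l + real k) * t" by simp
    then show ?thesis by (simp add: distrib_left)
  qed
  then have 1: "(\<Prod>k\<in>S. (real l - real k) * (real l + real k) * t + ?w k * z) = (\<Prod>k\<in>S. ?w k) * (\<Prod>k\<in>S. ?u k)"
    by (simp only: prod.distrib[symmetric] cong: prod.cong)
  have 2: "casimir_prod N t (real l * (real l - 1)) z = z * (z - 2 * real l * t) * (\<Prod>k\<in>S. ?u k)"
    unfolding casimir_prod_factored prod_split_off by (simp add: algebra_simps)
  show ?thesis unfolding lN c_def[symmetric] e_def[symmetric] 1 2 by (simp add: algebra_simps)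
qed

lemma prod_reflected_quotient: "(\<Prod>k\<in>S. (real l - real k) / (real l - real k + 1)) = (real N - real l) / real l"
proof -
  let ?x = "\<lambda>k. (real l - real k) / (real l - real k + 1)"
  have low: "(\<Prod>k=1..m. ?x k) = (real l - real m) / real l" if "m < l" for m
    using that
  proof (induction m)
    case (Suc m)
    then have "(\<Prod>k=1..Suc m. ?x k) = (real l - real m) / real l * ((real l - real (Suc m)) / (real l - real m))"
      by (simp add: prod.nat_ivl_Suc')
    then show ?case using Suc.prems by simp
  qed (use l in simp)
  have "(\<Prod>k\<in>{1..M} - {l, l + 1}. ?x k) = (real M - real l) / real l" if "Suc l \<le> M" for M
    using that
  proof (induction M rule: dec_induct)
    case base
    have "{1..Suc l} - {l, l + 1} = {1..l - 1}" by auto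
    then show ?case using low[of "l - 1"] l by (simp add: of_nat_diff)
  next
    case (step M)
    have "{1..Suc M} - {l, l + 1} = insert (Suc M) ({1..M} - {l, l + 1})" using step by auto
    then have "(\<Prod>k\<in>{1..Suc M} - {l, l + 1}. ?x k) = ?x (Suc M) * ((real M - real l) / real l)"
      using step by simp
    also have "?x (Suc M) = (real (Suc M) - real l) / (real M - real l)"
      using step by (simp add: field_simps)
    finally show ?case using step by simp
  qed
  then show ?thesis using l by (simp add: S_def)
qed

text \<open>The same comparison on the other axis, where the quotients are \<open>(l - k) / (l - k + 1)\<close>. Here the factors
  for \<open>k = l\<close> and \<open>k = l + 1\<close> are \<open>z + 2 l t\<close> and \<open>z\<close>; the quotients for these two indices, \<open>0\<close> and a
  division by zero, are the reason why they have to be treated separately.\<close>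

lemma second_axis_identity:
  "(real l - real N) * casimir_prod N t (real l * (real l + 1)) z =
    - (2 * real l / (2 * real l - 1)) * ((2 * real l - 1) / 2 * z * (2 * real l * t + z)) *
    (\<Prod>k\<in>S. (real l - real k) * (real l + real k) * t + (real l - real k) / (real l - real k + 1) * z)"
proof -
  let ?v = "\<lambda>k. z + t * ((real l - real k + 1) * (real l + real k))"
  let ?x = "\<lambda>k. (real l - real k) / (real l - real k + 1)"
  have "(real l - real k) * (real l + real k) * t + ?x k * z = ?x k * ?v k" if "k \<in> S" for k
  proof -
    have "real l - real k + 1 \<noteq> 0" using that by (auto simp: S_def)
    then show ?thesis by (simp add: field_simps)
  qed
  then have "(\<Prod>k\<in>S. (real l - real k) * (real l + real k) * t + ?x k * z) = (\<Prod>k\<in>S. ?x k) * (\<Prod>k\<in>S. ?v k)"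
    by (simp only: prod.distrib[symmetric] cong: prod.cong)
  also have "\<dots> = (real N - real l) / real l * (\<Prod>k\<in>S. ?v k)" by (simp only: prod_reflected_quotient)
  finally have 1: "(\<Prod>k\<in>S. (real l - real k) * (real l + real k) * t + ?x k * z) = (real N - real l) / real l * (\<Prod>k\<in>S. ?v k)" .
  have 2: "casimir_prod N t (real l * (real l + 1)) z = (2 * real l * t + z) * z * (\<Prod>k\<in>S. ?v k)"
    unfolding casimir_prod_factored' prod_split_off by (simp add: algebra_simps)
  have "2 * real l / (2 * real l - 1) * ((2 * real l - 1) / 2 * z * (2 * real l * t + z)) = real l * z * (2 * real l * t + z)"
    using l by (simp add: field_simps)
  then have 3: "- (2 * real l / (2 * real l - 1)) * ((2 * real l - 1) / 2 * z * (2 * real l * t + z)) = - (real l * z * (2 * real l * t + z))"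
    by simp
  show ?thesis unfolding 1 2 3 using l by (simp add: field_simps)
qed

end

section \<open>The factorizations\<close>

lemma poly_prod_list: "poly (prod_list (map P ks)) z = prod_list (map (\<lambda>k. poly (P k) z) ks)"
  by (induction ks) auto

context hodge
begin

declare plus_fun_apply [simp del] minus_apply [simp del] zero_fun_apply [simp del]

lemma annihilating: "annihilating_pair \<A> p (\<delta> \<circ> d) (d \<circ> \<delta>)"
proof
  show "linear_op \<A> p p (\<delta> \<circ> d)" using linear_codiff_d by (simp add: o_def)
  show "linear_op \<A> p p (d \<circ> \<delta>)" using linear_d_codiff by (simp add: o_def)
  fix \<omega> assume \<omega>: "\<omega> \<in> forms \<A> p"
  show "(\<delta> \<circ> d) ((d \<circ> \<delta>) \<omega>) = 0"
    using ext_d_ext_d[OF codiff_in_forms[OF \<omega>]] by (simp add: codiff_of_0)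
  show "(d \<circ> \<delta>) ((\<delta> \<circ> d) \<omega>) = 0"
    using codiff_codiff[OF ext_d_in_forms[OF \<omega>]] by (simp add: d_0)
qed

text \<open>The values on the axes are the same product formulas for \<open>J \<noteq> 0\<close> and for the multiplied-out case
  \<open>J = 0\<close>, so the factorizations need no further case distinction.\<close>

lemma represents_branson_gover:
  fixes J :: real
  assumes b: "real CARD('n) - 2 * real p = 2 * real l" and l: "l < N"
  shows "\<exists>P Q. annihilating_pair.represents \<A> p (\<delta> \<circ> d) (d \<circ> \<delta>) P Q (branson_gover d \<delta> J p N) \<and>
    (\<forall>z. poly P z = (real l + real N) * casimir_prod N (2 * J / real CARD('n)) (real l * (real l - 1)) z
       + (real l - real N) * casimir_prod N (2 * J / real CARD('n)) (real l * (real l + 1)) 0) \<and>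
    (\<forall>z. poly Q z = (real l + real N) * casimir_prod N (2 * J / real CARD('n)) (real l * (real l - 1)) 0
       + (real l - real N) * casimir_prod N (2 * J / real CARD('n)) (real l * (real l + 1)) z)"
proof -
  interpret annihilating_pair \<A> p "\<delta> \<circ> d" "d \<circ> \<delta>" by (rule annihilating)
  define t where "t = 2 * J / real CARD('n)"
  let ?G = "\<lambda>s z. casimir_prod N (2 * J / real CARD('n)) s z"
  let ?sp = "real l * (real l - 1)" and ?s1 = "real l * (real l + 1)"
  let ?T = "casimir_poly N"
  have R1: "R1_poly (real CARD('n) - 2 * real p) N = ?T" unfolding b by (rule R1_poly_eq[OF l])
  have half: "(real CARD('n) - 2 * real p) / 2 = real l" using b by simp
  have G: "?G s z = poly (hom_poly N t s ?T) z" for s z by (simp add: t_def poly_hom_casimir_poly)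
  show ?thesis
  proof (cases "J = 0")
    case False
    let ?q = "real CARD('n) / (2 * J)"
    have t: "t \<noteq> 0" using False by (simp add: t_def)
    have G': "t ^ N * poly ?T (?q * z + s) = ?G s z" for s z
      unfolding G poly_hom_poly[OF degree_casimir_poly t] using False by (simp add: t_def mult.commute)
    have eq: "branson_gover d \<delta> J p N = (t ^ N) *\<^sub>o
        ((real l + real N) *\<^sub>o opoly ?T (?q *\<^sub>o (\<delta> \<circ> d) + ?sp *\<^sub>o id) +
         (real l - real N) *\<^sub>o opoly ?T (?q *\<^sub>o (d \<circ> \<delta>) + ?s1 *\<^sub>o id))"
      using False by (simp only: branson_gover_def Let_def R1 R_poly_0 half if_True not_False_eq_True t_def)
    have "represents
        (smult (t ^ N) (smult (real l + real N) (pcompose ?T (smult ?q [:0, 1:] + [:?sp:])) + smult (real l - real N) (pcompose ?T (smult ?q 0 + [:?s1:]))))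
        (smult (t ^ N) (smult (real l + real N) (pcompose ?T (smult ?q 0 + [:?sp:])) + smult (real l - real N) (pcompose ?T (smult ?q [:0, 1:] + [:?s1:]))))
        (branson_gover d \<delta> J p N)" (is "represents ?P ?Q _")
      unfolding eq by (intro represents_scale represents_add represents_opoly represents_const represents_A represents_B)
    moreover have "poly ?P z = (real l + real N) * ?G ?sp z + (real l - real N) * ?G ?s1 0" for z
    proof -
      have "poly ?P z = (real l + real N) * (t ^ N * poly ?T (?q * z + ?sp)) + (real l - real N) * (t ^ N * poly ?T (?q * 0 + ?s1))"
        by (simp add: poly_pcompose algebra_simps)
      then show ?thesis by (simp only: G')
    qed
    moreover have "poly ?Q z = (real l + real N) * ?G ?sp 0 + (real l - real N) * ?G ?s1 z" for z
    proof -
      have "poly ?Q z = (real l + real N) * (t ^ N * poly ?T (?q * 0 + ?sp)) + (real l - real N) * (t ^ N * poly ?T (?q * z + ?s1))"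
        by (simp add: poly_pcompose algebra_simps)
      then show ?thesis by (simp only: G')
    qed
    ultimately show ?thesis by blast
  next
    case True
    let ?H = "\<lambda>s. hom_poly N 0 s ?T"
    have eq: "branson_gover d \<delta> J p N =
        (real l + real N) *\<^sub>o opoly (?H ?sp) (\<delta> \<circ> d) + (real l - real N) *\<^sub>o opoly (?H ?s1) (d \<circ> \<delta>)"
      using True by (simp only: branson_gover_def Let_def R1 R_poly_0 half if_False not_True_eq_False simp_thms)
    have "represents
        (smult (real l + real N) (pcompose (?H ?sp) [:0, 1:]) + smult (real l - real N) (pcompose (?H ?s1) 0))
        (smult (real l + real N) (pcompose (?H ?sp) 0) + smult (real l - real N) (pcompose (?H ?s1) [:0, 1:]))
        (branson_gover d \<delta> J p N)" (is "represents ?P ?Q _")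
      unfolding eq by (intro represents_scale represents_add represents_opoly represents_A represents_B)
    moreover have "poly ?P z = (real l + real N) * ?G ?sp z + (real l - real N) * ?G ?s1 0"
      "poly ?Q z = (real l + real N) * ?G ?sp 0 + (real l - real N) * ?G ?s1 z" for z
      by (simp_all add: poly_pcompose poly_hom_casimir_poly True)
    ultimately show ?thesis by blast
  qed
qed

lemma branson_gover_factorization_pos:
  fixes J :: real
  assumes b: "real CARD('n) - 2 * real p = 2 * real l" and l: "1 \<le> l" "l < N" and \<omega>: "\<omega> \<in> forms \<A> p"
  shows "branson_gover d \<delta> J p N \<omega> =
    ((- (2 * real l / (2 * real l - 1))) *\<^sub>o
      (P_tilde d \<delta> J l \<circ>
       oprod (\<lambda>k.
           ((real l + real k) / (real l + real k - 1)) *\<^sub>o (\<delta> \<circ> d)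
         + ((real l - real k) / (real l - real k + 1)) *\<^sub>o (d \<circ> \<delta>)
         + ((real l - real k) * (real l + real k) * (2*J / real CARD('n))) *\<^sub>o id)
       (filter (\<lambda>k. k \<noteq> l \<and> k \<noteq> l + 1) [1..<N+1]))) \<omega>" (is "_ = (?c *\<^sub>o (_ \<circ> oprod ?F ?ks)) \<omega>")
proof -
  interpret annihilating_pair \<A> p "\<delta> \<circ> d" "d \<circ> \<delta>" by (rule annihilating)
  let ?t = "2 * J / real CARD('n)" and ?S = "{1..N} - {l, l + 1}"
  let ?G = "\<lambda>s z. casimir_prod N ?t s z"
  obtain P Q where PQ: "represents P Q (branson_gover d \<delta> J p N)"
    "\<And>z. poly P z = (real l + real N) * ?G (real l * (real l - 1)) z + (real l - real N) * ?G (real l * (real l + 1)) 0"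
    "\<And>z. poly Q z = (real l + real N) * ?G (real l * (real l - 1)) 0 + (real l - real N) * ?G (real l * (real l + 1)) z"
    using represents_branson_gover[OF b l(2), where J = J] by blast
  have van: "?G (real l * (real l + 1)) 0 = 0" by (rule casimir_prod_eq_0[OF l(2)])
  have "?G (real (l - 1) * (real (l - 1) + 1)) 0 = 0" by (rule casimir_prod_eq_0) (use l in simp)
  then have van': "?G (real l * (real l - 1)) 0 = 0" using l by (simp only: of_nat_diff) (simp add: mult.commute)
  let ?a = "(2 * real l + 1) / 2" and ?b = "(2 * real l - 1) / 2" and ?e = "2 * real l * ?t"
  have tilde: "represents ((smult ?a [:0, 1:] + smult ?b 0) * (0 - [:0, 1:] + [:?e:])) ((smult ?a 0 + smult ?b [:0, 1:]) * ([:0, 1:] - 0 + [:?e:]))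
      (P_tilde d \<delta> J l)"
    unfolding P_tilde_def
    by (intro represents_comp represents_add represents_diff represents_scale represents_const represents_A represents_B)
  let ?U = "\<lambda>k. smult ((real l + real k) / (real l + real k - 1)) [:0, 1:] + smult ((real l - real k) / (real l - real k + 1)) 0
      + [:(real l - real k) * (real l + real k) * ?t:]"
  let ?V = "\<lambda>k. smult ((real l + real k) / (real l + real k - 1)) 0 + smult ((real l - real k) / (real l - real k + 1)) [:0, 1:]
      + [:(real l - real k) * (real l + real k) * ?t:]"
  have prod: "represents (prod_list (map ?U ?ks)) (prod_list (map ?V ?ks)) (oprod ?F ?ks)"
    by (rule represents_oprod) (intro represents_add represents_scale represents_const represents_A represents_B)
  have ks: "prod_list (map g ?ks) = (\<Prod>k\<in>?S. g k)" for g :: "nat \<Rightarrow> real"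
  proof -
    have ks: "set ?ks = ?S" by auto
    have "distinct ?ks" by simp
    from prod.distinct_set_conv_list[OF this, of g] show ?thesis unfolding ks by (rule sym)
  qed
  have tilde_U: "poly ((smult a [:0, 1:] + smult b 0) * (0 - [:0, 1:] + [:e:])) z = a * z * (e - z)"
    and tilde_V: "poly ((smult a 0 + smult b [:0, 1:]) * ([:0, 1:] - 0 + [:e:])) z = b * z * (e + z)"
    and U: "poly (smult a [:0, 1:] + smult b 0 + [:e:]) z = e + a * z"
    and V: "poly (smult a 0 + smult b [:0, 1:] + [:e:]) z = e + b * z" for a b e z :: real
    by (simp_all add: algebra_simps)
  show ?thesis
  proof (rule represents_unique[OF PQ(1) represents_scale[OF represents_comp[OF tilde prod]] _ _ \<omega>])
    fix z
    show "poly P z = poly (smult ?c ((smult ?a [:0, 1:] + smult ?b 0) * (0 - [:0, 1:] + [:?e:]) * prod_list (map ?U ?ks))) z"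
      unfolding PQ(2) van poly_smult poly_mult[of _ "prod_list _"] poly_prod_list ks first_axis_identity[OF l] tilde_U U
      by (simp only: mult.assoc mult_zero_right add_0_right)
    show "poly Q z = poly (smult ?c ((smult ?a 0 + smult ?b [:0, 1:]) * ([:0, 1:] - 0 + [:?e:]) * prod_list (map ?V ?ks))) z"
      unfolding PQ(3) van' poly_smult poly_mult[of _ "prod_list _"] poly_prod_list ks second_axis_identity[OF l] tilde_V V
      by (simp only: mult.assoc mult_zero_right add_0_left)
  qed
qed

lemma branson_gover_factorization_0:
  fixes J :: real
  assumes b: "real CARD('n) - 2 * real p = 0" and \<omega>: "\<omega> \<in> forms \<A> p"
  shows "branson_gover d \<delta> J p N \<omega> =
    (real N *\<^sub>o
      (((\<delta> \<circ> d) - (d \<circ> \<delta>)) \<circ>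
       oprod (\<lambda>k. (\<delta> \<circ> d) + (d \<circ> \<delta>) - (real k * (real k - 1) * (2*J / real CARD('n))) *\<^sub>o id)
       [2..<N+1])) \<omega>" (is "_ = (_ *\<^sub>o (_ \<circ> oprod ?F ?ks)) \<omega>")
proof (cases "N = 0")
  case True
  then show ?thesis
    unfolding branson_gover_def Let_def b by (simp add: oscale_def fscale_simps plus_fun_apply[of "\<lambda>\<omega>. 0"])
next
  case False
  interpret annihilating_pair \<A> p "\<delta> \<circ> d" "d \<circ> \<delta>" by (rule annihilating)
  let ?t = "2 * J / real CARD('n)"
  let ?G = "\<lambda>s z. casimir_prod N ?t s z"
  have b0: "real CARD('n) - 2 * real p = 2 * real 0" using b by simp
  obtain P Q where PQ: "represents P Q (branson_gover d \<delta> J p N)"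
    "\<And>z. poly P z = (real 0 + real N) * ?G (real 0 * (real 0 - 1)) z + (real 0 - real N) * ?G (real 0 * (real 0 + 1)) 0"
    "\<And>z. poly Q z = (real 0 + real N) * ?G (real 0 * (real 0 - 1)) 0 + (real 0 - real N) * ?G (real 0 * (real 0 + 1)) z"
    using represents_branson_gover[OF b0, where J = J and N = N] False by blast
  let ?U = "\<lambda>k. [:0, 1:] + 0 - [:real k * (real k - 1) * ?t:]" and ?V = "\<lambda>k. 0 + [:0, 1:] - [:real k * (real k - 1) * ?t:]"
  have prod: "represents (prod_list (map ?U ?ks)) (prod_list (map ?V ?ks)) (oprod ?F ?ks)"
    by (rule represents_oprod) (intro represents_add represents_diff represents_const represents_A represents_B)
  have ks: "prod_list (map g ?ks) = (\<Prod>k\<in>{2..N}. g k)" for g :: "nat \<Rightarrow> real"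
  proof -
    have ks: "set ?ks = {2..N}" by auto
    have "distinct ?ks" by simp
    from prod.distinct_set_conv_list[OF this, of g] show ?thesis unfolding ks by (rule sym)
  qed
  have G: "?G 0 z = z * (\<Prod>k\<in>{2..N}. z - real k * (real k - 1) * ?t)" for z
  proof -
    have "?G 0 z = (\<Prod>k=1..N. z + ?t * ((0 - real k) * (0 + real k - 1)))"
      using casimir_prod_factored[where N = N and t = ?t and b = 0 and z = z] by simp
    also have "\<dots> = z * (\<Prod>k\<in>{2..N}. z + ?t * ((0 - real k) * (0 + real k - 1)))"
      using False by (simp add: prod.atLeast_Suc_atMost numeral_2_eq_2)
    also have "(\<Prod>k\<in>{2..N}. z + ?t * ((0 - real k) * (0 + real k - 1))) = (\<Prod>k\<in>{2..N}. z - real k * (real k - 1) * ?t)"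
    proof (rule prod.cong[OF refl])
      have "z + x * ((0 - real k) * (0 + real k - 1)) = z - real k * (real k - 1) * x" for x :: real and k
        by (simp add: algebra_simps)
      then show "z + ?t * ((0 - real k) * (0 + real k - 1)) = z - real k * (real k - 1) * ?t" for k .
    qed
    finally show ?thesis .
  qed
  show ?thesis
  proof (rule represents_unique[OF PQ(1) represents_scale[OF represents_comp[OF represents_diff[OF represents_A represents_B] prod]] _ _ \<omega>])
    fix z
    show "poly P z = poly (smult (real N) (([:0, 1:] - 0) * prod_list (map ?U ?ks))) z"
      unfolding PQ(2) poly_smult poly_mult poly_prod_list ks using G[of z] G[of 0] by simp
    show "poly Q z = poly (smult (real N) ((0 - [:0, 1:]) * prod_list (map ?V ?ks))) z"
      unfolding PQ(3) poly_smult poly_mult poly_prod_list ks using G[of z] G[of 0] by simp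
  qed
qed

end

theorem theorem4p4:
  fixes \<A> :: "('m::{t2_space, second_countable_topology}, 'n::finite) chart set"
    and h :: "('m, 'n) metric"
    and vol :: "'m measure"
    and \<delta> :: "('m, 'n) operator"
    and J :: real and N p :: nat
  defines "n \<equiv> CARD('n)"
  defines "\<beta> \<equiv> real n - 2 * real p"
  defines "d \<equiv> ext_d \<A>"
  assumes "n \<ge> 3" and "even n"
    and "p \<in> {0..n div 2}"
    and "oriented_smooth_atlas \<A>"
    and "riemannian_metric \<A> h"
    and "einstein \<A> h (2*J / real n * (real n - 1))"
    and "riemannian_volume \<A> h vol"
    and "codifferential \<A> h vol \<delta>"
  shows
    "(\<forall>l::nat. 1 \<le> l \<and> l < N \<and> \<beta> = 2 * real l \<longrightarrow>
        diff_op_of_order \<A> p p 4 (P_tilde d \<delta> J l) \<and>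
        (\<forall>\<omega>\<in>forms \<A> p.
           branson_gover d \<delta> J p N \<omega> =
           ((- (2 * real l / (2 * real l - 1))) *\<^sub>o
              (P_tilde d \<delta> J l \<circ>
               oprod (\<lambda>k.
                   ((real l + real k) / (real l + real k - 1)) *\<^sub>o (\<delta> \<circ> d)
                 + ((real l - real k) / (real l - real k + 1)) *\<^sub>o (d \<circ> \<delta>)
                 + ((real l - real k) * (real l + real k) * (2*J / real n)) *\<^sub>o id)
               (filter (\<lambda>k. k \<noteq> l \<and> k \<noteq> l + 1) [1..<N+1]))) \<omega>)) \<and>
     (\<beta> = 0 \<longrightarrow>
        (\<forall>\<omega>\<in>forms \<A> p.
           branson_gover d \<delta> J p N \<omega> =
           (real N *\<^sub>o
              (((\<delta> \<circ> d) - (d \<circ> \<delta>)) \<circ>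
               oprod (\<lambda>k. (\<delta> \<circ> d) + (d \<circ> \<delta>) - (real k * (real k - 1) * (2*J / real n)) *\<^sub>o id)
               [2..<N+1])) \<omega>))"
proof -
  have "hodge \<A> h vol \<delta>"
    using assms unfolding hodge_def hodge_axioms_def riemannian_def riemannian_axioms_def oriented_atlas_def by blast
  then interpret hodge \<A> h vol \<delta> .
  have order: "diff_op_of_order \<A> p p 4 (P_tilde d \<delta> J l)" if "1 \<le> l" "\<beta> = 2 * real l" for l
    unfolding d_def using that by (intro order_P_tilde) (simp add: \<beta>_def n_def)
  show ?thesis
    using order branson_gover_factorization_pos[of p] branson_gover_factorization_0[of p]
    unfolding d_def \<beta>_def n_def by blast
qed

end
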